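(* Let $(s_k)_{k\ge0}$ be a bounded sequence of integers with $s_0=-1$, $s_1=1$, $s_k\ge1$ for $k\ge1$, and put $\sigma=1/\limsup_{k\to\infty}[s_{k+1};s_k,\dots,s_1]$. Let $(w_i)_{i\ge0}$ be an admissible Sturmian sequence in $\mathcal{M}$ (relative to $(s_k)$) with multiplicative growth, $\|w_i\|\to\infty$ and $N$ non-symmetric; let $(y_i)$ be the associated sequence of symmetric matrices and $\delta\ge0$ the real number with $|\det w_i|\asymp\|w_i\|^\delta$. Assume that $\delta<\frac{\sigma}{1+\sigma}$ and that the content of $y_i$ is bounded. Let $\xi$ be the real number such that $(y_i)$ converges in $\mathbb{P}^2(\mathbb{R})$ to the class of $u=(1,\xi,\xi^2)$, let $\mathbf{L}_u=(L_1,L_2,L_3)$ be the successive minima map attached to $u$, and let $k_0$, $q_i$, $c_i$, $P=(P_1,P_2,P_3)$, $a_j,b_j,d_k$, $I_j=[a_j,b_j]$, $I_j'=[b_{j-1},a_j]$ be as defined in the context. Then $P$ is a $3$-system on $[q_{t_{k_0}},+\infty)$ and its combined graph (the union of the graphs of $P_1,P_2,P_3$) is of the following type. The abscissas are ordered by $a_i<q_i<b_i\le c_i\le a_{i+1}$. - Over $I_i=[a_i,b_i]$: $P_3$ has slope $1$ on $[a_i,q_i]$ and is constant on $[q_i,b_i]$. If $i=t_k+l$ with $0<l<s_{k+1}$, then $P_1$ is constant on $I_i$, while $P_2$ is constant on $[a_i,q_i]$ and has slope $1$ on $[q_i,b_i]$. If $i=t_k$, then $q_{t_k}<d_k<b_{t_k}$;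 $P_1$ is constant on $[a_{t_k},q_{t_k}]$, has slope $1$ on $[q_{t_k},d_k]$ and is constant on $[d_k,b_{t_k}]$, while $P_2$ is constant on $[a_{t_k},d_k]$ and has slope $1$ on $[d_k,b_{t_k}]$; and $P_1(d_k)=P_2(d_k)$. - Over $I_{i+1}'=[b_i,a_{i+1}]$: $P_1$ is constant, $P_2=P_3$ at both endpoints, $P_3$ has slope $1$ on $[b_i,c_i]$ and is constant on $[c_i,a_{i+1}]$, while $P_2$ is constant on $[b_i,c_i]$ and has slope $1$ on $[c_i,a_{i+1}]$. The parallelogram between the graphs of $P_2$ and $P_3$ over $I_{i+1}'$ is called a shaded (gray) area. Moreover, there exists $C>0$ depending only on $\xi$ such that (a) $|L_1(q)-P_1(q)|\le C$ for any $q$ large enough; (b) $|L_2(q)-P_2(q)|\le C$ and $|L_3(q)-P_3(q)|\le C$ for each $q\in I_j$ with $j$ large enough; (c) $P_2(q)-C\le L_2(q)\le L_3(q)\le P_3(q)+C$ for each $q\in I_j'$ with $j$ large enough. (Roughly speaking: up to a bounded difference, the combined graph of $\mathbf{L}_u$ coincides with that of $P$ outside the shaded areas, and for each $j$ large enough the combined graph of $L_2$ and $L_3$ on $I_j'$ is included, within $O(1)$, in the corresponding shaded area.)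
   Context: Sturmian sequences. $[a_0;a_1,\dots]$ denotes a continued fraction. Put $t_k=s_0+\dots+s_k$ (so $t_0=-1$, $t_1=0$). $\mathcal{M}$ is the monoid of $2\times2$ integer matrices with non-zero determinant; $\|w\|$ is the maximum of the absolute values of the entries of $w$. A Sturmian sequence in $\mathcal{M}$ relative to $(s_k)$ is a sequence $(w_i)_{i\ge0}$ in $\mathcal{M}$ with $w_{i+1}=w_i^{s_{i+1}}w_{i-1}$ for $i\ge1$. It is admissible if there is $N\in\mathcal{M}$ such that $w_1N$, $w_0{}^tN$, $w_1w_0{}^tN$ are symmetric. It has multiplicative growth if there are $c_1,c_2>0$ with $c_1\|w_k\|\,\|w_k^{l-1}w_{k-1}\|\le\|w_k^lw_{k-1}\|\le c_2\|w_k\|\,\|w_k^{l-1}w_{k-1}\|$ for all $k\ge1$, $1\le l\le s_{k+1}+1$. Put $N_k=N$ for $k$ even, $N_k={}^tN$ for $k$ odd, $y_{-2}=w_0{}^tN$, $y_{-1}=w_1N$, $y_{t_k+l}=w_k^{l+1}w_{k-1}N_k$ for $k\ge1$, $0\le l<s_{k+1}$; these symmetric matrices are identified with points of $\mathbb{Z}^3$ through $(x_0,x_1,x_2)\leftrightarrow\begin{pmatrix} x_0 & x_1 \\ x_1 & x_2 \end{pmatrix}$. The content of an integer point is the gcd of its coordinates. $a_i\asymp b_i$ means that $a_i/b_i$ is bounded above and below by positive constants for $i$ large. Under the hypotheses $\delta$ and $\xi$ exist and $1,\xi,\xi^2$ are linearly independent over $\mathbb{Q}$. Auxiliary functions. Fix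 positive reals $(\widehat W_k)_{k\ge0}$ with $\widehat W_{k+1}=\widehat W_k^{s_{k+1}}\widehat W_{k-1}$ ($k\ge1$) and $\widehat W_k\asymp\|w_k\|$ (such a sequence exists), put $\widehat W_{-1}=\widehat W_1/\widehat W_0$, and fix an integer $k_0\ge1$ such that $\widehat W_k>1$ for all $k\ge k_0-1$. For $i=t_k+l$ with $k\ge0$, $0\le l<s_{k+1}$ put $\widehat Y_i=\widehat W_k^{l+1}\widehat W_{k-1}$, $\mathcal{E}_i^*=\widehat Y_i^{\,\delta-1}$, $\widehat Z_i=\widehat W_k^{l}\widehat W_{k-1}$, $\mathcal{E}_i=\widehat W_k^{(\delta-1)(l+1)-1}\widehat W_{k-1}^{\delta-1}$, and for $q\ge0$ $$\widehat L_i(q)=\max(\log\widehat Z_i,\ \log\mathcal{E}_i+q),\qquad \widehat L_i^*(q)=\max(\log\mathcal{E}_i^*,\ \log\widehat Y_i-q),$$ $$q_i=(2-\delta)\log\widehat Y_i,\qquad c_i=q_i+\log\widehat W_k .$$ Let $\Phi_3:\mathbb{R}^3\to\mathbb{R}^3$ list the coordinates of a point in non-decreasing order. For $k\ge k_0$, $t_k-1\le i<t_{k+1}-1$ and $c_i\le q<c_{i+1}$, define $$P(q)=(P_1(q),P_2(q),P_3(q))=\Phi_3\big(\widehat L_{t_{k+1}}(q),-\widehat L_{i+1}^*(q),\widehat L_{i+1}(q)\big).$$ $I_{i+1}=[a_{i+1},b_{i+1}]\subset[c_i,c_{i+1}]$ is the interval on which $P_3=-\widehat L_{i+1}^*$,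 and $I_{i+1}'=[b_i,a_{i+1}]$. Finally $d_k=(3-\delta)\log\widehat W_k+(1-\delta)\log\widehat W_{k-1}$ is the abscissa of the intersection point of $\widehat L_{t_k}$ and $\widehat L_{t_{k+1}}$. Successive minima. With the Euclidean norm on $\mathbb{R}^3$, $\mathcal{C}_u(e^q)=\{x\in\mathbb{R}^3:\|x\|\le1,\ |x\cdot u|\le e^{-q}\}$; $L_j(q)$ is the logarithm of the $j$-th successive minimum of $\mathcal{C}_u(e^q)$ with respect to $\mathbb{Z}^3$. $3$-system. A $3$-system on $[q_0,+\infty)$ is a continuous piecewise linear map $P=(P_1,P_2,P_3):[q_0,+\infty)\to\mathbb{R}^3$ (finitely many non-differentiability points in each bounded interval) such that: for each $q$, $0\le P_1(q)\le P_2(q)\le P_3(q)$ and $P_1(q)+P_2(q)+P_3(q)=q$; on each non-empty open subinterval where $P$ is differentiable, some $P_r$ has slope $1$ and the other two components are constant; and if $q>q_0$ is a point where $P$ is not differentiable, $P_r$ has slope $1$ on $(q-\varepsilon,q)$ and $P_s$ has slope $1$ on $(q,q+\varepsilon)$ for small $\varepsilon>0$, with $r<s$, then $P_r(q)=P_{r+1}(q)=\dots=P_s(q)$.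
   Formalization: That P is a 3-system with the described combined graph is proved for all sufficiently large k_0, since it can fail for a k_0 that only satisfies Ŵ_k>1 for k≥k_0-1 (e.g. k_0=1 with Ŵ_1<Ŵ_0 gives d_1<q_{t_1}); (a), (b), (c) hold for every such k_0. *)

theory Defs
  imports "HOL-Analysis.Analysis" "HOL-Library.Landau_Symbols"
begin

section \<open>Sturmian sequences of matrices\<close>

fun cfrac :: "int list \<Rightarrow> real" where
  "cfrac [] = 0"
| "cfrac [a] = of_int a"
| "cfrac (a # b # as) = of_int a + 1 / cfrac (b # as)"

text \<open>The argument of the limit superior is $[s_{k+1}; s_k, \dots, s_1]$.\<close>

definition sturm_sigma :: "(nat \<Rightarrow> int) \<Rightarrow> real" where
  "sturm_sigma s =
     1 / real_of_ereal (limsup (\<lambda>k. ereal (cfrac (map s (rev [1..<k + 2])))))"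

definition tt :: "(nat \<Rightarrow> int) \<Rightarrow> nat \<Rightarrow> int" where
  "tt s k = (\<Sum>j\<le>k. s j)"

text \<open>
  Indices $i$ are integers since $t_0 = -1$.  Every $i \ge -1$ is uniquely $i = t_k + l$ with
  $0 \le l < s_{k+1}$; then \<open>level s i\<close> is $k$ and \<open>offset s i\<close> is $l$.
\<close>

definition level :: "(nat \<Rightarrow> int) \<Rightarrow> int \<Rightarrow> nat" where
  "level s i = (THE k. tt s k \<le> i \<and> i < tt s (k + 1))"

definition offset :: "(nat \<Rightarrow> int) \<Rightarrow> int \<Rightarrow> nat" where
  "offset s i = nat (i - tt s (level s i))"

definition mnorm :: "int^2^2 \<Rightarrow> real" where
  "mnorm A = real_of_int (Max (range (\<lambda>(i, j). \<bar>A $ i $ j\<bar>)))"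

text \<open>The library power \<open>^\<close> on vector types is componentwise, not the matrix power.\<close>

primrec mpow :: "int^2^2 \<Rightarrow> nat \<Rightarrow> int^2^2" where
  "mpow A 0 = mat 1"
| "mpow A (Suc n) = A ** mpow A n"

definition symmetric :: "int^2^2 \<Rightarrow> bool" where
  "symmetric A \<longleftrightarrow> transpose A = A"

definition sturmian :: "(nat \<Rightarrow> int) \<Rightarrow> (nat \<Rightarrow> int^2^2) \<Rightarrow> bool" where
  "sturmian s w \<longleftrightarrow> (\<forall>i. det (w i) \<noteq> 0) \<and>
     (\<forall>i\<ge>1. w (i + 1) = mpow (w i) (nat (s (i + 1))) ** w (i - 1))"

definition admissible_with :: "(nat \<Rightarrow> int^2^2) \<Rightarrow> int^2^2 \<Rightarrow> bool" where
  "admissible_with w N \<longleftrightarrow> det N \<noteq> 0 \<and> symmetric (w 1 ** N) \<and>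
     symmetric (w 0 ** transpose N) \<and> symmetric (w 1 ** w 0 ** transpose N)"

definition multiplicative_growth :: "(nat \<Rightarrow> int) \<Rightarrow> (nat \<Rightarrow> int^2^2) \<Rightarrow> bool" where
  "multiplicative_growth s w \<longleftrightarrow> (\<exists>c\<^sub>1>0. \<exists>c\<^sub>2>0. \<forall>k\<ge>1. \<forall>l\<ge>1. int l \<le> s (k + 1) + 1 \<longrightarrow>
     c\<^sub>1 * mnorm (w k) * mnorm (mpow (w k) (l - 1) ** w (k - 1))
       \<le> mnorm (mpow (w k) l ** w (k - 1)) \<and>
     mnorm (mpow (w k) l ** w (k - 1))
       \<le> c\<^sub>2 * mnorm (w k) * mnorm (mpow (w k) (l - 1) ** w (k - 1)))"

definition sturm_y ::
  "(nat \<Rightarrow> int) \<Rightarrow> (nat \<Rightarrow> int^2^2) \<Rightarrow> int^2^2 \<Rightarrow> int \<Rightarrow> int^2^2" where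
  "sturm_y s w N i =
     (if i = -2 then w 0 ** transpose N
      else if i = -1 then w 1 ** N
      else (let k = level s i in
        mpow (w k) (offset s i + 1) ** w (k - 1) ** (if even k then N else transpose N)))"

text \<open>A symmetric matrix with rows $(x_0, x_1)$, $(x_1, x_2)$ is the point $(x_0, x_1, x_2)$.\<close>

definition point :: "int^2^2 \<Rightarrow> real^3" where
  "point A = vector [of_int (A $ 1 $ 1), of_int (A $ 1 $ 2), of_int (A $ 2 $ 2)]"

definition content :: "int^2^2 \<Rightarrow> int" where
  "content A = gcd (A $ 1 $ 1) (gcd (A $ 1 $ 2) (A $ 2 $ 2))"

text \<open>
  Convergence of classes in real projective space, which carries the quotient topology: its open
  sets correspond to the open subsets of the space minus the origin that are invariant under
  non-zero scaling.
\<close>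

definition proj_tendsto :: "(nat \<Rightarrow> real^3) \<Rightarrow> real^3 \<Rightarrow> bool" where
  "proj_tendsto x u \<longleftrightarrow> u \<noteq> 0 \<and> (\<forall>n. x n \<noteq> 0) \<and>
     (\<forall>U. open U \<and> 0 \<notin> U \<and> (\<forall>v\<in>U. \<forall>c. c \<noteq> 0 \<longrightarrow> c *\<^sub>R v \<in> U) \<and> u \<in> U \<longrightarrow>
       (\<forall>\<^sub>F n in sequentially. x n \<in> U))"

section \<open>Successive minima\<close>

definition convex_body :: "real^3 \<Rightarrow> real \<Rightarrow> (real^3) set" where
  "convex_body u X = {x. norm x \<le> 1 \<and> \<bar>x \<bullet> u\<bar> \<le> 1 / X}"

definition integer_points :: "(real^3) set" where
  "integer_points = {x. \<forall>i. x $ i \<in> \<int>}"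

definition successive_minimum :: "nat \<Rightarrow> (real^3) set \<Rightarrow> real" where
  "successive_minimum j K = Inf {r. r > 0 \<and>
     (\<exists>S. S \<subseteq> integer_points \<inter> (*\<^sub>R) r ` K \<and> independent S \<and> card S = j)}"

definition Lmap :: "real^3 \<Rightarrow> nat \<Rightarrow> real \<Rightarrow> real" where
  "Lmap u j q = ln (successive_minimum j (convex_body u (exp q)))"

section \<open>3-systems\<close>

definition slope_on :: "real \<Rightarrow> (real \<Rightarrow> real) \<Rightarrow> real set \<Rightarrow> bool" where
  "slope_on m f A \<longleftrightarrow> (\<forall>x\<in>A. \<forall>y\<in>A. f y - f x = m * (y - x))"

definition diff_at :: "(nat \<Rightarrow> real \<Rightarrow> real) \<Rightarrow> real \<Rightarrow> bool" where
  "diff_at P q \<longleftrightarrow> (\<forall>j\<in>{1..3}. P j differentiable (at q))"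

text \<open>
  A map $P = (P_1, P_2, P_3)$ is given by its components \<open>P 1\<close>, \<open>P 2\<close>, \<open>P 3\<close>.  Linearity on the
  intervals of differentiability is part of the fourth conjunct.
\<close>

definition three_system :: "real \<Rightarrow> (nat \<Rightarrow> real \<Rightarrow> real) \<Rightarrow> bool" where
  "three_system q0 P \<longleftrightarrow>
     (\<forall>j\<in>{1..3}. continuous_on {q0..} (P j)) \<and>
     (\<forall>x y. finite {q. q0 < q \<and> x \<le> q \<and> q \<le> y \<and> \<not> diff_at P q}) \<and>
     (\<forall>q\<ge>q0. 0 \<le> P 1 q \<and> P 1 q \<le> P 2 q \<and> P 2 q \<le> P 3 q \<and> P 1 q + P 2 q + P 3 q = q) \<and>
     (\<forall>x y. q0 \<le> x \<and> x < y \<and> (\<forall>q\<in>{x<..<y}. diff_at P q) \<longrightarrow>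
       (\<exists>r\<in>{1..3}. \<forall>j\<in>{1..3}. slope_on (if j = r then 1 else 0) (P j) {x<..<y})) \<and>
     (\<forall>q>q0. \<not> diff_at P q \<longrightarrow>
       (\<forall>r\<in>{1..3}. \<forall>m\<in>{1..3}. \<forall>\<epsilon>>0. q0 \<le> q - \<epsilon> \<and> r < m \<and>
          slope_on 1 (P r) {q - \<epsilon><..<q} \<and> slope_on 1 (P m) {q<..<q + \<epsilon>} \<longrightarrow>
          (\<forall>j\<in>{r..<m}. P j q = P (j + 1) q)))"

section \<open>The map \<open>P\<close> attached to a Sturmian sequence\<close>

text \<open>
  \<open>W\<close> is the sequence $(\widehat W_k)_{k \ge 0}$; \<open>Wpred W k\<close> is $\widehat W_{k-1}$, including
  $\widehat W_{-1} = \widehat W_1 / \widehat W_0$.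
\<close>

definition Wpred :: "(nat \<Rightarrow> real) \<Rightarrow> nat \<Rightarrow> real" where
  "Wpred W k = (if k = 0 then W 1 / W 0 else W (k - 1))"

definition is_What ::
  "(nat \<Rightarrow> int) \<Rightarrow> (nat \<Rightarrow> int^2^2) \<Rightarrow> (nat \<Rightarrow> real) \<Rightarrow> bool" where
  "is_What s w W \<longleftrightarrow> (\<forall>k. W k > 0) \<and>
     (\<forall>k\<ge>1. W (k + 1) = W k ^ nat (s (k + 1)) * W (k - 1)) \<and>
     W \<in> \<Theta>(\<lambda>k. mnorm (w k))"

definition valid_start :: "(nat \<Rightarrow> real) \<Rightarrow> nat \<Rightarrow> bool" where
  "valid_start W k0 \<longleftrightarrow> k0 \<ge> 1 \<and> (\<forall>k\<ge>k0 - 1. W k > 1)"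

definition Yhat :: "(nat \<Rightarrow> int) \<Rightarrow> (nat \<Rightarrow> real) \<Rightarrow> int \<Rightarrow> real" where
  "Yhat s W i = W (level s i) ^ (offset s i + 1) * Wpred W (level s i)"

definition Zhat :: "(nat \<Rightarrow> int) \<Rightarrow> (nat \<Rightarrow> real) \<Rightarrow> int \<Rightarrow> real" where
  "Zhat s W i = W (level s i) ^ offset s i * Wpred W (level s i)"

definition Estar :: "(nat \<Rightarrow> int) \<Rightarrow> (nat \<Rightarrow> real) \<Rightarrow> real \<Rightarrow> int \<Rightarrow> real" where
  "Estar s W \<delta> i = Yhat s W i powr (\<delta> - 1)"

definition Ecal :: "(nat \<Rightarrow> int) \<Rightarrow> (nat \<Rightarrow> real) \<Rightarrow> real \<Rightarrow> int \<Rightarrow> real" where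
  "Ecal s W \<delta> i = W (level s i) powr ((\<delta> - 1) * (real (offset s i) + 1) - 1)
     * Wpred W (level s i) powr (\<delta> - 1)"

definition Lhat :: "(nat \<Rightarrow> int) \<Rightarrow> (nat \<Rightarrow> real) \<Rightarrow> real \<Rightarrow> int \<Rightarrow> real \<Rightarrow> real" where
  "Lhat s W \<delta> i q = max (ln (Zhat s W i)) (ln (Ecal s W \<delta> i) + q)"

definition Lhat_star ::
  "(nat \<Rightarrow> int) \<Rightarrow> (nat \<Rightarrow> real) \<Rightarrow> real \<Rightarrow> int \<Rightarrow> real \<Rightarrow> real" where
  "Lhat_star s W \<delta> i q = max (ln (Estar s W \<delta> i)) (ln (Yhat s W i) - q)"

definition qq :: "(nat \<Rightarrow> int) \<Rightarrow> (nat \<Rightarrow> real) \<Rightarrow> real \<Rightarrow> int \<Rightarrow> real" where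
  "qq s W \<delta> i = (2 - \<delta>) * ln (Yhat s W i)"

definition cc :: "(nat \<Rightarrow> int) \<Rightarrow> (nat \<Rightarrow> real) \<Rightarrow> real \<Rightarrow> int \<Rightarrow> real" where
  "cc s W \<delta> i = qq s W \<delta> i + ln (W (level s i))"

definition dd :: "(nat \<Rightarrow> real) \<Rightarrow> real \<Rightarrow> nat \<Rightarrow> real" where
  "dd W \<delta> k = (3 - \<delta>) * ln (W k) + (1 - \<delta>) * ln (Wpred W k)"

definition Phi3 :: "real \<Rightarrow> real \<Rightarrow> real \<Rightarrow> nat \<Rightarrow> real" where
  "Phi3 x y z j = sort [x, y, z] ! (j - 1)"

text \<open>
  For a valid starting index \<open>k0\<close> (and $0 \le \delta < 1$) the $c_i$ with $i \ge t_{k_0} - 1$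
  increase to infinity, so the index $i$ below is well defined when $q \ge c_{t_{k_0}-1}$.  The
  condition $t_k - 1 \le i < t_{k+1} - 1$ says that $k$ is the level of $i + 1$.
\<close>

definition Pmap ::
  "(nat \<Rightarrow> int) \<Rightarrow> (nat \<Rightarrow> real) \<Rightarrow> real \<Rightarrow> nat \<Rightarrow> nat \<Rightarrow> real \<Rightarrow> real" where
  "Pmap s W \<delta> k0 j q =
     (let i = (THE i. tt s k0 - 1 \<le> i \<and> cc s W \<delta> i \<le> q \<and> q < cc s W \<delta> (i + 1));
          k = level s (i + 1)
      in Phi3 (Lhat s W \<delta> (tt s (k + 1)) q) (- Lhat_star s W \<delta> (i + 1) q)
           (Lhat s W \<delta> (i + 1) q) j)"

definition Iset ::
  "(nat \<Rightarrow> int) \<Rightarrow> (nat \<Rightarrow> real) \<Rightarrow> real \<Rightarrow> nat \<Rightarrow> int \<Rightarrow> real set" where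
  "Iset s W \<delta> k0 i = {q \<in> {cc s W \<delta> (i - 1)..cc s W \<delta> i}.
     Pmap s W \<delta> k0 3 q = - Lhat_star s W \<delta> i q}"

definition aa :: "(nat \<Rightarrow> int) \<Rightarrow> (nat \<Rightarrow> real) \<Rightarrow> real \<Rightarrow> nat \<Rightarrow> int \<Rightarrow> real" where
  "aa s W \<delta> k0 i = Inf (Iset s W \<delta> k0 i)"

definition bb :: "(nat \<Rightarrow> int) \<Rightarrow> (nat \<Rightarrow> real) \<Rightarrow> real \<Rightarrow> nat \<Rightarrow> int \<Rightarrow> real" where
  "bb s W \<delta> k0 i = Sup (Iset s W \<delta> k0 i)"

text \<open>
  Shape of the combined graph of \<open>P\<close>, for abstract abscissas \<open>a\<close>, \<open>q\<close>, \<open>b\<close>, \<open>c\<close>, \<open>d\<close>.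
\<close>

definition combined_graph_type ::
  "(nat \<Rightarrow> int) \<Rightarrow> nat \<Rightarrow> (nat \<Rightarrow> real \<Rightarrow> real) \<Rightarrow> (int \<Rightarrow> real) \<Rightarrow> (int \<Rightarrow> real) \<Rightarrow>
   (int \<Rightarrow> real) \<Rightarrow> (int \<Rightarrow> real) \<Rightarrow> (nat \<Rightarrow> real) \<Rightarrow> bool" where
  "combined_graph_type s k0 P a q b c d \<longleftrightarrow> (\<forall>i\<ge>tt s k0.
     a i < q i \<and> q i < b i \<and> b i \<le> c i \<and> c i \<le> a (i + 1) \<and>
     slope_on 1 (P 3) {a i..q i} \<and> slope_on 0 (P 3) {q i..b i} \<and>
     (\<forall>k l. i = tt s k + l \<and> 0 < l \<and> l < s (k + 1) \<longrightarrow>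
        slope_on 0 (P 1) {a i..b i} \<and>
        slope_on 0 (P 2) {a i..q i} \<and> slope_on 1 (P 2) {q i..b i}) \<and>
     (\<forall>k. i = tt s k \<longrightarrow>
        q i < d k \<and> d k < b i \<and>
        slope_on 0 (P 1) {a i..q i} \<and> slope_on 1 (P 1) {q i..d k} \<and>
        slope_on 0 (P 1) {d k..b i} \<and>
        slope_on 0 (P 2) {a i..d k} \<and> slope_on 1 (P 2) {d k..b i} \<and>
        P 1 (d k) = P 2 (d k)) \<and>
     slope_on 0 (P 1) {b i..a (i + 1)} \<and>
     P 2 (b i) = P 3 (b i) \<and> P 2 (a (i + 1)) = P 3 (a (i + 1)) \<and>
     slope_on 1 (P 3) {b i..c i} \<and> slope_on 0 (P 3) {c i..a (i + 1)} \<and>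
     slope_on 0 (P 2) {b i..c i} \<and> slope_on 1 (P 2) {c i..a (i + 1)})"

end

theory Submission
  imports Defs
begin

text \<open>
  Put $\eta_i = \log\widehat Y_i$. Over $[c_{i-1}, c_i]$ the three lines defining $P$ are matched, up to
  bounded factors, by integer points: an integer normal $A$ of the plane spanned by the $y_j$ of the
  same level, a second integer point $Z$ orthogonal to $y_i$, and an integer point $X$ with $X \cdot y_i$
  equal to the content of $y_i$, reduced modulo $A$ and $Z$. They give the upper bounds $L_3 \le P_3 + O(1)$
  and, as long as the trajectory of $y_i$ stays above those of $A$ and $Z$ (that is, on $I_i$),
  $L_j \le P_j + O(1)$ for every $j$. As $L_1 + L_2 + L_3 \ge q - O(1)$ by integrality of determinants, all
  these are equalities up to $O(1)$ on $I_i$. On $I_i'$ the map $P_1$ is constant while $L_1$ is monotone, so $L_1$ is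
  still controlled there.

  The constant depends only on $\xi$ because two Sturmian sequences with the same $\xi$ have maps $P_1$ at
  bounded distance from the same $L_1$. This staircase determines $\delta$, the tail of $(s_k)$ and, up to
  $o(1)$, the numbers $\log\widehat W_k$: their differences form a bounded solution of
  $e_{k+1} = s_{k+1} e_k + e_{k-1}$, along which $e_{k+1} e_k$ increases by at least $e_k^2$. Hence the
  integer points coming from one Sturmian sequence serve for all others.
\<close>

section \<open>Criterion for 3-systems\<close>

text \<open>The bound on \<delta> enters only as \<open>\<delta> * (x (k + 1) + x k) < x k\<close>
  for large k, where x k = log W_k: the continued fractions in the definition of \<sigma> and the
  ratios x (k + 1) / x k obey the same contracting recursion, so they have the same limsup. With g_i
  the logarithm of the weight at the level of i, it says \<delta> eta_i < g_(i-1), and the number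
  g_(i-1) - \<delta> eta_i is the length of both [a_i, q_i] and [d_i, b_i]. The two halves of a
  shaded area have length \<delta> eta_i. As the inequality holds only from some rank on, the shape
  of the graph is proved for large k0; the estimates (a)-(c) are asymptotic and hold for every valid
  k0. The obstacle is uniformity: bounds obtained from one sequence involve its growth constants,
  its determinants, N and the contents. They are collected in the predicate
  \<open>approximable\<close>, which refers to the sequence only through \<delta>, x and e. For a
  second sequence with the same \<xi> these arguments eventually agree with those of the first
  within 1/4, which costs a factor 3.\<close>

definition seg :: "(nat \<Rightarrow> real \<Rightarrow> real) \<Rightarrow> nat \<Rightarrow> real \<Rightarrow> real \<Rightarrow> bool" where
  "seg P r x y \<longleftrightarrow> (\<forall>j\<in>{1..3}. slope_on (if j = r then 1 else 0) (P j) {x..y})"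

lemma slope_on_subset: "slope_on m f A \<Longrightarrow> B \<subseteq> A \<Longrightarrow> slope_on m f B"
  unfolding slope_on_def by blast

lemma seg_subset: "seg P r x y \<Longrightarrow> x \<le> x' \<Longrightarrow> y' \<le> y \<Longrightarrow> seg P r x' y'"
  unfolding seg_def by (meson atLeastatMost_subset_iff slope_on_subset)

lemma slope_on_unique:
  assumes "slope_on m f A" "slope_on m' f A" "x \<in> A" "y \<in> A" "x \<noteq> y"
  shows "m = m'"
proof -
  have "m * (y - x) = m' * (y - x)" using assms unfolding slope_on_def by metis
  thus ?thesis using assms(5) by simp
qed

lemma slope_on_has_real_derivative:
  assumes "slope_on m f {x..y}" "x < q" "q < y"
  shows "(f has_real_derivative m) (at q)"
proof -
  have "((\<lambda>z. f q + m * (z - q)) has_real_derivative m) (at q)"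
    by (auto intro!: derivative_eq_intros)
  moreover have "f q + m * (z - q) = f z" if "z \<in> {x<..<y}" for z
    using assms(1)[unfolded slope_on_def, rule_format, of q z] assms(2,3) that by simp
  ultimately show ?thesis
    using has_field_derivative_transform_within_open[of _ m q "{x<..<y}" f] assms by auto
qed

lemma seg_diff_at:
  assumes "seg P r x y" "x < q" "q < y"
  shows "diff_at P q"
  unfolding diff_at_def
proof
  fix j :: nat assume "j \<in> {1..3}"
  then have "slope_on (if j = r then 1 else 0) (P j) {x..y}" using assms(1) by (simp add: seg_def)
  from slope_on_has_real_derivative[OF this assms(2,3)]
  show "P j differentiable (at q)" using real_differentiable_def by blast
qed

text \<open>The point \<open>q\<close> may be an end of the interval: the derivative within
  \<open>{x..y}\<close> is still unique there, because \<open>q\<close> is a limit point of it. This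
  compares the pieces on the two sides of a point of differentiability.\<close>

lemma one_sided_derivative_unique:
  assumes D: "(f has_real_derivative D) (at q)" and S: "slope_on m f {x..y}" and "x < y"
    and "q \<in> {x..y}"
  shows "D = m"
proof -
  have 1: "(f has_real_derivative D) (at q within {x..y})" using D has_field_derivative_at_within by blast
  have "((\<lambda>z. f q + m * (z - q)) has_real_derivative m) (at q within {x..y})"
    by (auto intro!: derivative_eq_intros)
  then have 2: "(f has_real_derivative m) (at q within {x..y})"
    by (rule has_field_derivative_transform_within[where d=1])
      (use assms in \<open>auto simp: slope_on_def algebra_simps\<close>)
  have "at q within {x..y} \<noteq> bot"
    using assms(3,4) by (simp add: trivial_limit_within islimpt_Icc)
  then show ?thesis using 1 2 has_field_derivative_unique by blast
qed

lemma seg_type_unique: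
  assumes "seg P r x y" "slope_on 1 (P m) {x<..<y}" "x < y" "m \<in> {1..3}"
  shows "m = r"
proof (rule ccontr)
  assume "m \<noteq> r"
  then have "slope_on 0 (P m) {x<..<y}"
    using assms unfolding seg_def by (smt (verit) greaterThanLessThan_subseteq_atLeastAtMost_iff slope_on_subset)
  then have "(0::real) = 1"
    using assms(2,3) slope_on_unique[of 0 "P m" "{x<..<y}" 1 "x + (y-x)/3" "x + (y-x)/2"]
    by (auto simp: field_simps)
  then show False by simp
qed

text \<open>Only local data are asked for: a piece of pure type on each side of every point.
  Finiteness of the break points follows by compactness, since no break points lie close to an
  accumulation point, and on an interval of differentiability the type is locally constant. The
  pieces are closed, which yields continuity at their common end points.\<close>

lemma three_systemI:
  fixes P :: "nat \<Rightarrow> real \<Rightarrow> real"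
  assumes ord: "\<And>q. q0 \<le> q \<Longrightarrow> 0 \<le> P 1 q \<and> P 1 q \<le> P 2 q \<and> P 2 q \<le> P 3 q \<and> P 1 q + P 2 q + P 3 q = q"
    and right: "\<And>q. q0 \<le> q \<Longrightarrow> \<exists>\<epsilon>>0. \<exists>r\<in>{1..3}. seg P r q (q + \<epsilon>)"
    and both: "\<And>q. q0 < q \<Longrightarrow> \<exists>\<epsilon>>0. \<exists>r\<in>{1..3}. \<exists>m\<in>{1..3}. seg P r (q - \<epsilon>) q \<and> seg P m q (q + \<epsilon>) \<and>
        (\<forall>j\<in>{r..<m}. P j q = P (j + 1) q)"
  shows "three_system q0 P"
proof -
  have cont: "continuous_on {q0..} (P j)" if j: "j \<in> {1..3}" for j
  proof -
    have "\<exists>d>0. \<forall>z\<in>{q0..}. \<bar>z - q\<bar> < d \<longrightarrow> \<bar>P j z - P j q\<bar> < e" if q: "q0 \<le> q" and e: "e > 0" for q e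
    proof -
      obtain \<epsilon> r where \<epsilon>: "\<epsilon> > 0" "seg P r q (q + \<epsilon>)" using right[OF q] by blast
      \<comment> \<open>At \<open>q = q0\<close> there is no piece on the left;
        \<open>\<epsilon>'\<close> is then an arbitrary positive number.\<close>
      obtain \<epsilon>' r' where \<epsilon>': "\<epsilon>' > 0" "q0 < q \<longrightarrow> seg P r' (q - \<epsilon>') q"
        using both[of q] by (metis zero_less_one)
      \<comment> \<open>The slopes are 0 or 1, so each component is 1-Lipschitz near
        \<open>q\<close> and \<open>e\<close> itself is an admissible radius.\<close>
      define d where "d = min e (min \<epsilon> \<epsilon>')"
      have "\<bar>P j z - P j q\<bar> < e" if z: "q0 \<le> z" "\<bar>z - q\<bar> < d" for z
      proof (cases "q \<le> z")
        case True
        then have "P j z - P j q = (if j = r then 1 else 0) * (z - q)"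
          using \<epsilon>(2) j z unfolding seg_def slope_on_def d_def by simp
        then show ?thesis using True z e by (auto simp: d_def)
      next
        case False
        then have "P j z - P j q = (if j = r' then 1 else 0) * (z - q)"
          using \<epsilon>'(2) j z unfolding seg_def slope_on_def d_def by simp
        then show ?thesis using False z e by (auto simp: d_def)
      qed
      moreover have "d > 0" using \<epsilon> \<epsilon>' e by (simp add: d_def)
      ultimately show ?thesis by (intro exI[of _ d]) auto
    qed
    then show ?thesis unfolding continuous_on_iff dist_real_def by simp
  qed
  have fin: "finite {q. q0 < q \<and> x \<le> q \<and> q \<le> y \<and> \<not> diff_at P q}" (is "finite ?N") for x y
  proof (rule ccontr)
    assume "infinite ?N"
    moreover have "?N \<subseteq> {q0..y}" by auto
    ultimately obtain z where z: "z \<in> {q0..y}" "z islimpt ?N"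
      using compact_Icc[of q0 y] unfolding compact_eq_Bolzano_Weierstrass by blast
    obtain \<epsilon> r where \<epsilon>: "\<epsilon> > 0" "seg P r z (z + \<epsilon>)" using right[of z] z by auto
    obtain \<epsilon>' r' where \<epsilon>': "\<epsilon>' > 0" "q0 < z \<longrightarrow> seg P r' (z - \<epsilon>') z"
      using both[of z] by (metis zero_less_one)
    have "min \<epsilon> \<epsilon>' > 0" using \<epsilon> \<epsilon>' by simp
    then obtain p where p: "p \<in> ?N" "p \<noteq> z" "dist p z < min \<epsilon> \<epsilon>'"
      using z(2) unfolding islimpt_approachable by blast
    show False
    proof (cases "z < p")
      case True
      then have "diff_at P p" using seg_diff_at[OF \<epsilon>(2)] p by (auto simp: dist_real_def)
      then show False using p by simp
    next
      case False
      then have "diff_at P p" using seg_diff_at[of P r' "z - \<epsilon>'" z p] \<epsilon>'(2) p z by (auto simp: dist_real_def)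
      then show False using p by simp
    qed
  qed
  have lin: "\<exists>r\<in>{1..3}. \<forall>j\<in>{1..3}. slope_on (if j = r then 1 else 0) (P j) {x<..<y}"
    if xy: "q0 \<le> x" "x < y" and diff: "\<forall>q\<in>{x<..<y}. diff_at P q" for x y
  proof -
    \<comment> \<open>The derivative of \<open>P r\<close> at \<open>q\<close> is 1 by the left
      piece, and 1 or 0 by the right piece according to whether \<open>r = m\<close>. So the type
      does not change at a point of differentiability.\<close>
    have loc: "\<exists>\<epsilon>>0. \<exists>r\<in>{1..3}. seg P r (q - \<epsilon>) q \<and> seg P r q (q + \<epsilon>)" if q: "q \<in> {x<..<y}" for q
    proof -
      have "q0 < q" using q xy by auto
      from both[OF this] obtain \<epsilon> r m where *: "\<epsilon> > 0" "r \<in> {1..3}" "m\<in>{1..3}" "seg P r (q - \<epsilon>) q" "seg P m q (q + \<epsilon>)"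
        by blast
      obtain D where D: "(P r has_real_derivative D) (at q)"
        using diff q * unfolding diff_at_def by (meson real_differentiable_def)
      have "slope_on 1 (P r) {q - \<epsilon>..q}" using *(2,4) unfolding seg_def by force
      then have "D = 1" using one_sided_derivative_unique[OF D, of 1 "q - \<epsilon>" q] *(1) by auto
      moreover have "D = (if r = m then 1 else 0)"
        using one_sided_derivative_unique[OF D, of "if r = m then 1 else 0" q "q + \<epsilon>"] *(1,2,5) unfolding seg_def by auto
      ultimately have "r = m" by (auto split: if_splits)
      then show ?thesis using * by blast
    qed
    have der: "\<exists>m\<in>{0,1}. \<forall>q\<in>{x<..<y}. (P j has_real_derivative m) (at q)" if j: "j \<in> {1..3}" for j
    proof -
      have locd: "\<exists>\<epsilon>>0. \<exists>m\<in>{0,1}. \<forall>z. \<bar>z - q\<bar> < \<epsilon> \<longrightarrow> (P j has_real_derivative m) (at z)" if q: "q \<in> {x<..<y}" for q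
      proof -
        from loc[OF q] obtain \<epsilon> r where *: "\<epsilon> > 0" "seg P r (q - \<epsilon>) q" "seg P r q (q + \<epsilon>)" by blast
        define m where "m = (if j = r then 1 else 0 :: real)"
        have s: "slope_on m (P j) {q - \<epsilon>..q}" "slope_on m (P j) {q..q + \<epsilon>}"
          using * j unfolding seg_def m_def by auto
        have a: "P j z - P j q = m * (z - q)" if "z \<in> {q-\<epsilon>..q+\<epsilon>}" for z
          by (cases "z \<le> q") (use s that *(1) in \<open>auto simp: slope_on_def\<close>)
        have "slope_on m (P j) {q - \<epsilon>..q + \<epsilon>}"
          unfolding slope_on_def
        proof (intro ballI)
          fix z z' assume "z \<in> {q-\<epsilon>..q+\<epsilon>}" "z' \<in> {q-\<epsilon>..q+\<epsilon>}"
          from a[OF this(1)] a[OF this(2)] show "P j z' - P j z = m * (z' - z)" by (simp add: algebra_simps)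
        qed
        then show ?thesis using slope_on_has_real_derivative[of m "P j" "q-\<epsilon>" "q+\<epsilon>"] *(1)
          by (intro exI[of _ \<epsilon>] conjI bexI[of _ m]) (auto simp: m_def)
      qed
      define mid where "mid = (x + y) / 2"
      have mid: "mid \<in> {x<..<y}" using xy by (auto simp: mid_def)
      \<comment> \<open>The derivative is locally constant on a connected interval.\<close>
      have const: "deriv (P j) p = deriv (P j) mid" if "p \<in> {x<..<y}" for p
      proof (rule connected_local_const[where A="{x<..<y}" and f="deriv (P j)"])
        show "connected {x<..<y}" by simp
        show "p \<in> {x<..<y}" "mid \<in> {x<..<y}" using that mid by auto
        show "\<forall>a\<in>{x<..<y}. \<forall>\<^sub>F b in at a within {x<..<y}. deriv (P j) a = deriv (P j) b"
        proof
          fix a assume "a \<in> {x<..<y}"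
          from locd[OF this] obtain \<epsilon> m where e: "\<epsilon> > 0" "\<forall>z. \<bar>z - a\<bar> < \<epsilon> \<longrightarrow> (P j has_real_derivative m) (at z)" by blast
          have "deriv (P j) z = m" if "\<bar>z - a\<bar> < \<epsilon>" for z using e that DERIV_imp_deriv by blast
          then show "\<forall>\<^sub>F b in at a within {x<..<y}. deriv (P j) a = deriv (P j) b"
            unfolding eventually_at dist_real_def using e by (intro exI[of _ \<epsilon>]) auto
        qed
      qed
      have at_self: "\<exists>m\<in>{0,1}. (P j has_real_derivative m) (at p)" if "p \<in> {x<..<y}" for p
        using locd[OF that] by (metis abs_zero diff_self)
      from at_self[OF mid] obtain m where m: "m \<in> {0,1}" "(P j has_real_derivative m) (at mid)" by blast
      have "(P j has_real_derivative m) (at q)" if q: "q \<in> {x<..<y}" for q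
      proof -
        from at_self[OF q] obtain m' where m': "(P j has_real_derivative m') (at q)" by blast
        with const[OF q] m have "m' = m" using DERIV_imp_deriv by metis
        with m' show ?thesis by simp
      qed
      then show ?thesis using m by blast
    qed
    have sl: "\<exists>m\<in>{0,1}. slope_on m (P j) {x<..<y}" if j: "j \<in> {1..3}" for j
    proof -
      from der[OF j] obtain m where m: "m \<in> {0,1}" "\<forall>q\<in>{x<..<y}. (P j has_real_derivative m) (at q)" by blast
      have *: "P j v - P j u = m * (v - u)" if uv: "u < v" "u \<in> {x<..<y}" "v \<in> {x<..<y}" for u v
      proof -
        have "\<exists>z. u < z \<and> z < v \<and> P j v - P j u = (v - u) * m"
          using uv m(2) by (intro MVT2) auto
        then show ?thesis by (auto simp: mult.commute)
      qed
      have "slope_on m (P j) {x<..<y}" unfolding slope_on_def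
      proof (intro ballI)
        fix u v assume uv: "u \<in> {x<..<y}" "v \<in> {x<..<y}"
        consider "u < v" | "v < u" | "u = v" by linarith
        then show "P j v - P j u = m * (v - u)"
          using *[of u v] *[of v u] uv by cases (auto simp: algebra_simps)
      qed
      then show ?thesis using m by blast
    qed
    obtain m1 where m1: "m1 \<in> {0,1}" "slope_on m1 (P 1) {x<..<y}" using sl[of 1] by auto
    obtain m2 where m2: "m2 \<in> {0,1}" "slope_on m2 (P 2) {x<..<y}" using sl[of 2] by auto
    obtain m3 where m3: "m3 \<in> {0,1}" "slope_on m3 (P 3) {x<..<y}" using sl[of 3] by auto
    obtain u v where uv: "u \<in> {x<..<y}" "v \<in> {x<..<y}" "u < v"
      using dense[of x y] dense xy(2) by (metis greaterThanLessThan_iff order_less_trans)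
    have "P 1 v - P 1 u = m1 * (v - u)" "P 2 v - P 2 u = m2 * (v - u)" "P 3 v - P 3 u = m3 * (v - u)"
      using m1(2) m2(2) m3(2) uv unfolding slope_on_def by auto
    moreover have "P 1 v + P 2 v + P 3 v = v" "P 1 u + P 2 u + P 3 u = u" using ord[of u] ord[of v] uv xy by auto
    \<comment> \<open>The components add up to the identity, so the three slopes, each 0 or 1, have
      sum 1.\<close>
    ultimately have "(m1 + m2 + m3) * (v - u) = v - u" by (simp add: algebra_simps)
    then have "m1 + m2 + m3 = 1" using uv by simp
    then have "m1 = 1 \<and> m2 = 0 \<and> m3 = 0 \<or> m1 = 0 \<and> m2 = 1 \<and> m3 = 0 \<or> m1 = 0 \<and> m2 = 0 \<and> m3 = 1"
      using m1(1) m2(1) m3(1) by auto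
    moreover have "{1..3} = {1, 2, 3::nat}" by auto
    ultimately show ?thesis using m1(2) m2(2) m3(2) by auto
  qed
  have sw: "\<forall>j\<in>{r..<m}. P j q = P (j + 1) q"
    if h: "q0 < q" "r \<in> {1..3}" "m \<in> {1..3}" "0 < \<epsilon>" "q0 \<le> q - \<epsilon>" "r < m"
      "slope_on 1 (P r) {q - \<epsilon><..<q}" "slope_on 1 (P m) {q<..<q + \<epsilon>}" for q r m \<epsilon>
  proof -
    from both[OF h(1)] obtain \<epsilon>' r' m' where *: "\<epsilon>' > 0" "seg P r' (q - \<epsilon>') q" "seg P m' q (q + \<epsilon>')"
      "\<forall>j\<in>{r'..<m'}. P j q = P (j + 1) q" by blast
    \<comment> \<open>\<open>\<epsilon>\<close> is imposed by the definition and
      \<open>\<epsilon>'\<close> by the local pieces; on the smaller neighbourhood the type of each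
      piece is determined by the component of slope 1.\<close>
    define e where "e = min \<epsilon> \<epsilon>'"
    have e: "e > 0" "e \<le> \<epsilon>" "e \<le> \<epsilon>'" using h * by (auto simp: e_def)
    have "r = r'"
      by (rule seg_type_unique[of P _ "q - e" q])
        (use h e * in \<open>auto intro: seg_subset[OF *(2)] slope_on_subset[OF h(7)]\<close>)
    moreover have "m = m'"
      by (rule seg_type_unique[of P _ q "q + e"])
        (use h e * in \<open>auto intro: seg_subset[OF *(3)] slope_on_subset[OF h(8)]\<close>)
    ultimately show ?thesis using * by simp
  qed
  show ?thesis unfolding three_system_def
    using cont fin ord lin sw by blast
qed

section \<open>The combined graph\<close>

lemma Phi3_perm:
  assumes "a \<le> b" "b \<le> (c::real)"
  shows "Phi3 a b c = (\<lambda>j. [a, b, c] ! (j - 1))" "Phi3 a c b = (\<lambda>j. [a, b, c] ! (j - 1))"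
    "Phi3 b a c = (\<lambda>j. [a, b, c] ! (j - 1))" "Phi3 b c a = (\<lambda>j. [a, b, c] ! (j - 1))"
    "Phi3 c a b = (\<lambda>j. [a, b, c] ! (j - 1))" "Phi3 c b a = (\<lambda>j. [a, b, c] ! (j - 1))"
  using assms by (auto simp: Phi3_def fun_eq_iff)

text \<open>The data in logarithmic form: \<open>\<eta> i\<close> is the logarithm of Yhat_i and
  \<open>g i\<close> that of the weight at the level of \<open>i\<close>. In \<open>turn\<close> the
  first case is an index inside a level, the second is the first index t_k of a level. The
  inequality of \<open>start\<close> follows at later indices from \<open>g_le\<close> and
  \<open>\<delta>_small\<close> one step earlier; at \<open>i0\<close> it has to be assumed.\<close>

locale sturmian_system =
  fixes \<eta> g :: "int \<Rightarrow> real" and \<delta> :: real and i0 :: int and P :: "nat \<Rightarrow> real \<Rightarrow> real"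
  assumes step: "i \<ge> i0 \<Longrightarrow> \<eta> i = \<eta> (i - 1) + g (i - 1)"
    and turn: "i \<ge> i0 \<Longrightarrow> g i = g (i - 1) \<or> \<eta> i = g i + g (i - 1)"
    and g_mono: "i \<ge> i0 \<Longrightarrow> g (i - 1) \<le> g i"
    and g_le: "i \<ge> i0 \<Longrightarrow> g i \<le> \<eta> (i - 1)"
    and g_pos: "i \<ge> i0 \<Longrightarrow> g (i - 1) > 0"
    and \<delta>_nonneg: "\<delta> \<ge> 0"
    and \<delta>_small: "i \<ge> i0 \<Longrightarrow> \<delta> * \<eta> i < g (i - 1)"
    and start: "g (i0 - 1) \<le> (1 - \<delta>) * \<eta> (i0 - 1)"
    and unbounded: "\<exists>i\<ge>i0. x < (2 - \<delta>) * \<eta> i + g i"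
    and P_eq: "i \<ge> i0 \<Longrightarrow> (2 - \<delta>) * \<eta> (i - 1) + g (i - 1) \<le> q \<Longrightarrow> q \<le> (2 - \<delta>) * \<eta> i + g i \<Longrightarrow>
      P j q = Phi3 (g i) (min ((1 - \<delta>) * \<eta> i) (q - \<eta> i))
        (\<eta> i - g i + max 0 (q - (2 - \<delta>) * \<eta> i)) j"
begin

definition q where "q i = (2 - \<delta>) * \<eta> i"
definition c where "c i = q i + g i"
text \<open>\<open>a i\<close>, \<open>b i\<close> and \<open>d i\<close> are crossing points: at
  \<open>a i\<close> the line \<open>x - \<eta> i\<close> reaches \<open>\<eta> (i - 1)\<close>, at
  \<open>b i\<close> the line \<open>\<eta> i - g i + x - q i\<close> reaches
  \<open>(1 - \<delta>) * \<eta> i\<close>, at \<open>d i\<close> the line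
  \<open>g (i - 1) + x - q i\<close> reaches \<open>g i\<close>. Inside a level
  \<open>d i = q i\<close>.\<close>

definition a where "a i = \<eta> i + \<eta> (i - 1)"
definition b where "b i = q i + g i - \<delta> * \<eta> i"
definition d where "d i = q i + g i - g (i - 1)"

lemmas abscissa_defs = q_def c_def a_def b_def d_def

text \<open>The products with \<open>\<delta>\<close> are recorded as separate facts, so that all
  comparisons of abscissas become linear in them.\<close>

lemma basic:
  assumes "i \<ge> i0"
  shows "\<eta> i = \<eta> (i - 1) + g (i - 1)" "g i = g (i - 1) \<or> \<eta> i = g i + g (i - 1)"
    "g (i - 1) \<le> g i" "g i \<le> \<eta> (i - 1)" "0 < g (i - 1)" "\<delta> * \<eta> i < g (i - 1)"
    "\<delta> * \<eta> i = \<delta> * \<eta> (i - 1) + \<delta> * g (i - 1)" "0 \<le> \<delta> * \<eta> (i - 1)" "0 \<le> \<delta> * g (i - 1)"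
    "g (i - 1) + \<delta> * \<eta> (i - 1) \<le> \<eta> (i - 1)"
proof -
  show 1: "\<eta> i = \<eta> (i - 1) + g (i - 1)" "g i = g (i - 1) \<or> \<eta> i = g i + g (i - 1)"
    "g (i - 1) \<le> g i" "g i \<le> \<eta> (i - 1)" "0 < g (i - 1)" "\<delta> * \<eta> i < g (i - 1)"
    using step turn g_mono g_le g_pos \<delta>_small assms by auto
  show "\<delta> * \<eta> i = \<delta> * \<eta> (i - 1) + \<delta> * g (i - 1)" unfolding 1(1) by (simp add: algebra_simps)
  show "0 \<le> \<delta> * \<eta> (i - 1)" "0 \<le> \<delta> * g (i - 1)"
    using 1 \<delta>_nonneg by (auto intro!: mult_nonneg_nonneg)
  show "g (i - 1) + \<delta> * \<eta> (i - 1) \<le> \<eta> (i - 1)"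
  proof (cases "i = i0")
    case True
    then show ?thesis using start by (simp add: algebra_simps)
  next
    case False
    then show ?thesis using step[of "i - 1"] g_le[of "i - 1"] \<delta>_small[of "i - 1"] assms by simp
  qed
qed

lemma abscissas_expand: "q i = 2 * \<eta> i - \<delta> * \<eta> i" "c i = 2 * \<eta> i - \<delta> * \<eta> i + g i"
  "b i = 2 * \<eta> i - 2 * (\<delta> * \<eta> i) + g i" "d i = 2 * \<eta> i - \<delta> * \<eta> i + g i - g (i - 1)"
  by (simp_all add: abscissa_defs algebra_simps)

text \<open>Expanding gives \<open>q i - a i = b i - d i = g (i - 1) - \<delta> * \<eta> i\<close>,
  positive by \<open>\<delta>_small\<close>, and
  \<open>c i - b i = a (i + 1) - c i = \<delta> * \<eta> i\<close>. A shaded area degenerates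
  exactly when \<open>\<delta> = 0\<close>.\<close>

lemma order:
  assumes "i \<ge> i0"
  shows "c (i - 1) \<le> a i" "a i < q i" "q i \<le> d i" "d i < b i" "b i \<le> c i" "c (i - 1) < c i"
    "q i < b i" "c i \<le> a (i + 1)"
proof -
  note B = basic[OF assms]
  have n: "\<eta> (i + 1) = \<eta> i + g i" "\<delta> * \<eta> i \<ge> 0" using basic[of "i + 1"] assms by auto
  show "c (i - 1) \<le> a i" "a i < q i" "q i \<le> d i" "d i < b i" "b i \<le> c i" "c (i - 1) < c i"
    "q i < b i"
    unfolding abscissas_expand a_def using B(1,3-9) n by linarith+
  show "c i \<le> a (i + 1)" unfolding abscissas_expand a_def using n by simp
qed

lemma pieces:
  assumes "i \<ge> i0"
  shows "x \<in> {c (i - 1)..a i} \<Longrightarrow> P j x = [g (i - 1), x - \<eta> i, \<eta> (i - 1)] ! (j - 1)"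
    "x \<in> {a i..q i} \<Longrightarrow> P j x = [g (i - 1), \<eta> (i - 1), x - \<eta> i] ! (j - 1)"
    "x \<in> {q i..d i} \<Longrightarrow> P j x = [g (i - 1) + x - q i, \<eta> (i - 1), (1 - \<delta>) * \<eta> i] ! (j - 1)"
    "x \<in> {d i..b i} \<Longrightarrow> P j x = [g i, \<eta> i - g i + x - q i, (1 - \<delta>) * \<eta> i] ! (j - 1)"
    "x \<in> {b i..c i} \<Longrightarrow> P j x = [g i, (1 - \<delta>) * \<eta> i, \<eta> i - g i + x - q i] ! (j - 1)"
proof -
  note B = basic[OF assms] and O = order[OF assms]
  have E: "(1 - \<delta>) * \<eta> i = \<eta> i - \<delta> * \<eta> i" "q i = 2 * \<eta> i - \<delta> * \<eta> i" by (simp_all add: algebra_simps q_def)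
  have P: "P j x = Phi3 (g i) (min ((1 - \<delta>) * \<eta> i) (x - \<eta> i)) (\<eta> i - g i + max 0 (x - q i)) j"
    if "c (i - 1) \<le> x" "x \<le> c i" for x
    using P_eq[OF assms, of x j] that by (simp add: c_def q_def)
  show "P j x = [g (i - 1), x - \<eta> i, \<eta> (i - 1)] ! (j - 1)" if x: "x \<in> {c (i - 1)..a i}"
  proof -
    have "min ((1 - \<delta>) * \<eta> i) (x - \<eta> i) = x - \<eta> i" "max 0 (x - q i) = 0" "c (i - 1) \<le> x" "x \<le> c i"
      "g (i - 1) \<le> x - \<eta> i" "x - \<eta> i \<le> \<eta> (i - 1)"
      using x O B unfolding abscissas_expand a_def E by auto
    then show ?thesis using B(1,2) by (auto simp: P Phi3_perm)
  qed
  show "P j x = [g (i - 1), \<eta> (i - 1), x - \<eta> i] ! (j - 1)" if x: "x \<in> {a i..q i}"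
  proof -
    have "min ((1 - \<delta>) * \<eta> i) (x - \<eta> i) = x - \<eta> i" "max 0 (x - q i) = 0" "c (i - 1) \<le> x" "x \<le> c i"
      "g (i - 1) \<le> \<eta> (i - 1)" "\<eta> (i - 1) \<le> x - \<eta> i"
      using x O B unfolding abscissas_expand a_def E by auto
    then show ?thesis using B(1,2) by (auto simp: P Phi3_perm)
  qed
  show "P j x = [g (i - 1) + x - q i, \<eta> (i - 1), (1 - \<delta>) * \<eta> i] ! (j - 1)" if x: "x \<in> {q i..d i}"
  proof -
    have *: "min ((1 - \<delta>) * \<eta> i) (x - \<eta> i) = (1 - \<delta>) * \<eta> i" "max 0 (x - q i) = x - q i"
      "c (i - 1) \<le> x" "x \<le> c i"
      "g (i - 1) + x - q i \<le> \<eta> (i - 1)" "\<eta> (i - 1) \<le> (1 - \<delta>) * \<eta> i"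
      using x O B unfolding abscissas_expand a_def E by auto
    \<comment> \<open>Inside a level the interval is the single point \<open>q i\<close>. At the
      start of a level \<open>g i = \<eta> (i - 1)\<close>: the constant line of height
      \<open>g i\<close> is then \<open>P 2\<close>, and the rising line, which starts at
      \<open>g (i - 1)\<close>, is \<open>P 1\<close>.\<close>
    show ?thesis
    proof (cases "g i = g (i - 1)")
      case True
      then have "x = q i" using x by (auto simp: d_def)
      then show ?thesis using B(1) * True by (auto simp: P Phi3_perm)
    next
      case False
      then have **: "\<eta> i - g i + (x - q i) = g (i - 1) + x - q i" "g i = \<eta> (i - 1)" using B(1,2) by auto
      have "P j x = Phi3 (\<eta> (i - 1)) ((1 - \<delta>) * \<eta> i) (g (i - 1) + x - q i) j"
        using P[OF *(3,4)] unfolding *(1,2) **(1) **(2)[symmetric] by simp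
      then show ?thesis using *(5,6) by (simp add: Phi3_perm)
    qed
  qed
  show "P j x = [g i, \<eta> i - g i + x - q i, (1 - \<delta>) * \<eta> i] ! (j - 1)" if x: "x \<in> {d i..b i}"
  proof -
    have *: "min ((1 - \<delta>) * \<eta> i) (x - \<eta> i) = (1 - \<delta>) * \<eta> i" "max 0 (x - q i) = x - q i"
      "c (i - 1) \<le> x" "x \<le> c i"
      "g i \<le> \<eta> i - g i + (x - q i)" "\<eta> i - g i + (x - q i) \<le> (1 - \<delta>) * \<eta> i"
      using x O B unfolding abscissas_expand a_def E by auto
    have "P j x = Phi3 (g i) ((1 - \<delta>) * \<eta> i) (\<eta> i - g i + x - q i) j"
      using P[OF *(3,4)] unfolding *(1,2) by (simp add: add_diff_eq)
    then show ?thesis using *(5,6) by (simp add: Phi3_perm add_diff_eq)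
  qed
  show "P j x = [g i, (1 - \<delta>) * \<eta> i, \<eta> i - g i + x - q i] ! (j - 1)" if x: "x \<in> {b i..c i}"
  proof -
    have *: "min ((1 - \<delta>) * \<eta> i) (x - \<eta> i) = (1 - \<delta>) * \<eta> i" "max 0 (x - q i) = x - q i"
      "c (i - 1) \<le> x" "x \<le> c i"
      "g i \<le> (1 - \<delta>) * \<eta> i" "(1 - \<delta>) * \<eta> i \<le> \<eta> i - g i + (x - q i)"
      using x O B unfolding abscissas_expand a_def E by auto
    have "P j x = Phi3 (g i) ((1 - \<delta>) * \<eta> i) (\<eta> i - g i + x - q i) j"
      using P[OF *(3,4)] unfolding *(1,2) by (simp add: add_diff_eq)
    then show ?thesis using *(5,6) by (simp add: Phi3_perm add_diff_eq)
  qed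
qed

lemma three_set: "{1..3} = {1, 2, 3 :: nat}" by auto

lemma segs:
  assumes "i \<ge> i0"
  shows "seg P 2 (c (i - 1)) (a i)" "seg P 3 (a i) (q i)" "seg P 1 (q i) (d i)"
    "seg P 2 (d i) (b i)" "seg P 3 (b i) (c i)"
  unfolding seg_def slope_on_def three_set using pieces[OF assms] by auto

lemma meets:
  assumes "i \<ge> i0"
  shows "P 2 (a i) = P 3 (a i)" "P 2 (b i) = P 3 (b i)" "q i < d i \<Longrightarrow> P 1 (d i) = P 2 (d i)"
proof -
  note O = order[OF assms] and S = pieces[OF assms] and B = basic[OF assms]
  show "P 2 (a i) = P 3 (a i)" using S(1)[of "a i"] O by (simp add: a_def)
  show "P 2 (b i) = P 3 (b i)" using S(5)[of "b i"] O by (simp add: b_def algebra_simps)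
  show "P 1 (d i) = P 2 (d i)" if "q i < d i"
    using that S(4)[of "d i"] O B(2) by (auto simp: d_def)
qed

section \<open>Pieces of P around a point and the 3-system property\<close>

lemma index_exists_right:
  assumes "c (i0 - 1) \<le> x"
  obtains i where "i \<ge> i0" "c (i - 1) \<le> x" "x < c i"
proof -
  obtain i' where i': "i' \<ge> i0" "x < c i'" using unbounded[of x] unfolding c_def q_def by auto
  define n where "n = (LEAST n::nat. x < c (i0 + int n))"
  have ex: "x < c (i0 + int (nat (i' - i0)))" using i' by simp
  have n: "x < c (i0 + int n)" unfolding n_def by (rule LeastI, rule ex)
  have "c (i0 + int n - 1) \<le> x"
  proof (cases n)
    case 0
    then show ?thesis using assms by simp
  next
    case (Suc m)
    then have "\<not> x < c (i0 + int m)" using not_less_Least[of m "\<lambda>n. x < c (i0 + int n)"] unfolding n_def by simp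
    then show ?thesis using Suc by simp
  qed
  then show ?thesis using that[of "i0 + int n"] n by simp
qed

text \<open>Half-open on the left, so that the interval found contains points just before
  \<open>x\<close>; the left-hand pieces need this.\<close>

lemma index_exists_left:
  assumes "c (i0 - 1) < x"
  obtains i where "i \<ge> i0" "c (i - 1) < x" "x \<le> c i"
proof -
  obtain i where i: "i \<ge> i0" "c (i - 1) \<le> x" "x < c i" using index_exists_right[of x] assms by auto
  show ?thesis
  proof (cases "c (i - 1) < x")
    case True
    then show ?thesis using that[of i] i by simp
  next
    case False
    then have x: "x = c (i - 1)" using i by simp
    then have "i \<noteq> i0" using assms by auto
    then show ?thesis using that[of "i - 1"] i x order(6)[of "i - 1"] by auto
  qed
qed

lemma right_seg:
  assumes "c (i0 - 1) \<le> x"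
  shows "\<exists>\<epsilon>>0. \<exists>r\<in>{1..3}. seg P r x (x + \<epsilon>)"
proof -
  obtain i where i: "i \<ge> i0" "c (i - 1) \<le> x" "x < c i" using index_exists_right[OF assms] .
  have *: ?thesis if "seg P r u v" "u \<le> x" "x < v" "r \<in> {1..3}" for r u v
    using that by (intro exI[of _ "v - x"] conjI bexI[of _ r]) (auto intro: seg_subset)
  consider "x < a i" | "a i \<le> x" "x < q i" | "q i \<le> x" "x < d i" | "d i \<le> x" "x < b i" | "b i \<le> x"
    by linarith
  then show ?thesis using *[OF segs(1)[OF i(1)]] *[OF segs(2)[OF i(1)]] *[OF segs(3)[OF i(1)]]
      *[OF segs(4)[OF i(1)]] *[OF segs(5)[OF i(1)]] i(2,3) by cases simp_all
qed

lemma both_seg: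
  assumes x: "c (i0 - 1) < x"
  shows "\<exists>\<epsilon>>0. \<exists>r\<in>{1..3}. \<exists>m\<in>{1..3}. seg P r (x - \<epsilon>) x \<and> seg P m x (x + \<epsilon>) \<and>
        (\<forall>j\<in>{r..<m}. P j x = P (j + 1) x)"
proof -
  obtain i where i: "i \<ge> i0" "c (i - 1) < x" "x \<le> c i" using index_exists_left[OF x] .
  note O = order[OF i(1)] and S = segs[OF i(1)]
  have *: ?thesis if "seg P r u x" "u < x" "r \<in> {1..3}" "seg P m x v" "x < v" "m \<in> {1..3}"
    "\<forall>j\<in>{r..<m}. P j x = P (j + 1) x" for r u m v
  proof -
    define e where "e = min (x - u) (v - x)"
    have "seg P r (x - e) x" "seg P m x (x + e)" "e > 0"
      using that unfolding e_def by (auto intro: seg_subset)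
    then show ?thesis using that by blast
  qed
  have same: ?thesis if "seg P r u v" "u < x" "x < v" "r \<in> {1..3}" for r u v
    by (rule *[of r u r v]) (use that in \<open>auto intro: seg_subset\<close>)
  obtain \<epsilon> m where R: "\<epsilon> > 0" "m \<in> {1..3}" "seg P m x (x + \<epsilon>)"
    using right_seg[of x] x by auto
  \<comment> \<open>A piece of type 3 ends without condition, as \<open>{3..<m}\<close> is empty.
    The type on the right is left open because some intervals degenerate, inside a level or for
    \<open>\<delta> = 0\<close>.\<close>
  have last: ?thesis if "seg P 3 u v" "u < x" "x \<le> v" for u v
    by (rule *[of 3 u m "x + \<epsilon>"]) (use R that in \<open>auto intro: seg_subset\<close>)
  consider "x < a i" | "x = a i" | "a i < x" "x \<le> q i" | "q i < x" "x < d i" | "x = d i" "q i < x"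
    | "d i < x" "x < b i" | "x = b i" | "b i < x"
    by linarith
  then show ?thesis
  proof cases
    case 1 then show ?thesis using same[OF S(1)] i by simp
  next
    case 2
    have "\<forall>j\<in>{2..<3}. P j x = P (j + 1) x"
    proof
      fix j :: nat assume "j \<in> {2..<3}"
      then have "j = 2" by auto
      then show "P j x = P (j + 1) x" using 2 meets[OF i(1)] by simp
    qed
    then show ?thesis using *[of 2 "c (i - 1)" 3 "q i"] S(1,2) 2 i O by simp
  next
    case 3 then show ?thesis using last[OF S(2)] by simp
  next
    case 4 then show ?thesis using same[OF S(3)] by simp
  next
    case 5
    have "\<forall>j\<in>{1..<2}. P j x = P (j + 1) x"
    proof
      fix j :: nat assume "j \<in> {1..<2}"
      then have "j = 1" by auto
      then show "P j x = P (j + 1) x" using 5 meets[OF i(1)] by (simp add: numeral_2_eq_2)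
    qed
    then show ?thesis using *[of 1 "q i" 2 "b i"] S(3,4) 5 i O by simp
  next
    case 6 then show ?thesis using same[OF S(4)] by simp
  next
    case 7
    have "\<forall>j\<in>{2..<m}. P j x = P (j + 1) x"
    proof
      fix j :: nat assume "j \<in> {2..<m}"
      then have "j = 2" using R(2) by auto
      then show "P j x = P (j + 1) x" using 7 meets[OF i(1)] by simp
    qed
    then show ?thesis using *[of 2 "d i" m "x + \<epsilon>"] S(4) R 7 i O by simp
  next
    case 8 then show ?thesis using last[OF S(5)] i by simp
  qed
qed

lemma P_order:
  assumes "c (i0 - 1) \<le> x"
  shows "0 \<le> P 1 x \<and> P 1 x \<le> P 2 x \<and> P 2 x \<le> P 3 x \<and> P 1 x + P 2 x + P 3 x = x"
proof -
  obtain i where i: "i \<ge> i0" "c (i - 1) \<le> x" "x < c i" using index_exists_right[OF assms] .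
  note O = order[OF i(1)] and S = pieces[OF i(1), of x]
  note B = basic[OF i(1)]
  consider "x \<in> {c (i - 1)..a i}" | "x \<in> {a i..q i}" | "x \<in> {q i..d i}" | "x \<in> {d i..b i}" | "x \<in> {b i..c i}"
    using i by fastforce
  then show ?thesis
    by cases (use B in \<open>auto simp: S abscissas_expand a_def algebra_simps\<close>)
qed

theorem three_system: "three_system (q i0) P"
proof (rule three_systemI)
  have le: "c (i0 - 1) < q i0" using order(1,2)[of i0] by simp
  show "0 \<le> P 1 x \<and> P 1 x \<le> P 2 x \<and> P 2 x \<le> P 3 x \<and> P 1 x + P 2 x + P 3 x = x"
    if "q i0 \<le> x" for x using P_order[of x] that le by simp
  show "\<exists>\<epsilon>>0. \<exists>r\<in>{1..3}. seg P r x (x + \<epsilon>)" if "q i0 \<le> x" for x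
    using right_seg[of x] that le by simp
  show "\<exists>\<epsilon>>0. \<exists>r\<in>{1..3}. \<exists>m\<in>{1..3}. seg P r (x - \<epsilon>) x \<and> seg P m x (x + \<epsilon>) \<and>
        (\<forall>j\<in>{r..<m}. P j x = P (j + 1) x)" if "q i0 < x" for x
    using both_seg[of x] that le by simp
qed

text \<open>Yields closed forms for the infimum and the supremum that define the end points of I_i.
  Before \<open>a i\<close> the maximum is \<open>\<eta> (i - 1)\<close>, still above the line
  \<open>x - \<eta> i\<close>; after \<open>b i\<close> it is the rising line that has crossed
  \<open>(1 - \<delta>) * \<eta> i\<close>.\<close>

lemma P3_maximal_set:
  assumes "i \<ge> i0"
  shows "{x \<in> {c (i - 1)..c i}. P 3 x = min ((1 - \<delta>) * \<eta> i) (x - \<eta> i)} = {a i..b i}"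
proof -
  note O = order[OF assms] and B = basic[OF assms]
  have E: "(1 - \<delta>) * \<eta> i = \<eta> i - \<delta> * \<eta> i" by (simp add: algebra_simps)
  have "P 3 x = min ((1 - \<delta>) * \<eta> i) (x - \<eta> i) \<longleftrightarrow> a i \<le> x \<and> x \<le> b i" if x: "x \<in> {c (i - 1)..c i}" for x
  proof -
    note S = pieces[OF assms, of x 3]
    have lo: "min ((1 - \<delta>) * \<eta> i) (x - \<eta> i) = x - \<eta> i" if "x \<le> q i"
      using that unfolding E abscissas_expand by linarith
    have hi: "min ((1 - \<delta>) * \<eta> i) (x - \<eta> i) = (1 - \<delta>) * \<eta> i" if "q i \<le> x"
      using that unfolding E abscissas_expand by linarith
    consider "x \<in> {c (i - 1)..a i}" | "x \<in> {a i..q i}" | "x \<in> {q i..d i}" | "x \<in> {d i..b i}" | "x \<in> {b i..c i}"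
      using x by fastforce
    then show ?thesis
    proof cases
      case 1
      then have "P 3 x = \<eta> (i - 1)" "min ((1 - \<delta>) * \<eta> i) (x - \<eta> i) = x - \<eta> i"
        using S(1) lo O by auto
      then show ?thesis using 1 O unfolding a_def by auto
    next
      case 2
      then show ?thesis using S(2) lo O by auto
    next
      case 3
      then show ?thesis using S(3) hi O by auto
    next
      case 4
      then show ?thesis using S(4) hi O by auto
    next
      case 5
      then have "P 3 x = \<eta> i - g i + x - q i" "min ((1 - \<delta>) * \<eta> i) (x - \<eta> i) = \<eta> i - \<delta> * \<eta> i" "a i \<le> x"
        using S(5) hi O E by auto
      then show ?thesis using 5 unfolding b_def by auto
    qed
  qed
  then show ?thesis using O by auto
qed

lemma graph:
  assumes "i \<ge> i0"
  shows "slope_on 1 (P 3) {a i..q i}" "slope_on 0 (P 3) {q i..b i}"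
    "g i = g (i - 1) \<Longrightarrow> slope_on 0 (P 1) {a i..b i} \<and> slope_on 0 (P 2) {a i..q i} \<and> slope_on 1 (P 2) {q i..b i}"
    "slope_on 0 (P 1) {a i..q i} \<and> slope_on 1 (P 1) {q i..d i} \<and> slope_on 0 (P 1) {d i..b i} \<and>
        slope_on 0 (P 2) {a i..d i} \<and> slope_on 1 (P 2) {d i..b i}"
    "slope_on 0 (P 1) {b i..a (i + 1)}" "slope_on 1 (P 3) {b i..c i}" "slope_on 0 (P 3) {c i..a (i + 1)}"
    "slope_on 0 (P 2) {b i..c i}" "slope_on 1 (P 2) {c i..a (i + 1)}"
proof -
  note O = order[OF assms] and S = segs[OF assms] and S' = segs[of "i + 1"]
  have glue: "slope_on m f {x..z}" if "slope_on m f {x..y}" "slope_on m f {y..z}" "x \<le> y" "y \<le> z" for m f x y z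
    unfolding slope_on_def
  proof (intro ballI)
    have *: "f u - f y = m * (u - y)" if "u \<in> {x..z}" for u
      using \<open>slope_on m f {x..y}\<close> \<open>slope_on m f {y..z}\<close> \<open>x \<le> y\<close> \<open>y \<le> z\<close> that unfolding slope_on_def by (cases "u \<le> y") auto
    fix u v assume "u \<in> {x..z}" "v \<in> {x..z}"
    from *[OF this(1)] *[OF this(2)] show "f v - f u = m * (v - u)" by (simp add: algebra_simps)
  qed
  have S: "slope_on (if j = 2 then 1 else 0) (P j) {c (i - 1)..a i}"
    "slope_on (if j = 3 then 1 else 0) (P j) {a i..q i}"
    "slope_on (if j = 1 then 1 else 0) (P j) {q i..d i}"
    "slope_on (if j = 2 then 1 else 0) (P j) {d i..b i}"
    "slope_on (if j = 3 then 1 else 0) (P j) {b i..c i}"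
    "slope_on (if j = 2 then 1 else 0) (P j) {c i..a (i + 1)}" if "j \<in> {1..3}" for j
    using S S' that assms unfolding seg_def by auto
  show "slope_on 1 (P 3) {a i..q i}" "slope_on 1 (P 3) {b i..c i}" "slope_on 0 (P 3) {c i..a (i + 1)}"
    "slope_on 0 (P 2) {b i..c i}" "slope_on 1 (P 2) {c i..a (i + 1)}"
    using S[of 2] S[of 3] by auto
  show "slope_on 0 (P 3) {q i..b i}"
    by (rule glue[of _ _ _ "d i"]) (use S[of 3] O in auto)
  show "slope_on 0 (P 1) {b i..a (i + 1)}"
    by (rule glue[of _ _ _ "c i"]) (use S[of 1] O in auto)
  show 4: "slope_on 0 (P 1) {a i..q i} \<and> slope_on 1 (P 1) {q i..d i} \<and> slope_on 0 (P 1) {d i..b i} \<and>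
        slope_on 0 (P 2) {a i..d i} \<and> slope_on 1 (P 2) {d i..b i}"
  proof (intro conjI)
    show "slope_on 0 (P 2) {a i..d i}"
      by (rule glue[of _ _ _ "q i"]) (use S[of 2] O in auto)
  qed (use S[of 1] S[of 2] in auto)
  show "slope_on 0 (P 1) {a i..b i} \<and> slope_on 0 (P 2) {a i..q i} \<and> slope_on 1 (P 2) {q i..b i}"
    if "g i = g (i - 1)"
  proof -
    have "d i = q i" using that by (simp add: d_def)
    then show ?thesis using 4 O by (auto intro: glue[of _ _ _ "q i"])
  qed
qed

end

section \<open>Lattice points and successive minima\<close>

text \<open>The set whose infimum is the \<open>j\<close>-th successive minimum, with membership in
  the dilated body spelled out as two inequalities.\<close>

definition radii :: "real^3 \<Rightarrow> nat \<Rightarrow> real \<Rightarrow> real set" where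
  "radii u j q = {r. r > 0 \<and> (\<exists>S. S \<subseteq> integer_points \<and> independent S \<and> card S = j \<and>
     (\<forall>v\<in>S. norm v \<le> r \<and> \<bar>v \<bullet> u\<bar> \<le> r * exp (- q)))}"

lemma mem_scaled_convex_body:
  assumes "r > 0"
  shows "v \<in> (*\<^sub>R) r ` convex_body u (exp q) \<longleftrightarrow> norm v \<le> r \<and> \<bar>v \<bullet> u\<bar> \<le> r * exp (- q)"
proof
  assume "v \<in> (*\<^sub>R) r ` convex_body u (exp q)"
  then obtain x where "v = r *\<^sub>R x" "norm x \<le> 1" "\<bar>x \<bullet> u\<bar> \<le> 1 / exp q"
    unfolding convex_body_def by auto
  then show "norm v \<le> r \<and> \<bar>v \<bullet> u\<bar> \<le> r * exp (- q)"
    using assms by (auto simp: abs_mult exp_minus inverse_eq_divide mult_left_mono[of _ "1 / exp q" r, simplified])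
next
  assume *: "norm v \<le> r \<and> \<bar>v \<bullet> u\<bar> \<le> r * exp (- q)"
  have "v = r *\<^sub>R (v /\<^sub>R r)" using assms by simp
  moreover have "v /\<^sub>R r \<in> convex_body u (exp q)"
    using assms * unfolding convex_body_def
    by (auto simp: abs_mult exp_minus field_simps)
  ultimately show "v \<in> (*\<^sub>R) r ` convex_body u (exp q)" by blast
qed

lemma successive_minimum_eq: "successive_minimum j (convex_body u (exp q)) = Inf (radii u j q)"
proof -
  have "{r. r > 0 \<and> (\<exists>S. S \<subseteq> integer_points \<inter> (*\<^sub>R) r ` convex_body u (exp q) \<and> independent S \<and> card S = j)}
    = radii u j q"
    unfolding radii_def
  proof (intro Collect_cong conj_cong refl)
    fix r :: real assume "0 < r"
    then show "(\<exists>S. S \<subseteq> integer_points \<inter> (*\<^sub>R) r ` convex_body u (exp q) \<and> independent S \<and> card S = j) \<longleftrightarrow>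
      (\<exists>S. S \<subseteq> integer_points \<and> independent S \<and> card S = j \<and>
     (\<forall>v\<in>S. norm v \<le> r \<and> \<bar>v \<bullet> u\<bar> \<le> r * exp (- q)))"
      using mem_scaled_convex_body[of r _ u q] by blast
  qed
  then show ?thesis unfolding successive_minimum_def by simp
qed

lemma norm_integer_point_ge_1:
  assumes "v \<in> integer_points" "v \<noteq> 0"
  shows "1 \<le> norm v"
proof -
  obtain i where "v $ i \<noteq> 0" using assms(2) by (auto simp: vec_eq_iff)
  moreover have "v $ i \<in> \<int>" using assms(1) by (simp add: integer_points_def)
  ultimately have "1 \<le> \<bar>v $ i\<bar>" using Ints_nonzero_abs_ge1 by blast
  also have "\<dots> \<le> norm v" by (rule component_le_norm_cart)
  finally show ?thesis .
qed

lemma radii_ge_1: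
  assumes "r \<in> radii u j q" "j > 0"
  shows "1 \<le> r"
proof -
  obtain S where S: "S \<subseteq> integer_points" "independent S" "card S = j" "\<forall>v\<in>S. norm v \<le> r"
    using assms(1) unfolding radii_def by auto
  then obtain v where "v \<in> S" using assms(2) by fastforce
  moreover have "v \<noteq> 0" using \<open>v \<in> S\<close> S(2) dependent_zero by blast
  ultimately show ?thesis using norm_integer_point_ge_1[of v] S by force
qed

lemma bdd_below_radii: "j > 0 \<Longrightarrow> bdd_below (radii u j q)"
  using radii_ge_1 by (meson bdd_below.I)

text \<open>Standard basis vectors fit into a large dilate. Non-emptiness matters because the
  infimum of an empty set of reals carries no information.\<close>

lemma radii_nonempty:
  assumes "j \<le> 3"
  shows "radii u j q \<noteq> {}"
proof -
  have "card (Basis :: (real^3) set) = 3" by simp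
  then obtain S :: "(real^3) set" where S: "S \<subseteq> Basis" "card S = j"
    using assms by (metis obtain_subset_with_card_n)
  have fin: "finite S" using S finite_Basis finite_subset by blast
  define r where "r = 1 + norm u * exp q"
  have r: "r > 0" by (simp add: r_def add_pos_nonneg)
  have "norm v \<le> r \<and> \<bar>v \<bullet> u\<bar> \<le> r * exp (- q)" if "v \<in> S" for v
  proof -
    have n: "norm v = 1" using that S by (auto intro: norm_Basis)
    have "\<bar>v \<bullet> u\<bar> \<le> norm u" using Cauchy_Schwarz_ineq2[of v u] n by simp
    also have "\<dots> \<le> r * exp (- q)" unfolding r_def by (simp add: algebra_simps exp_minus)
    finally show ?thesis using n by (simp add: r_def)
  qed
  moreover have "S \<subseteq> integer_points"
  proof
    fix v assume "v \<in> S"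
    then obtain k where "v = axis k 1" using S by (auto simp: Basis_vec_def)
    then show "v \<in> integer_points" by (auto simp: integer_points_def axis_def)
  qed
  moreover have "independent S" using S independent_Basis independent_mono by blast
  ultimately show ?thesis unfolding radii_def using r S by blast
qed

lemma Lmap_eq: "Lmap u j q = ln (Inf (radii u j q))"
  unfolding Lmap_def successive_minimum_eq ..

lemma Inf_radii_ge_1: "0 < j \<Longrightarrow> j \<le> 3 \<Longrightarrow> 1 \<le> Inf (radii u j q)"
  using radii_ge_1 radii_nonempty by (meson cInf_greatest)

lemma Lmap_le:
  assumes "r \<in> radii u j q" "0 < j" "j \<le> 3"
  shows "Lmap u j q \<le> ln r"
proof -
  have "Inf (radii u j q) \<le> r" using assms bdd_below_radii by (intro cInf_lower)
  then show ?thesis unfolding Lmap_eq using Inf_radii_ge_1[OF assms(2,3), of u q] by simp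
qed

lemma Lmap_mono_q:
  assumes "q \<le> q'" "0 < j" "j \<le> 3"
  shows "Lmap u j q \<le> Lmap u j q'"
proof -
  have "radii u j q' \<subseteq> radii u j q"
    unfolding radii_def
  proof (intro subsetI CollectI)
    fix r assume "r \<in> {r. r > 0 \<and> (\<exists>S. S \<subseteq> integer_points \<and> independent S \<and> card S = j \<and>
     (\<forall>v\<in>S. norm v \<le> r \<and> \<bar>v \<bullet> u\<bar> \<le> r * exp (- q')))}"
    then obtain S where *: "0 < r" "S \<subseteq> integer_points" "independent S" "card S = j"
      "\<forall>v\<in>S. norm v \<le> r \<and> \<bar>v \<bullet> u\<bar> \<le> r * exp (- q')" by blast
    have le: "r * exp (- q') \<le> r * exp (- q)" using * assms by simp
    have "\<forall>v\<in>S. norm v \<le> r \<and> \<bar>v \<bullet> u\<bar> \<le> r * exp (- q)"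
    proof
      fix v assume "v \<in> S"
      with *(5) have "norm v \<le> r" "\<bar>v \<bullet> u\<bar> \<le> r * exp (- q')" by auto
      with le show "norm v \<le> r \<and> \<bar>v \<bullet> u\<bar> \<le> r * exp (- q)" by simp
    qed
    with *(1-4) show "r > 0 \<and> (\<exists>S. S \<subseteq> integer_points \<and> independent S \<and> card S = j \<and>
     (\<forall>v\<in>S. norm v \<le> r \<and> \<bar>v \<bullet> u\<bar> \<le> r * exp (- q)))"
      by blast
  qed
  then have "Inf (radii u j q) \<le> Inf (radii u j q')"
    by (rule cInf_superset_mono[OF radii_nonempty[OF assms(3)] bdd_below_radii[OF assms(2)]])
  then show ?thesis unfolding Lmap_eq using Inf_radii_ge_1[OF assms(2,3), of u q] by simp
qed

lemma Lmap_2_le_3: "Lmap u 2 q \<le> Lmap u 3 q"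
proof -
  have "radii u 3 q \<subseteq> radii u 2 q"
  proof
    fix r assume "r \<in> radii u 3 q"
    then obtain S where S: "0 < r" "S \<subseteq> integer_points" "independent S" "card S = 3"
      "\<forall>v\<in>S. norm v \<le> r \<and> \<bar>v \<bullet> u\<bar> \<le> r * exp (- q)" unfolding radii_def by auto
    obtain T where "T \<subseteq> S" "card T = 2" using S(4) obtain_subset_with_card_n[of 2 S] by auto
    then show "r \<in> radii u 2 q" unfolding radii_def using S independent_mono by blast
  qed
  then have "Inf (radii u 2 q) \<le> Inf (radii u 3 q)"
    using radii_nonempty[of 3] bdd_below_radii[of 2] by (intro cInf_superset_mono) auto
  then show ?thesis unfolding Lmap_eq using Inf_radii_ge_1[of 2 u q] by simp
qed

section \<open>Lower bound for L_1 + L_2 + L_3 from integrality of determinants\<close>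

lemma mem_span_pair_iff: "v \<in> span {a, b :: real^3} \<longleftrightarrow> (\<exists>s t. v = s *\<^sub>R a + t *\<^sub>R b)"
proof -
  have "v \<in> span {a, b} \<longleftrightarrow> (\<exists>s t. v - s *\<^sub>R a = t *\<^sub>R b)"
    by (auto simp: span_insert span_singleton)
  also have "\<dots> \<longleftrightarrow> (\<exists>s t. v = s *\<^sub>R a + t *\<^sub>R b)" by (simp add: diff_eq_eq add.commute)
  finally show ?thesis .
qed

lemma span_orthogonal_pair:
  fixes a b y :: "real^3"
  assumes "independent {a, b}" "a \<noteq> b" "y \<noteq> 0" "a \<bullet> y = 0" "b \<bullet> y = 0" "v \<bullet> y = 0"
  shows "v \<in> span {a, b}"
proof -
  have "dim {x. y \<bullet> x = 0} = 2" using dim_hyperplane[OF assms(3)] by simp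
  moreover have "dim (span {a, b}) = 2" using assms(1,2) by (simp add: dim_eq_card_independent)
  moreover have "span {a, b} \<subseteq> {x. y \<bullet> x = 0}"
    using assms(4,5) by (intro span_minimal subspace_hyperplane) (auto simp: inner_commute)
  ultimately have "span {a, b} = {x. y \<bullet> x = 0}"
    by (intro subspace_dim_equal) (auto intro: subspace_hyperplane)
  then show ?thesis using assms(6) by (auto simp: inner_commute)
qed

lemma independent_pair_iff_cross:
  fixes a b :: "real^3"
  shows "independent {a, b} \<and> a \<noteq> b \<longleftrightarrow> cross3 a b \<noteq> 0"
proof -
  have "cross3 a b = 0 \<longleftrightarrow> collinear {0, a, b}" by (rule cross_eq_0)
  also have "\<dots> \<longleftrightarrow> \<not> (independent {a, b} \<and> a \<noteq> b)"
  proof (cases "a = b")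
    case True
    then show ?thesis by (simp add: collinear_2)
  next
    case False
    have "independent {b, a} \<longleftrightarrow> a \<noteq> 0 \<and> b \<notin> span {a}"
      using False by (simp add: independent_insert)
    moreover have "b \<in> span {a} \<longleftrightarrow> (\<exists>c. b = c *\<^sub>R a)" unfolding span_singleton by auto
    moreover have "b = 0 \<Longrightarrow> \<exists>c. b = c *\<^sub>R a" by (intro exI[of _ 0]) simp
    ultimately show ?thesis unfolding collinear_lemma using False by (metis insert_commute)
  qed
  finally show ?thesis by blast
qed

lemma integer_points_inner_cross:
  assumes "x \<in> integer_points" "y \<in> integer_points" "z \<in> integer_points"
  shows "x \<bullet> cross3 y z \<in> \<int>"
  using assms unfolding integer_points_def cross3_def inner_vec_def sum_3
  by (auto intro!: Ints_add Ints_diff Ints_mult)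

text \<open>As \<open>u $ 1 = 1\<close>, the first coordinates in the determinant of the three
  points can be replaced by the products with \<open>u\<close>. Expanding along that column leaves
  three terms, each with a minor made of two products, whence the factor 6.\<close>

lemma abs_triple_le:
  fixes x y z u :: "real^3"
  assumes u: "u $ 1 = 1" and "norm x \<le> r" "norm y \<le> s" "norm z \<le> t"
    and "\<bar>x \<bullet> u\<bar> \<le> r * e" "\<bar>y \<bullet> u\<bar> \<le> s * e" "\<bar>z \<bullet> u\<bar> \<le> t * e"
  shows "\<bar>x \<bullet> cross3 y z\<bar> \<le> 6 * (r * s * t * e)"
proof -
  have c: "\<bar>x $ i\<bar> \<le> r" "\<bar>y $ i\<bar> \<le> s" "\<bar>z $ i\<bar> \<le> t" for i
    using component_le_norm_cart[of x i] component_le_norm_cart[of y i] component_le_norm_cart[of z i] assms by auto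
  have h: "\<bar>p * (a * b - c' * d)\<bar> \<le> P * e * (S * T + S * T)"
    if "\<bar>p\<bar> \<le> P * e" "\<bar>a\<bar> \<le> S" "\<bar>b\<bar> \<le> T" "\<bar>c'\<bar> \<le> S" "\<bar>d\<bar> \<le> T"
    for p P a b c' d S T :: real
  proof -
    have "\<bar>a * b\<bar> \<le> S * T" "\<bar>c' * d\<bar> \<le> S * T" unfolding abs_mult by (rule mult_mono'; use that in simp)+
    then have "\<bar>a * b - c' * d\<bar> \<le> S * T + S * T" by linarith
    then show ?thesis unfolding abs_mult by (rule mult_mono'[OF that(1)]) simp_all
  qed
  have eq: "x \<bullet> cross3 y z = (x \<bullet> u) * (y $ 2 * z $ 3 - y $ 3 * z $ 2) - (y \<bullet> u) * (x $ 2 * z $ 3 - x $ 3 * z $ 2)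
    + (z \<bullet> u) * (x $ 2 * y $ 3 - x $ 3 * y $ 2)"
    by (simp add: cross3_def inner_vec_def sum_3 u algebra_simps)
  have tri: "\<bar>a - b + c'\<bar> \<le> A + B + C" if "\<bar>a\<bar> \<le> A" "\<bar>b\<bar> \<le> B" "\<bar>c'\<bar> \<le> C" for a b c' A B C :: real
    using that by linarith
  have "\<bar>x \<bullet> cross3 y z\<bar> \<le> r * e * (s * t + s * t) + s * e * (r * t + r * t) + t * e * (r * s + r * s)"
    unfolding eq by (intro tri h c assms)
  then show ?thesis by (simp add: algebra_simps)
qed

text \<open>Counting dimensions, each family contains a point outside the span of those already
  chosen, and the determinant of the three points is a non-zero integer. This is the elementary half
  of Minkowski's second theorem.\<close>

lemma radii_prod_ge:
  assumes u: "u $ 1 = 1" and r: "r1 \<in> radii u 1 q" "r2 \<in> radii u 2 q" "r3 \<in> radii u 3 q"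
  shows "exp q \<le> 6 * (r1 * r2 * r3)"
proof -
  obtain S1 where S1: "S1 \<subseteq> integer_points" "independent S1" "card S1 = 1"
     "\<forall>v\<in>S1. norm v \<le> r1 \<and> \<bar>v \<bullet> u\<bar> \<le> r1 * exp (- q)" using r(1) unfolding radii_def by auto
  obtain S2 where S2: "S2 \<subseteq> integer_points" "independent S2" "card S2 = 2"
     "\<forall>v\<in>S2. norm v \<le> r2 \<and> \<bar>v \<bullet> u\<bar> \<le> r2 * exp (- q)" using r(2) unfolding radii_def by auto
  obtain S3 where S3: "S3 \<subseteq> integer_points" "independent S3" "card S3 = 3"
     "\<forall>v\<in>S3. norm v \<le> r3 \<and> \<bar>v \<bullet> u\<bar> \<le> r3 * exp (- q)" using r(3) unfolding radii_def by auto
  obtain x where x: "x \<in> S1" using S1(3) by fastforce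
  have x0: "x \<noteq> 0" using S1(2) x dependent_zero by blast
  have "\<not> S2 \<subseteq> span {x}" using independent_span_bound[of "{x}" S2] S2 by auto
  then obtain y where y: "y \<in> S2" "y \<notin> span {x}" by blast
  have "card {x, y} \<le> 2" by (simp add: card_insert_if)
  then have "\<not> S3 \<subseteq> span {x, y}" using independent_span_bound[of "{x, y}" S3] S3 by auto
  then obtain z where z: "z \<in> S3" "z \<notin> span {x, y}" by blast
  have ind: "independent {x, y}" "x \<noteq> y"
  proof -
    show "x \<noteq> y" using y span_base by blast
    have "independent {y, x}" by (rule independent_insertI[OF y(2)]) (simp add: x0)
    then show "independent {x, y}" by (simp add: insert_commute)
  qed
  have "cross3 x y \<noteq> 0" using independent_pair_iff_cross[of x y] ind by simp
  then have "z \<bullet> cross3 x y \<noteq> 0"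
    using span_orthogonal_pair[OF ind, of "cross3 x y" z] z by (auto simp: dot_cross_self)
  moreover have "z \<bullet> cross3 x y \<in> \<int>" using integer_points_inner_cross x y z S1 S2 S3 by blast
  ultimately have "1 \<le> \<bar>z \<bullet> cross3 x y\<bar>" using Ints_nonzero_abs_ge1 by blast
  also have "\<dots> \<le> 6 * (r3 * r1 * r2 * exp (- q))"
    using abs_triple_le[OF u, of z r3 x r1 y r2 "exp (- q)"] x y z S1 S2 S3 by blast
  finally have "1 * exp q \<le> 6 * (r3 * r1 * r2 * exp (- q)) * exp q" by (intro mult_right_mono) auto
  also have "\<dots> = 6 * (r1 * r2 * r3) * (exp (- q) * exp q)" by (simp only: mult_ac)
  also have "\<dots> = 6 * (r1 * r2 * r3)" by (simp add: exp_minus)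
  finally show ?thesis by simp
qed

text \<open>No minimum is assumed to be attained, so the infimum is taken in one radius at a time,
  the others being fixed.\<close>

lemma Lmap_sum_ge:
  assumes u: "u $ 1 = 1"
  shows "q - ln 6 \<le> Lmap u 1 q + Lmap u 2 q + Lmap u 3 q"
proof -
  define I where "I j = Inf (radii u j q)" for j
  have I: "1 \<le> I 1" "1 \<le> I 2" "1 \<le> I 3" unfolding I_def by (auto intro!: Inf_radii_ge_1)
  have 1: "exp q \<le> 6 * (I 1 * r2 * r3)" if r: "r2 \<in> radii u 2 q" "r3 \<in> radii u 3 q" for r2 r3
  proof -
    have p: "r2 > 0" "r3 > 0" using radii_ge_1[OF r(1)] radii_ge_1[OF r(2)] by auto
    have "exp q / (6 * (r2 * r3)) \<le> I 1" unfolding I_def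
    proof (rule cInf_greatest)
      show "radii u 1 q \<noteq> {}" by (rule radii_nonempty) simp
      show "exp q / (6 * (r2 * r3)) \<le> x" if "x \<in> radii u 1 q" for x
        using radii_prod_ge[OF u that r] p by (simp add: field_simps)
    qed
    then show ?thesis using p by (simp add: field_simps)
  qed
  have 2: "exp q \<le> 6 * (I 1 * I 2 * r3)" if r: "r3 \<in> radii u 3 q" for r3
  proof -
    have p: "r3 > 0" "I 1 > 0" using radii_ge_1[OF r(1)] I by auto
    have "exp q / (6 * (I 1 * r3)) \<le> I 2" unfolding I_def[of 2]
    proof (rule cInf_greatest)
      show "radii u 2 q \<noteq> {}" by (rule radii_nonempty) simp
      show "exp q / (6 * (I 1 * r3)) \<le> x" if "x \<in> radii u 2 q" for x
        using 1[OF that r] p by (simp add: field_simps)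
    qed
    then show ?thesis using p by (simp add: field_simps)
  qed
  have p: "I 1 > 0" "I 2 > 0" "I 3 > 0" using I by auto
  have "exp q / (6 * (I 1 * I 2)) \<le> I 3" unfolding I_def[of 3]
  proof (rule cInf_greatest)
    show "radii u 3 q \<noteq> {}" by (rule radii_nonempty) simp
    show "exp q / (6 * (I 1 * I 2)) \<le> x" if "x \<in> radii u 3 q" for x
      using 2[OF that] p by (simp add: field_simps)
  qed
  then have "exp q \<le> 6 * (I 1 * I 2 * I 3)" using p by (simp add: field_simps)
  then have "ln (exp q) \<le> ln (6 * (I 1 * I 2 * I 3))" using p by (subst ln_le_cancel_iff) auto
  also have "\<dots> = ln 6 + (ln (I 1) + ln (I 2) + ln (I 3))" using p by (simp add: ln_mult)
  finally show ?thesis unfolding Lmap_eq I_def by simp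
qed

text \<open>Here \<open>x\<close> is the logarithm of W_k and \<open>e\<close> that of Yhat_i.
  \<open>A\<close> gives the line of height log W_k, flat up to c_i, and \<open>Z\<close> gives
  Lhat_i; \<open>Y\<close> stands for y_i, and the last inequality keeps it at distance at least of
  order Yhat_i^(\<delta>-1) from the line of \<open>u\<close>. The matrices are hidden behind
  existential quantifiers, so that the property can be passed to another sequence with the same
  \<delta> and nearly the same \<open>x\<close> and \<open>e\<close>.\<close>

definition approximable :: "real \<Rightarrow> real^3 \<Rightarrow> real \<Rightarrow> real \<Rightarrow> real \<Rightarrow> bool" where
  "approximable \<kappa> u \<delta> x e \<longleftrightarrow> (\<exists>A Z Y V. A \<in> integer_points \<and> Z \<in> integer_points \<and> V \<in> integer_points \<and>
     A \<bullet> Y = 0 \<and> Z \<bullet> Y = 0 \<and> independent {A, Z} \<and> A \<noteq> Z \<and> V \<bullet> Y \<noteq> 0 \<and> \<bar>V \<bullet> Y\<bar> \<le> \<kappa> \<and>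
     norm A \<le> \<kappa> * exp x \<and> \<bar>A \<bullet> u\<bar> \<le> \<kappa> * exp (- (2 - \<delta>) * e) \<and>
     norm Z \<le> \<kappa> * exp (e - x) \<and> \<bar>Z \<bullet> u\<bar> \<le> \<kappa> * exp (e - x - (2 - \<delta>) * e) \<and>
     exp e \<le> \<kappa> * norm Y \<and> exp ((\<delta> - 1) * e) \<le> \<kappa> * norm (Y - ((Y \<bullet> u) / (u \<bullet> u)) *\<^sub>R u))"

text \<open>Each exponent is a combination of \<open>x\<close>, \<open>e\<close> and
  \<open>\<delta> * e\<close> that moves by at most 3/4 when \<open>x\<close> and \<open>e\<close>
  move by 1/4; the factor 3 bounds \<open>exp 1\<close>.\<close>

lemma approximable_perturb:
  assumes "approximable \<kappa> u \<delta> x e" "\<bar>x' - x\<bar> \<le> 1 / 4" "\<bar>e' - e\<bar> \<le> 1 / 4" "0 \<le> \<delta>" "\<delta> \<le> 1" "\<kappa> \<ge> 0"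
  shows "approximable (3 * \<kappa>) u \<delta> x' e'"
proof -
  have e1: "exp (1::real) \<le> 3" using exp_le by simp
  have E: "\<kappa> * exp s \<le> 3 * \<kappa> * exp t" if "s \<le> t + 1" for s t
  proof -
    have "exp s \<le> exp 1 * exp t" using that by (simp flip: exp_add)
    also have "\<dots> \<le> 3 * exp t" using e1 by simp
    finally have "\<kappa> * exp s \<le> \<kappa> * (3 * exp t)" using assms(6) by (rule mult_left_mono)
    then show ?thesis by simp
  qed
  have d: "\<bar>\<delta> * (e' - e)\<bar> \<le> 1 / 4"
    using assms(3-5) mult_mono[of "\<bar>\<delta>\<bar>" 1 "\<bar>e' - e\<bar>" "1/4"] by (simp add: abs_mult)
  have F: "exp s \<le> 3 * \<kappa> * n" if "exp t \<le> \<kappa> * n" "s \<le> t + 1" for s t n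
  proof -
    have "exp s \<le> exp 1 * exp t" using that by (simp flip: exp_add)
    also have "\<dots> \<le> 3 * exp t" using e1 by simp
    also have "\<dots> \<le> 3 * (\<kappa> * n)" using that by simp
    finally show ?thesis by simp
  qed
  obtain A Z Y V where *: "A \<in> integer_points" "Z \<in> integer_points" "V \<in> integer_points"
     "A \<bullet> Y = 0" "Z \<bullet> Y = 0" "independent {A, Z}" "A \<noteq> Z" "V \<bullet> Y \<noteq> 0" "\<bar>V \<bullet> Y\<bar> \<le> \<kappa>"
     "norm A \<le> \<kappa> * exp x" "\<bar>A \<bullet> u\<bar> \<le> \<kappa> * exp (- (2 - \<delta>) * e)"
     "norm Z \<le> \<kappa> * exp (e - x)" "\<bar>Z \<bullet> u\<bar> \<le> \<kappa> * exp (e - x - (2 - \<delta>) * e)"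
     "exp e \<le> \<kappa> * norm Y" "exp ((\<delta> - 1) * e) \<le> \<kappa> * norm (Y - ((Y \<bullet> u) / (u \<bullet> u)) *\<^sub>R u)"
    using assms(1) unfolding approximable_def by blast
  have b: "x \<le> x' + 1 / 4" "x' \<le> x + 1 / 4" "e \<le> e' + 1 / 4" "e' \<le> e + 1 / 4"
    "\<delta> * e' \<le> \<delta> * e + 1 / 4" "\<delta> * e \<le> \<delta> * e' + 1 / 4"
    using assms(2,3) d unfolding right_diff_distrib by linarith+
  have "\<bar>V \<bullet> Y\<bar> \<le> 3 * \<kappa>" using *(9) assms(6) by linarith
  moreover have "norm A \<le> 3 * \<kappa> * exp x'"
    by (rule order_trans[OF *(10) E]) (use b in linarith)
  moreover have "\<bar>A \<bullet> u\<bar> \<le> 3 * \<kappa> * exp (- (2 - \<delta>) * e')"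
    by (rule order_trans[OF *(11) E]) (use b in \<open>simp add: algebra_simps\<close>)
  moreover have "norm Z \<le> 3 * \<kappa> * exp (e' - x')"
    by (rule order_trans[OF *(12) E]) (use b in linarith)
  moreover have "\<bar>Z \<bullet> u\<bar> \<le> 3 * \<kappa> * exp (e' - x' - (2 - \<delta>) * e')"
    by (rule order_trans[OF *(13) E]) (use b in \<open>simp add: algebra_simps\<close>)
  moreover have "exp e' \<le> 3 * \<kappa> * norm Y"
    by (rule F[OF *(14)]) (use b in linarith)
  moreover have "exp ((\<delta> - 1) * e') \<le> 3 * \<kappa> * norm (Y - ((Y \<bullet> u) / (u \<bullet> u)) *\<^sub>R u)"
    by (rule F[OF *(15)]) (use b in \<open>simp add: algebra_simps\<close>)
  ultimately show ?thesis unfolding approximable_def using *(1-8) by blast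
qed

text \<open>The third point is an integer point off the plane of the first two, moved by
  integer multiples of them so that its component in that plane is bounded by their sum.\<close>

lemma Lmap_upper_bounds:
  assumes u: "u $ 1 = 1" and ap: "approximable \<kappa> u \<delta> x e"
    and \<kappa>: "\<kappa> \<ge> 1" and q: "0 \<le> q" "q \<le> (2 - \<delta>) * e + x"
  defines "\<beta> \<equiv> min ((1 - \<delta>) * e) (q - e)" and "\<gamma> \<equiv> e - x + max 0 (q - (2 - \<delta>) * e)"
    and "K \<equiv> ln (\<kappa>\<^sup>2 * norm u + 2 * \<kappa>)"
  shows "Lmap u 1 q \<le> min x \<gamma> + K" "Lmap u 2 q \<le> max x \<gamma> + K"
    "Lmap u 3 q \<le> max (max x \<gamma>) \<beta> + K"
proof -
  \<comment> \<open>The third point is the sum of a real point \<open>x0\<close> of size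
    \<open>\<kappa>\<^sup>2 * norm u * exp \<beta>\<close> and of fractional multiples of
    \<open>A\<close> and \<open>Z\<close>, each with constant \<open>\<kappa>\<close>;
    \<open>k\<close> adds the three constants.\<close>
  define k where "k = \<kappa>\<^sup>2 * norm u + 2 * \<kappa>"
  have u1: "1 \<le> norm u" using component_le_norm_cart[of u 1] u by simp
  have ku: "\<kappa>\<^sup>2 \<le> \<kappa>\<^sup>2 * norm u" using mult_left_mono[OF u1, of "\<kappa>\<^sup>2"] by simp
  then have k: "0 < k" "\<kappa> \<le> k" using \<kappa> zero_le_power2[of \<kappa>] unfolding k_def by linarith+
  obtain A Z Y V where *: "A \<in> integer_points" "Z \<in> integer_points" "V \<in> integer_points"
     "A \<bullet> Y = 0" "Z \<bullet> Y = 0" "independent {A, Z}" "A \<noteq> Z" "V \<bullet> Y \<noteq> 0" "\<bar>V \<bullet> Y\<bar> \<le> \<kappa>"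
     "norm A \<le> \<kappa> * exp x" "\<bar>A \<bullet> u\<bar> \<le> \<kappa> * exp (- (2 - \<delta>) * e)"
     "norm Z \<le> \<kappa> * exp (e - x)" "\<bar>Z \<bullet> u\<bar> \<le> \<kappa> * exp (e - x - (2 - \<delta>) * e)"
     "exp e \<le> \<kappa> * norm Y" "exp ((\<delta> - 1) * e) \<le> \<kappa> * norm (Y - ((Y \<bullet> u) / (u \<bullet> u)) *\<^sub>R u)"
    using ap unfolding approximable_def by blast
  have ex: "\<kappa> * exp s \<le> \<kappa> * exp t" if "s \<le> t" for s t using that \<kappa> by simp
  \<comment> \<open>Up to q = (2 - \<delta>) e + x, that is up to c_i, the product of
    \<open>A\<close> with \<open>u\<close> imposes no larger radius than its norm does.\<close>
  have A: "norm A \<le> \<kappa> * exp x" "\<bar>A \<bullet> u\<bar> \<le> \<kappa> * exp x * exp (- q)"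
  proof -
    have "\<kappa> * exp (- (2 - \<delta>) * e) \<le> \<kappa> * exp (x - q)" by (rule ex) (use q in \<open>simp add: algebra_simps\<close>)
    then show "\<bar>A \<bullet> u\<bar> \<le> \<kappa> * exp x * exp (- q)" using *(11) by (simp add: exp_diff exp_minus divide_inverse mult.assoc)
  qed (rule *(10))
  have Z: "norm Z \<le> \<kappa> * exp \<gamma>" "\<bar>Z \<bullet> u\<bar> \<le> \<kappa> * exp \<gamma> * exp (- q)"
  proof -
    have "\<kappa> * exp (e - x) \<le> \<kappa> * exp \<gamma>" by (rule ex) (simp add: \<gamma>_def)
    then show "norm Z \<le> \<kappa> * exp \<gamma>" using *(12) by linarith
    have "\<kappa> * exp (e - x - (2 - \<delta>) * e) \<le> \<kappa> * exp (\<gamma> - q)" by (rule ex) (simp add: \<gamma>_def)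
    then show "\<bar>Z \<bullet> u\<bar> \<le> \<kappa> * exp \<gamma> * exp (- q)" using *(13) by (simp add: exp_diff[of \<gamma>] exp_minus divide_inverse mult.assoc)
  qed
  have single: "norm v \<le> k * exp t \<and> \<bar>v \<bullet> u\<bar> \<le> k * exp t * exp (- q)"
    if "norm v \<le> \<kappa> * exp s" "\<bar>v \<bullet> u\<bar> \<le> \<kappa> * exp s * exp (- q)" "s \<le> t" for v s t
  proof -
    have 1: "\<kappa> * exp s \<le> k * exp t" using that k \<kappa> by (intro mult_mono) auto
    then have "\<kappa> * exp s * exp (- q) \<le> k * exp t * exp (- q)" by (intro mult_right_mono) auto
    then show ?thesis using 1 that by linarith
  qed
  have L: "Lmap u j q \<le> t + K" if "S \<subseteq> integer_points" "independent S" "card S = j" "0 < j" "j \<le> 3"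
     "\<And>v. v \<in> S \<Longrightarrow> norm v \<le> k * exp t \<and> \<bar>v \<bullet> u\<bar> \<le> k * exp t * exp (- q)" for S j t
  proof -
    have "k * exp t \<in> radii u j q" unfolding radii_def using that k by auto
    from Lmap_le[OF this] have "Lmap u j q \<le> ln (k * exp t)" using that by simp
    also have "\<dots> = t + K" using k unfolding K_def k_def[symmetric] by (simp add: ln_mult)
    finally show ?thesis .
  qed
  have A0: "A \<noteq> 0" "Z \<noteq> 0" using *(6) dependent_zero by blast+
  show "Lmap u 1 q \<le> min x \<gamma> + K"
  proof (cases "x \<le> \<gamma>")
    case True
    then have "Lmap u 1 q \<le> x + K" using L[of "{A}" 1 x] single[OF A] * A0 by simp
    then show ?thesis using True by simp
  next
    case False
    then have "Lmap u 1 q \<le> \<gamma> + K" using L[of "{Z}" 1 \<gamma>] single[OF Z] * A0 by simp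
    then show ?thesis using False by simp
  qed
  show "Lmap u 2 q \<le> max x \<gamma> + K"
    using L[of "{A, Z}" 2 "max x \<gamma>"] single[OF A, of "max x \<gamma>"] single[OF Z, of "max x \<gamma>"] *(1,2,6,7)
    by auto
  have Y0: "Y \<noteq> 0" using *(8) by auto
  define Y' where "Y' = Y - ((Y \<bullet> u) / (u \<bullet> u)) *\<^sub>R u"
  have uu: "u \<bullet> u \<noteq> 0" using u1 by auto
  have Y'u: "Y' \<bullet> u = 0" unfolding Y'_def using uu by (simp add: inner_diff_left)
  have Y'Y: "Y' \<bullet> Y = Y' \<bullet> Y'"
    using Y'u unfolding Y'_def by (simp add: inner_diff_right inner_diff_left)
  have Y'0: "norm Y' > 0" using *(15) \<kappa> unfolding Y'_def[symmetric]
    by (smt (verit) exp_gt_zero mult_eq_0_iff norm_ge_zero)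
  \<comment> \<open>Two real points have the required product with \<open>Y\<close>. The multiple of
    \<open>Y\<close> itself is short but not orthogonal to \<open>u\<close>; it serves up to q_i =
    (2 - \<delta>) e. Beyond that, the multiple of \<open>Y'\<close>, the component of
    \<open>Y\<close> orthogonal to \<open>u\<close>, has product 0 with \<open>u\<close>. Together
    they produce the two branches of \<open>\<beta>\<close>.\<close>
  have "\<exists>x0. x0 \<bullet> Y = V \<bullet> Y \<and> norm x0 \<le> \<kappa>\<^sup>2 * norm u * exp \<beta> \<and> \<bar>x0 \<bullet> u\<bar> \<le> \<kappa>\<^sup>2 * norm u * exp \<beta> * exp (- q)"
  proof (cases "q \<le> (2 - \<delta>) * e")
    case True
    then have b: "\<beta> = q - e" unfolding \<beta>_def by (simp add: algebra_simps)
    define x0 where "x0 = ((V \<bullet> Y) / (Y \<bullet> Y)) *\<^sub>R Y"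
    have "norm x0 = \<bar>V \<bullet> Y\<bar> / norm Y" using Y0
      by (simp add: x0_def power2_norm_eq_inner[symmetric] power2_eq_square)
    also have "\<dots> \<le> \<kappa> / (exp e / \<kappa>)" using *(9,14) \<kappa> by (intro frac_le) (auto simp: field_simps)
    also have "\<dots> = \<kappa>\<^sup>2 * exp (- e)" by (simp add: power2_eq_square exp_minus field_simps)
    finally have n: "norm x0 \<le> \<kappa>\<^sup>2 * exp (- e)" .
    have "\<kappa>\<^sup>2 * exp (- e) \<le> \<kappa>\<^sup>2 * norm u * exp \<beta>"
      by (rule mult_mono) (use ku q b in simp_all)
    moreover have "\<bar>x0 \<bullet> u\<bar> \<le> norm x0 * norm u" by (rule Cauchy_Schwarz_ineq2)
    moreover have "norm x0 * norm u \<le> \<kappa>\<^sup>2 * exp (- e) * norm u" using n by (intro mult_right_mono) auto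
    moreover have "\<kappa>\<^sup>2 * exp (- e) * norm u = \<kappa>\<^sup>2 * norm u * exp \<beta> * exp (- q)"
      by (simp add: b mult.assoc flip: exp_add)
    ultimately have "norm x0 \<le> \<kappa>\<^sup>2 * norm u * exp \<beta>" "\<bar>x0 \<bullet> u\<bar> \<le> \<kappa>\<^sup>2 * norm u * exp \<beta> * exp (- q)"
      using n by linarith+
    moreover have "x0 \<bullet> Y = V \<bullet> Y" using Y0 by (simp add: x0_def)
    ultimately show ?thesis by blast
  next
    case False
    then have b: "\<beta> = (1 - \<delta>) * e" unfolding \<beta>_def by (simp add: algebra_simps)
    define x0 where "x0 = ((V \<bullet> Y) / (Y' \<bullet> Y')) *\<^sub>R Y'"
    have "norm x0 = \<bar>V \<bullet> Y\<bar> / norm Y'" using Y'0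
      by (simp add: x0_def power2_norm_eq_inner[symmetric] power2_eq_square)
    also have "\<dots> \<le> \<kappa> / (exp ((\<delta> - 1) * e) / \<kappa>)"
      using *(9,15) \<kappa> unfolding Y'_def[symmetric] by (intro frac_le) (auto simp: field_simps)
    also have "\<dots> = \<kappa>\<^sup>2 * exp (- ((\<delta> - 1) * e))" unfolding exp_minus by (simp add: power2_eq_square field_simps)
    also have "- ((\<delta> - 1) * e) = \<beta>" by (simp add: b algebra_simps)
    also have "\<kappa>\<^sup>2 * exp \<beta> \<le> \<kappa>\<^sup>2 * norm u * exp \<beta>" using ku by (rule mult_right_mono) simp
    finally have "norm x0 \<le> \<kappa>\<^sup>2 * norm u * exp \<beta>" .
    moreover have "x0 \<bullet> u = 0" by (simp add: x0_def Y'u)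
    moreover have "x0 \<bullet> Y = V \<bullet> Y" using Y'0 by (simp add: x0_def Y'Y)
    ultimately show ?thesis by (intro exI[of _ x0]) auto
  qed
  then obtain x0 where x0: "x0 \<bullet> Y = V \<bullet> Y" "norm x0 \<le> \<kappa>\<^sup>2 * norm u * exp \<beta>"
    "\<bar>x0 \<bullet> u\<bar> \<le> \<kappa>\<^sup>2 * norm u * exp \<beta> * exp (- q)" by blast
  have "(V - x0) \<bullet> Y = 0" using x0 by (simp add: inner_diff_left)
  \<comment> \<open>\<open>V\<close> and \<open>x0\<close> have the same product with
    \<open>Y\<close>, so they differ by a vector of the plane of \<open>A\<close> and
    \<open>Z\<close>; subtracting the integer parts of its coordinates from \<open>V\<close> leaves
    an integer point near \<open>x0\<close>.\<close>
  then have "V - x0 \<in> span {A, Z}" using span_orthogonal_pair[of A Z Y "V - x0"] * Y0 by blast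
  then obtain s t where st: "V - x0 = s *\<^sub>R A + t *\<^sub>R Z" unfolding mem_span_pair_iff by blast
  define X where "X = V - of_int \<lfloor>s\<rfloor> *\<^sub>R A - of_int \<lfloor>t\<rfloor> *\<^sub>R Z"
  have X: "X = x0 + frac s *\<^sub>R A + frac t *\<^sub>R Z"
    unfolding X_def frac_def using st by (simp add: algebra_simps)
  define m where "m = max (max x \<gamma>) \<beta>"
  have mm: "exp x \<le> exp m" "exp \<gamma> \<le> exp m" "exp \<beta> \<le> exp m" unfolding m_def by auto
  have fr: "0 \<le> frac s" "frac s \<le> 1" "0 \<le> frac t" "frac t \<le> 1"
    using frac_lt_1[of s] frac_lt_1[of t] by auto
  have fb: "\<bar>frac a * v\<bar> \<le> w" if "\<bar>v\<bar> \<le> w" "0 \<le> frac a" "frac a \<le> 1" for a v w :: real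
    using that mult_mono[of "frac a" 1 "\<bar>v\<bar>" w] by (auto simp: abs_mult)
  have tot: "\<kappa>\<^sup>2 * norm u * exp \<beta> + \<kappa> * exp x + \<kappa> * exp \<gamma> \<le> k * exp m"
  proof -
    have "\<kappa>\<^sup>2 * norm u * exp \<beta> + \<kappa> * exp x + \<kappa> * exp \<gamma> \<le> \<kappa>\<^sup>2 * norm u * exp m + \<kappa> * exp m + \<kappa> * exp m"
      using mm \<kappa> by (intro add_mono mult_left_mono) auto
    also have "\<dots> = k * exp m" by (simp add: k_def algebra_simps)
    finally show ?thesis .
  qed
  have nX: "norm X \<le> k * exp m"
  proof -
    have "norm X \<le> norm x0 + \<bar>frac s * norm A\<bar> + \<bar>frac t * norm Z\<bar>"
      unfolding X using norm_triangle_le[of "x0 + frac s *\<^sub>R A" "frac t *\<^sub>R Z"] norm_triangle_ineq[of x0 "frac s *\<^sub>R A"] fr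
      by (simp add: norm_triangle_le abs_mult)
    moreover have "\<bar>frac s * norm A\<bar> \<le> \<kappa> * exp x" "\<bar>frac t * norm Z\<bar> \<le> \<kappa> * exp \<gamma>"
      by (rule fb; use fr A Z in simp)+
    ultimately show ?thesis using x0(2) tot by linarith
  qed
  have uX: "\<bar>X \<bullet> u\<bar> \<le> k * exp m * exp (- q)"
  proof -
    have "X \<bullet> u = x0 \<bullet> u + frac s * (A \<bullet> u) + frac t * (Z \<bullet> u)" unfolding X by (simp add: inner_add_left)
    moreover have "\<bar>frac s * (A \<bullet> u)\<bar> \<le> \<kappa> * exp x * exp (- q)" "\<bar>frac t * (Z \<bullet> u)\<bar> \<le> \<kappa> * exp \<gamma> * exp (- q)"
      by (rule fb; use fr A Z in simp)+
    ultimately have "\<bar>X \<bullet> u\<bar> \<le> (\<kappa>\<^sup>2 * norm u * exp \<beta> + \<kappa> * exp x + \<kappa> * exp \<gamma>) * exp (- q)"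
      using x0(3) unfolding distrib_right by linarith
    also have "\<dots> \<le> k * exp m * exp (- q)" using tot by (rule mult_right_mono) simp
    finally show ?thesis .
  qed
  \<comment> \<open>The product with \<open>Y\<close> is unchanged and non-zero, which keeps
    \<open>X\<close> out of the plane of \<open>A\<close> and \<open>Z\<close>.\<close>
  have "X \<bullet> Y = V \<bullet> Y" unfolding X_def using * by (simp add: inner_diff_left)
  moreover have "v \<bullet> Y = 0" if "v \<in> span {A, Z}" for v
    using that *(4,5) unfolding mem_span_pair_iff by (auto simp: inner_add_left)
  ultimately have Xn: "X \<notin> span {A, Z}" using *(8) by auto
  have XA: "X \<noteq> A" "X \<noteq> Z" using Xn span_base by blast+
  have "Lmap u 3 q \<le> m + K"
  proof (rule L[of "{X, A, Z}"])
    show "independent {X, A, Z}" using independent_insertI[OF Xn *(6)] .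
    have "X \<in> integer_points" using *(1-3) unfolding X_def integer_points_def by auto
    then show "{X, A, Z} \<subseteq> integer_points" using *(1,2) by simp
    show "card {X, A, Z} = 3" using XA *(7) by simp
    have "x \<le> m" "\<gamma> \<le> m" by (auto simp: m_def)
    then show "norm v \<le> k * exp m \<and> \<bar>v \<bullet> u\<bar> \<le> k * exp m * exp (- q)" if "v \<in> {X, A, Z}" for v
      using that nX uX single[OF A] single[OF Z] by blast
  qed simp_all
  then show "Lmap u 3 q \<le> max (max x \<gamma>) \<beta> + K" unfolding m_def .
qed

text \<open>The last two facts serve by contraposition: if \<open>\<beta>\<close> occurs as the
  second or third value, it is at least \<open>min \<alpha> \<gamma>\<close>, and this minimum is
  then the first value.\<close>

lemma Phi3_extremes:
  fixes \<alpha> \<beta> \<gamma> :: real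
  shows "Phi3 \<alpha> \<beta> \<gamma> 3 = max (max \<alpha> \<gamma>) \<beta>"
    "min \<alpha> \<gamma> \<le> \<beta> \<Longrightarrow> Phi3 \<alpha> \<beta> \<gamma> 1 = min \<alpha> \<gamma>"
    "max \<alpha> \<gamma> \<le> \<beta> \<Longrightarrow> Phi3 \<alpha> \<beta> \<gamma> 2 = max \<alpha> \<gamma>"
    "\<beta> < min \<alpha> \<gamma> \<Longrightarrow> \<beta> < Phi3 \<alpha> \<beta> \<gamma> 2" "\<beta> < min \<alpha> \<gamma> \<Longrightarrow> \<beta> < Phi3 \<alpha> \<beta> \<gamma> 3"
proof -
  have "Phi3 \<alpha> \<beta> \<gamma> 3 = max (max \<alpha> \<gamma>) \<beta> \<and> (min \<alpha> \<gamma> \<le> \<beta> \<longrightarrow> Phi3 \<alpha> \<beta> \<gamma> 1 = min \<alpha> \<gamma>) \<and>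
    (max \<alpha> \<gamma> \<le> \<beta> \<longrightarrow> Phi3 \<alpha> \<beta> \<gamma> 2 = max \<alpha> \<gamma>) \<and>
    (\<beta> < min \<alpha> \<gamma> \<longrightarrow> \<beta> < Phi3 \<alpha> \<beta> \<gamma> 2 \<and> \<beta> < Phi3 \<alpha> \<beta> \<gamma> 3)"
  proof -
    consider "\<alpha> \<le> \<beta>" "\<beta> \<le> \<gamma>" | "\<alpha> \<le> \<gamma>" "\<gamma> \<le> \<beta>" | "\<beta> \<le> \<alpha>" "\<alpha> \<le> \<gamma>"
      | "\<beta> \<le> \<gamma>" "\<gamma> \<le> \<alpha>" | "\<gamma> \<le> \<alpha>" "\<alpha> \<le> \<beta>" | "\<gamma> \<le> \<beta>" "\<beta> \<le> \<alpha>"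
      by linarith
    then show ?thesis by cases (simp_all add: Phi3_perm max_def min_def)
  qed
  then show "Phi3 \<alpha> \<beta> \<gamma> 3 = max (max \<alpha> \<gamma>) \<beta>"
    "min \<alpha> \<gamma> \<le> \<beta> \<Longrightarrow> Phi3 \<alpha> \<beta> \<gamma> 1 = min \<alpha> \<gamma>"
    "max \<alpha> \<gamma> \<le> \<beta> \<Longrightarrow> Phi3 \<alpha> \<beta> \<gamma> 2 = max \<alpha> \<gamma>"
    "\<beta> < min \<alpha> \<gamma> \<Longrightarrow> \<beta> < Phi3 \<alpha> \<beta> \<gamma> 2" "\<beta> < min \<alpha> \<gamma> \<Longrightarrow> \<beta> < Phi3 \<alpha> \<beta> \<gamma> 3"
    by blast+
qed

definition deviation :: "real \<Rightarrow> real^3 \<Rightarrow> real" where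
  "deviation \<kappa> u = ln (\<kappa>\<^sup>2 * norm u + 2 * \<kappa>)"

section \<open>Comparison of the successive minima with P\<close>

context sturmian_system
begin

context
  fixes u :: "real^3" and \<kappa> :: real and i1 :: int
  assumes u1: "u $ 1 = 1" and \<kappa>: "\<kappa> \<ge> 1" and i1: "i1 \<ge> i0"
    and approx: "\<forall>i\<ge>i1. approximable \<kappa> u \<delta> (g i) (\<eta> i)"
begin

lemma deviation_nonneg: "0 \<le> deviation \<kappa> u"
proof -
  have "1 \<le> 2 * \<kappa>" "0 \<le> \<kappa>\<^sup>2 * norm u" using \<kappa> by auto
  then show ?thesis unfolding deviation_def by (intro ln_ge_zero) linarith
qed

lemma c_ge_c0: "i0 \<le> i \<Longrightarrow> c (i0 - 1) \<le> c (i - 1)"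
proof (induction i rule: int_ge_induct)
  case (step i)
  then show ?case using order(6)[of i] by simp
qed simp

text \<open>\<open>A\<close> and \<open>Z\<close>, with trajectories \<open>g i\<close> and
  \<open>\<gamma>\<close>, bound L_1 by the smaller and L_2 by the larger of the two. These are
  values of P_1 and P_2 only as far as the trajectory of y_i is not below them, whence the
  hypotheses of the last two claims.\<close>

lemma upper:
  assumes i: "i \<ge> i1" and x: "x \<in> {c (i - 1)..c i}"
  shows "P 3 x \<ge> Lmap u 3 x - deviation \<kappa> u"
    "P 2 x = min ((1 - \<delta>) * \<eta> i) (x - \<eta> i) \<or> P 3 x = min ((1 - \<delta>) * \<eta> i) (x - \<eta> i) \<Longrightarrow> P 1 x \<ge> Lmap u 1 x - deviation \<kappa> u"
    "P 3 x = min ((1 - \<delta>) * \<eta> i) (x - \<eta> i) \<Longrightarrow> P 2 x \<ge> Lmap u 2 x - deviation \<kappa> u"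
proof -
  have ii: "i \<ge> i0" using i i1 by simp
  define \<beta> where "\<beta> = min ((1 - \<delta>) * \<eta> i) (x - \<eta> i)"
  define \<gamma> where "\<gamma> = \<eta> i - g i + max 0 (x - (2 - \<delta>) * \<eta> i)"
  have P: "P j x = Phi3 (g i) \<beta> \<gamma> j" for j
    unfolding \<beta>_def \<gamma>_def using P_eq[OF ii] x by (simp add: c_def q_def)
  have c0: "c (i0 - 1) \<le> x" using c_ge_c0[OF ii] x by simp
  have x0: "0 \<le> x" using P_order[OF c0] by linarith
  have U: "Lmap u 1 x \<le> min (g i) \<gamma> + deviation \<kappa> u" "Lmap u 2 x \<le> max (g i) \<gamma> + deviation \<kappa> u"
    "Lmap u 3 x \<le> max (max (g i) \<gamma>) \<beta> + deviation \<kappa> u"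
    using Lmap_upper_bounds[OF u1 approx[rule_format, OF i] \<kappa> x0] x unfolding deviation_def \<beta>_def \<gamma>_def c_def q_def by auto
  note X = Phi3_extremes[where \<alpha> = "g i" and \<beta> = \<beta> and \<gamma> = \<gamma>, folded P]
  have "Lmap u 3 x \<le> P 3 x + deviation \<kappa> u" unfolding X(1) by (rule U(3))
  then show "P 3 x \<ge> Lmap u 3 x - deviation \<kappa> u" by linarith
  show "P 2 x \<ge> Lmap u 2 x - deviation \<kappa> u" if "P 3 x = min ((1 - \<delta>) * \<eta> i) (x - \<eta> i)"
  proof -
    have "max (max (g i) \<gamma>) \<beta> = \<beta>" using that X(1) unfolding \<beta>_def[symmetric] by metis
    then have "max (g i) \<gamma> \<le> \<beta>" by (metis max.cobounded1)
    from X(3)[OF this] U(2) show ?thesis by linarith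
  qed
  show "P 1 x \<ge> Lmap u 1 x - deviation \<kappa> u" if *: "P 2 x = min ((1 - \<delta>) * \<eta> i) (x - \<eta> i) \<or> P 3 x = min ((1 - \<delta>) * \<eta> i) (x - \<eta> i)"
  proof -
    have "min (g i) \<gamma> \<le> \<beta>"
      using X(4,5) * unfolding \<beta>_def[symmetric] by (metis less_irrefl not_le_imp_less)
    from X(2)[OF this] U(1) show ?thesis by linarith
  qed
qed

lemma sum_lower:
  assumes "c (i0 - 1) \<le> x"
  shows "P 1 x + P 2 x + P 3 x - ln 6 \<le> Lmap u 1 x + Lmap u 2 x + Lmap u 3 x"
proof -
  have "P 1 x + P 2 x + P 3 x = x" using P_order[OF assms] by blast
  then show ?thesis using Lmap_sum_ge[OF u1, of x] by linarith
qed

text \<open>Three upper bounds with error \<open>deviation \<kappa> u\<close> and a lower bound for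
  the sum with error \<open>ln 6\<close> give a lower bound for each component, by subtracting the
  other two.\<close>

lemma close_on_I:
  assumes i: "i \<ge> i1" and x: "x \<in> {a i..b i}"
  shows "\<bar>Lmap u 1 x - P 1 x\<bar> \<le> 2 * deviation \<kappa> u + ln 6" "\<bar>Lmap u 2 x - P 2 x\<bar> \<le> 2 * deviation \<kappa> u + ln 6"
    "\<bar>Lmap u 3 x - P 3 x\<bar> \<le> 2 * deviation \<kappa> u + ln 6"
proof -
  have ii: "i \<ge> i0" using i i1 by simp
  have x': "x \<in> {c (i - 1)..c i}" and m: "P 3 x = min ((1 - \<delta>) * \<eta> i) (x - \<eta> i)"
    using P3_maximal_set[OF ii] x by blast+
  have "c (i0 - 1) \<le> x" using c_ge_c0[OF ii] x' by simp
  note S = sum_lower[OF this]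
  have U: "P 3 x \<ge> Lmap u 3 x - deviation \<kappa> u" "P 1 x \<ge> Lmap u 1 x - deviation \<kappa> u" "P 2 x \<ge> Lmap u 2 x - deviation \<kappa> u"
    using upper[OF i x'] m by blast+
  have "0 \<le> ln (6::real)" by simp
  then show "\<bar>Lmap u 1 x - P 1 x\<bar> \<le> 2 * deviation \<kappa> u + ln 6" "\<bar>Lmap u 2 x - P 2 x\<bar> \<le> 2 * deviation \<kappa> u + ln 6"
    "\<bar>Lmap u 3 x - P 3 x\<bar> \<le> 2 * deviation \<kappa> u + ln 6"
    using S U deviation_nonneg by linarith+
qed

lemma close_on_I':
  assumes i: "i - 1 \<ge> i1" and x: "x \<in> {b (i - 1)..a i}"
  shows "\<bar>Lmap u 1 x - P 1 x\<bar> \<le> 2 * deviation \<kappa> u + ln 6" "P 2 x - (2 * deviation \<kappa> u + ln 6) \<le> Lmap u 2 x"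
    "Lmap u 3 x \<le> P 3 x + (2 * deviation \<kappa> u + ln 6)"
proof -
  have ii: "i - 1 \<ge> i0" "i \<ge> i0" using i i1 by auto
  \<comment> \<open>The index of the lines defining P changes at \<open>c (i - 1)\<close>, but on
    both sides P_2 is the trajectory of the current point y. So the bounds for L_1 and L_3 remain
    and only that for L_2 is lost.\<close>
  have U: "P 3 x \<ge> Lmap u 3 x - deviation \<kappa> u \<and> P 1 x \<ge> Lmap u 1 x - deviation \<kappa> u"
  proof (cases "x \<le> c (i - 1)")
    case True
    then have x': "x \<in> {c (i - 1 - 1)..c (i - 1)}" using x order[OF ii(1)] by auto
    moreover have "P 2 x = min ((1 - \<delta>) * \<eta> (i - 1)) (x - \<eta> (i - 1))"
    proof -
      have "P 2 x = (1 - \<delta>) * \<eta> (i - 1)" using pieces(5)[OF ii(1), of x 2] True x by simp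
      moreover have "q (i - 1) \<le> x" using order[OF ii(1)] x by simp
      ultimately show ?thesis unfolding q_def by (simp add: algebra_simps)
    qed
    ultimately show ?thesis using upper[of "i - 1" x] i by blast
  next
    case False
    then have x': "x \<in> {c (i - 1)..c i}" using x order[OF ii(2)] by auto
    moreover have "P 2 x = min ((1 - \<delta>) * \<eta> i) (x - \<eta> i)"
    proof -
      have "P 2 x = x - \<eta> i" using pieces(1)[OF ii(2), of x 2] False x by simp
      moreover have "x \<le> q i" using order[OF ii(2)] x by simp
      ultimately show ?thesis unfolding q_def by (simp add: algebra_simps)
    qed
    ultimately show ?thesis using upper[of i x] i by simp
  qed
  have O: "c (i - 1 - 1) \<le> a (i - 1)" "a (i - 1) \<le> b (i - 1)" "b (i - 1) \<le> a i"
    using order[OF ii(1)] by simp_all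
  have "c (i0 - 1) \<le> x" using c_ge_c0[OF ii(1)] O x by simp
  note S = sum_lower[OF this]
  have "Lmap u 1 (b (i - 1)) \<le> Lmap u 1 x" using x by (intro Lmap_mono_q) auto
  moreover have "P 1 x = P 1 (b (i - 1))"
    using graph(5)[OF ii(1), unfolded slope_on_def, rule_format, of "b (i - 1)" x] O x by simp
  moreover have "\<bar>Lmap u 1 (b (i - 1)) - P 1 (b (i - 1))\<bar> \<le> 2 * deviation \<kappa> u + ln 6"
    using close_on_I(1)[of "i - 1" "b (i - 1)"] i O by simp
  moreover have "0 \<le> ln (6::real)" by simp
  ultimately show "\<bar>Lmap u 1 x - P 1 x\<bar> \<le> 2 * deviation \<kappa> u + ln 6" using U deviation_nonneg by linarith
  have "Lmap u 2 x \<le> Lmap u 3 x" by (rule Lmap_2_le_3)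
  \<comment> \<open>L_2 is bounded below by the sum minus the upper bounds for L_1 and L_3.\<close>
  show "P 2 x - (2 * deviation \<kappa> u + ln 6) \<le> Lmap u 2 x" "Lmap u 3 x \<le> P 3 x + (2 * deviation \<kappa> u + ln 6)"
    using S U deviation_nonneg \<open>0 \<le> ln 6\<close> by linarith+
qed

lemma close_1:
  assumes x: "c i1 \<le> x"
  shows "\<bar>Lmap u 1 x - P 1 x\<bar> \<le> 2 * deviation \<kappa> u + ln 6"
proof -
  have "c (i0 - 1) \<le> c (i1 + 1 - 1)" by (rule c_ge_c0) (use i1 in simp)
  then obtain i where i: "i \<ge> i0" "c (i - 1) \<le> x" "x < c i"
    using index_exists_right[of x] x by auto
  have "i1 < i"
  proof (rule ccontr)
    assume "\<not> i1 < i"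
    then have "i \<le> i1" by simp
    then have "c i \<le> c i1" using i(1)
    proof (induction i1 rule: int_ge_induct)
      case (step k)
      then show ?case using order(6)[of "k + 1"] by simp
    qed simp
    then show False using i x by simp
  qed
  then have ii: "i - 1 \<ge> i1" "i \<ge> i1" "i + 1 - 1 \<ge> i1" by auto
  have O: "b (i - 1) \<le> c (i - 1)" "c i \<le> a (i + 1)" using order[of "i - 1"] order[of i] ii i1 by auto
  consider "x \<in> {b (i - 1)..a i}" | "x \<in> {a i..b i}" | "x \<in> {b (i + 1 - 1)..a (i + 1)}"
    using i O by fastforce
  then show ?thesis
    using close_on_I'(1)[OF ii(1)] close_on_I(1)[OF ii(2)] close_on_I'(1)[OF ii(3)] by cases
qed

end

end

section \<open>Symmetric matrices attached to a Sturmian sequence\<close>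

lemma matrix_mult_2: "(A ** B) $ i $ j = A $ i $ 1 * B $ 1 $ j + A $ i $ 2 * B $ 2 $ j"
  for A B :: "int^2^2"
  by (simp add: matrix_matrix_mult_def sum_2)

lemma symmetric_iff: "symmetric A \<longleftrightarrow> A $ 1 $ 2 = A $ 2 $ 1"
  by (auto simp: symmetric_def vec_eq_iff forall_2 transpose_def)

lemma det_mpow: "det (mpow A n) = det A ^ n"
  by (induction n) (simp_all add: det_mul)

lemma mpow_commute: "mpow A n ** A = A ** mpow A n"
  by (induction n) (simp_all add: matrix_mul_assoc[symmetric])

text \<open>If \<open>X\<close> and \<open>A ** X\<close> are symmetric, then
  \<open>A ** X = X ** transpose A\<close>, so \<open>A ** (A ** X) = A ** X ** transpose A\<close>
  is symmetric. Two consecutive powers are carried along because each step uses both.\<close>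

lemma symmetric_mpow_mult:
  assumes "symmetric Y" "symmetric (A ** Y)"
  shows "symmetric (mpow A n ** Y) \<and> symmetric (mpow A (Suc n) ** Y)"
proof (induction n)
  case 0
  then show ?case using assms by simp
next
  case (Suc n)
  define X where "X = mpow A n ** Y"
  have X: "transpose X = X" "transpose (A ** X) = A ** X"
    using Suc unfolding symmetric_def X_def by (simp_all add: matrix_mul_assoc)
  have "transpose (A ** (A ** X)) = A ** X ** transpose A" by (metis X(2) matrix_transpose_mul)
  also have "\<dots> = A ** (transpose X ** transpose A)" by (simp add: matrix_mul_assoc X(1))
  also have "\<dots> = A ** (A ** X)" by (simp only: matrix_transpose_mul[symmetric] X(2))
  finally show ?case using Suc unfolding symmetric_def X_def by (simp add: matrix_mul_assoc)
qed

text \<open>Symmetry of the first product turns the left side into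
  \<open>B ** M ** transpose A\<close>, which is the transpose of \<open>A ** (B ** M)\<close>. This
  exchange is what makes the points of consecutive levels fit together.\<close>

lemma transpose_swap:
  assumes "symmetric (A ** transpose M)" "symmetric (B ** M)" "symmetric (A ** B ** M)"
  shows "B ** A ** transpose M = A ** B ** M"
proof -
  have "B ** A ** transpose M = B ** transpose (A ** transpose M)"
    using assms(1) unfolding symmetric_def by (simp add: matrix_mul_assoc)
  also have "\<dots> = B ** M ** transpose A" by (simp add: matrix_transpose_mul transpose_transpose matrix_mul_assoc)
  also have "\<dots> = transpose (B ** M) ** transpose A" using assms(2) unfolding symmetric_def by simp
  also have "\<dots> = transpose (A ** (B ** M))" by (simp add: matrix_transpose_mul)
  also have "\<dots> = A ** B ** M" using assms(3) unfolding symmetric_def by (simp add: matrix_mul_assoc)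
  finally show ?thesis .
qed

text \<open>Passage of admissibility from level k to k + 1: \<open>A\<close>, \<open>B\<close>,
  \<open>C\<close> are the matrices of index k, k - 1, k + 1, and \<open>M\<close> is replaced by
  its transpose. By the last equation one more factor \<open>A\<close> leads from the end of a level
  to the first point of the next.\<close>

lemma symmetric_next:
  fixes A B M :: "int^2^2" and n :: nat
  assumes "symmetric (A ** transpose M)" "symmetric (B ** M)" "symmetric (A ** B ** M)"
  defines "C \<equiv> mpow A n ** B"
  shows "symmetric (C ** M)" "symmetric (C ** A ** transpose M)"
    "C ** A ** transpose M = mpow A (Suc n) ** B ** M"
proof -
  have S: "symmetric (mpow A n ** (B ** M)) \<and> symmetric (mpow A (Suc n) ** (B ** M))"
    by (rule symmetric_mpow_mult) (use assms in \<open>simp_all add: matrix_mul_assoc\<close>)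
  show 1: "C ** A ** transpose M = mpow A (Suc n) ** B ** M"
  proof -
    have "C ** A ** transpose M = mpow A n ** (B ** A ** transpose M)" unfolding C_def by (simp add: matrix_mul_assoc)
    also have "\<dots> = mpow A n ** A ** B ** M" unfolding transpose_swap[OF assms(1-3)] by (simp add: matrix_mul_assoc)
    finally show ?thesis by (simp add: mpow_commute)
  qed
  show "symmetric (C ** M)" "symmetric (C ** A ** transpose M)"
    using S unfolding 1 unfolding C_def by (simp_all add: matrix_mul_assoc)
qed

section \<open>Integer points orthogonal to the symmetric matrices\<close>

lemma point_sel: "point A $ 1 = of_int (A $ 1 $ 1)" "point A $ 2 = of_int (A $ 1 $ 2)" "point A $ 3 = of_int (A $ 2 $ 2)"
  by (simp_all add: point_def)

lemma inner_3: "x \<bullet> y = x $ 1 * y $ 1 + x $ 2 * y $ 2 + x $ 3 * y $ 3" for x y :: "real^3"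
  by (simp add: inner_vec_def sum_3)

text \<open>The points below come from the pairing of an integer matrix \<open>T\<close> with a symmetric matrix \<open>Y\<close>
  through the trace of \<open>T Y\<close>: it only depends on the point \<open>(T\<^sub>1\<^sub>1, T\<^sub>1\<^sub>2 + T\<^sub>2\<^sub>1, T\<^sub>2\<^sub>2)\<close>. Here \<open>T = J A\<close>
  and \<open>T = adj(X) M J\<close> with \<open>J\<close> the standard antisymmetric matrix.\<close>

definition plane_normal :: "int^2^2 \<Rightarrow> real^3" where
  "plane_normal A = vector [of_int (A $ 2 $ 1), of_int (A $ 2 $ 2 - A $ 1 $ 1), - of_int (A $ 1 $ 2)]"

definition second_normal :: "int^2^2 \<Rightarrow> int^2^2 \<Rightarrow> real^3" where
  "second_normal X M = vector [of_int (X $ 1 $ 2 * M $ 2 $ 2 - X $ 2 $ 2 * M $ 1 $ 2),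
     of_int (X $ 2 $ 2 * M $ 1 $ 1 - X $ 1 $ 2 * M $ 2 $ 1 + X $ 1 $ 2 * M $ 1 $ 2 - X $ 1 $ 1 * M $ 2 $ 2),
     of_int (X $ 1 $ 1 * M $ 2 $ 1 - X $ 1 $ 2 * M $ 1 $ 1)]"

text \<open>The pairing is the trace of \<open>J A X\<close>, the difference of the off-diagonal
  entries of \<open>A ** X\<close>. Hence a single vector is orthogonal to all points of a
  level.\<close>

lemma plane_normal_orth:
  assumes "symmetric X" "symmetric (A ** X)"
  shows "plane_normal A \<bullet> point X = 0"
proof -
  have "A $ 1 $ 1 * X $ 1 $ 2 + A $ 1 $ 2 * X $ 2 $ 2 = A $ 2 $ 1 * X $ 1 $ 1 + A $ 2 $ 2 * X $ 1 $ 2"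
    using assms unfolding symmetric_iff matrix_mult_2 by simp
  then have "real_of_int (A $ 1 $ 1 * X $ 1 $ 2 + A $ 1 $ 2 * X $ 2 $ 2) = of_int (A $ 2 $ 1 * X $ 1 $ 1 + A $ 2 $ 2 * X $ 1 $ 2)"
    by simp
  then show ?thesis unfolding inner_3 plane_normal_def point_def by (simp add: algebra_simps)
qed

text \<open>By cyclicity the trace of \<open>adj(X) M J X\<close> is \<open>det X\<close> times the
  trace of \<open>M J\<close>, which measures the asymmetry of \<open>M\<close>. This is where N has
  to be non-symmetric.\<close>

lemma second_normal_not_orth:
  assumes "symmetric X" "det X \<noteq> 0" "\<not> symmetric M"
  shows "second_normal X M \<bullet> point X \<noteq> 0"
proof -
  have "second_normal X M \<bullet> point X = of_int (det X * (M $ 2 $ 1 - M $ 1 $ 2))"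
    using assms(1) unfolding symmetric_iff inner_3 second_normal_def point_def det_2 by (simp add: algebra_simps)
  then show ?thesis using assms(2,3) unfolding symmetric_iff by simp
qed

text \<open>By cyclicity the trace of \<open>adj(X) M J A X\<close> is \<open>det X\<close> times
  the trace of \<open>J A M\<close>, which vanishes for symmetric \<open>A ** M\<close>.\<close>

lemma second_normal_orth:
  assumes "symmetric X" "symmetric (A ** X)" "symmetric (A ** M)"
  shows "second_normal X M \<bullet> point (A ** X) = 0"
proof -
  define a b c d where v1: "a = A $ 1 $ 1" "b = A $ 1 $ 2" "c = A $ 2 $ 1" "d = A $ 2 $ 2"
  define x y z where v2: "x = X $ 1 $ 1" "y = X $ 1 $ 2" "z = X $ 2 $ 2"
  define p q r t where v3: "p = M $ 1 $ 1" "q = M $ 1 $ 2" "r = M $ 2 $ 1" "t = M $ 2 $ 2"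
  note v = v1 v2 v3
  have X: "X $ 2 $ 1 = y" using assms(1) by (simp add: symmetric_iff v)
  have 1: "a * y + b * z = c * x + d * y" using assms(2) X unfolding symmetric_iff matrix_mult_2 by (simp add: v)
  have 2: "a * q + b * t = c * p + d * r" using assms(3) unfolding symmetric_iff matrix_mult_2 by (simp add: v)
  have "(y * t - z * q) * (a * x + b * y) + (z * p - y * r + y * q - x * t) * (a * y + b * z) + (x * r - y * p) * (c * y + d * z) = 0"
    using 1 2 by algebra
  then have "real_of_int ((y * t - z * q) * (a * x + b * y) + (z * p - y * r + y * q - x * t) * (a * y + b * z) + (x * r - y * p) * (c * y + d * z)) = 0"
    by simp
  then show ?thesis unfolding inner_3 second_normal_def point_def matrix_mult_2 X by (simp add: v)
qed

text \<open>The vector vanishes only for scalar \<open>A\<close>, and a non-zero multiple of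
  \<open>M\<close> is symmetric only if \<open>M\<close> is.\<close>

lemma plane_normal_nonzero:
  assumes "det A \<noteq> 0" "symmetric (A ** M)" "\<not> symmetric M"
  shows "plane_normal A \<noteq> 0"
proof
  assume "plane_normal A = 0"
  then have z: "plane_normal A $ i = 0" for i by simp
  have "A $ 2 $ 1 = 0" using z[of 1] by (simp add: plane_normal_def)
  moreover have "A $ 2 $ 2 = A $ 1 $ 1" using z[of 2] by (simp add: plane_normal_def)
  moreover have "A $ 1 $ 2 = 0" using z[of 3] by (simp add: plane_normal_def)
  ultimately have "A $ 1 $ 1 * M $ 1 $ 2 = A $ 1 $ 1 * M $ 2 $ 1" "A $ 1 $ 1 \<noteq> 0"
    using assms(1,2) unfolding symmetric_iff matrix_mult_2 det_2 by auto
  then show False using assms(3) unfolding symmetric_iff by simp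
qed

text \<open>\<open>point X\<close> is orthogonal to the first vector but not to the second, so the
  second is no multiple of the first.\<close>

lemma normals_independent:
  assumes "symmetric X" "symmetric (A ** X)" "symmetric (A ** M)" "\<not> symmetric M" "det A \<noteq> 0" "det X \<noteq> 0"
  shows "independent {plane_normal A, second_normal X M}" "plane_normal A \<noteq> second_normal X M"
proof -
  have o: "plane_normal A \<bullet> point X = 0" "second_normal X M \<bullet> point X \<noteq> 0"
    using plane_normal_orth second_normal_not_orth assms by auto
  then show "plane_normal A \<noteq> second_normal X M" by auto
  have "second_normal X M \<notin> span {plane_normal A}"
    using o by (auto simp: span_singleton)
  then have "independent {second_normal X M, plane_normal A}"
    by (rule independent_insertI) (use plane_normal_nonzero assms in simp)
  then show "independent {plane_normal A, second_normal X M}" by (simp add: insert_commute)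
qed

lemma normals_integer: "plane_normal A \<in> integer_points" "second_normal X M \<in> integer_points"
  by (auto simp: integer_points_def forall_3 plane_normal_def second_normal_def)

section \<open>Sizes, contents and distances to the line of u\<close>

lemma abs_le_mnorm: "real_of_int \<bar>A $ i $ j\<bar> \<le> mnorm A"
proof -
  have "\<bar>A $ i $ j\<bar> \<in> range (\<lambda>(i, j). \<bar>A $ i $ j\<bar>)" by (rule range_eqI[of _ _ "(i, j)"]) simp
  then have "\<bar>A $ i $ j\<bar> \<le> Max (range (\<lambda>(i, j). \<bar>A $ i $ j\<bar>))" by (intro Max_ge) simp_all
  then show ?thesis unfolding mnorm_def by (rule of_int_le_iff[THEN iffD2])
qed

lemma mnorm_le_iff: "mnorm A \<le> r \<longleftrightarrow> (\<forall>i j. real_of_int \<bar>A $ i $ j\<bar> \<le> r)"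
proof
  assume "\<forall>i j. real_of_int \<bar>A $ i $ j\<bar> \<le> r"
  moreover have "Max (range (\<lambda>(i, j). \<bar>A $ i $ j\<bar>)) \<in> range (\<lambda>(i, j). \<bar>A $ i $ j\<bar>)" by (rule Max_in) simp_all
  then have "\<exists>i j. Max (range (\<lambda>(i, j). \<bar>A $ i $ j\<bar>)) = \<bar>A $ i $ j\<bar>" unfolding image_iff by force
  then obtain i j where "Max (range (\<lambda>(i, j). \<bar>A $ i $ j\<bar>)) = \<bar>A $ i $ j\<bar>" by blast
  then have "mnorm A = real_of_int \<bar>A $ i $ j\<bar>" unfolding mnorm_def by (rule arg_cong)
  ultimately show "mnorm A \<le> r" by simp
qed (use abs_le_mnorm order_trans in blast)

lemma mnorm_nonneg: "0 \<le> mnorm A"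
  using abs_le_mnorm[of A 1 1] by linarith

lemma mnorm_ge_1:
  assumes "det A \<noteq> 0"
  shows "1 \<le> mnorm A"
proof -
  have "A $ 1 $ 1 \<noteq> 0 \<or> A $ 1 $ 2 \<noteq> 0" using assms unfolding det_2 by auto
  then show ?thesis using abs_le_mnorm[of A 1 1] abs_le_mnorm[of A 1 2] by force
qed

lemma mnorm_mult: "mnorm (A ** B) \<le> 2 * mnorm A * mnorm B"
  unfolding mnorm_le_iff
proof (intro allI)
  fix i j
  have p: "\<bar>real_of_int (A $ i $ k) * of_int (B $ k $ j)\<bar> \<le> mnorm A * mnorm B" for k
    unfolding abs_mult by (rule mult_mono') (use abs_le_mnorm in auto)
  have "real_of_int \<bar>(A ** B) $ i $ j\<bar> = \<bar>real_of_int (A $ i $ 1) * of_int (B $ 1 $ j) + of_int (A $ i $ 2) * of_int (B $ 2 $ j)\<bar>"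
    by (simp add: matrix_mult_2)
  also have "\<dots> \<le> 2 * mnorm A * mnorm B" using p[of 1] p[of 2] by linarith
  finally show "real_of_int \<bar>(A ** B) $ i $ j\<bar> \<le> 2 * mnorm A * mnorm B" .
qed

lemma mnorm_transpose: "mnorm (transpose A) = mnorm A"
proof (rule antisym)
  show "mnorm (transpose A) \<le> mnorm A" unfolding mnorm_le_iff transpose_def using abs_le_mnorm by simp
  show "mnorm A \<le> mnorm (transpose A)" unfolding mnorm_le_iff
    using abs_le_mnorm[of "transpose A"] by (simp add: transpose_def)
qed

text \<open>Multiplying \<open>A ** N\<close> by the adjugate of \<open>N\<close> gives
  \<open>det N\<close> times \<open>A\<close>, and \<open>det N\<close> is a non-zero integer. With
  \<open>mnorm_mult\<close> this removes the factor N from size estimates.\<close>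

lemma mnorm_mult_ge: 
  assumes "det N \<noteq> 0"
  shows "mnorm A \<le> 2 * mnorm (A ** N) * mnorm N"
  unfolding mnorm_le_iff
proof (intro allI)
  fix i j :: 2
  define X where "X = A ** N"
  have b: "\<bar>real_of_int (X $ i $ k) * of_int (N $ l $ m)\<bar> \<le> mnorm X * mnorm N" for k l m
    unfolding abs_mult by (rule mult_mono') (use abs_le_mnorm in auto)
  have 1: "A $ i $ 1 * det N = X $ i $ 1 * N $ 2 $ 2 - X $ i $ 2 * N $ 2 $ 1"
    unfolding X_def matrix_mult_2 det_2 by (simp add: algebra_simps)
  have 2: "A $ i $ 2 * det N = X $ i $ 2 * N $ 1 $ 1 - X $ i $ 1 * N $ 1 $ 2"
    unfolding X_def matrix_mult_2 det_2 by (simp add: algebra_simps)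
  have "real_of_int \<bar>A $ i $ j * det N\<bar> \<le> 2 * mnorm X * mnorm N"
  proof -
    have "j = 1 \<or> j = 2" using exhaust_2 by blast
    then show ?thesis
    proof
      assume "j = 1"
      then have "real_of_int \<bar>A $ i $ j * det N\<bar> = \<bar>real_of_int (X $ i $ 1) * of_int (N $ 2 $ 2) - of_int (X $ i $ 2) * of_int (N $ 2 $ 1)\<bar>"
        using 1 by simp
      then show ?thesis using b[of 1 2 2] b[of 2 2 1] by linarith
    next
      assume "j = 2"
      then have "real_of_int \<bar>A $ i $ j * det N\<bar> = \<bar>real_of_int (X $ i $ 2) * of_int (N $ 1 $ 1) - of_int (X $ i $ 1) * of_int (N $ 1 $ 2)\<bar>"
        using 2 by simp
      then show ?thesis using b[of 1 1 2] b[of 2 1 1] by linarith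
    qed
  qed
  moreover have "\<bar>A $ i $ j\<bar> \<le> \<bar>A $ i $ j * det N\<bar>"
  proof -
    have "\<bar>A $ i $ j\<bar> * 1 \<le> \<bar>A $ i $ j\<bar> * \<bar>det N\<bar>" using assms by (intro mult_left_mono) auto
    then show ?thesis by (simp add: abs_mult)
  qed
  ultimately show "real_of_int \<bar>A $ i $ j\<bar> \<le> 2 * mnorm (A ** N) * mnorm N" unfolding X_def by linarith
qed

lemma norm_le_3: "norm x \<le> \<bar>x $ 1\<bar> + \<bar>x $ 2\<bar> + \<bar>x $ 3\<bar>" for x :: "real^3"
  using norm_le_l1_cart[of x] by (simp add: sum_3)

lemma norm_plane_normal: "norm (plane_normal A) \<le> 4 * mnorm A"
proof -
  have e: "\<bar>real_of_int (A $ i $ j)\<bar> \<le> mnorm A" for i j using abs_le_mnorm[of A i j] by simp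
  have "norm (plane_normal A) \<le> \<bar>real_of_int (A $ 2 $ 1)\<bar> + \<bar>real_of_int (A $ 2 $ 2) - of_int (A $ 1 $ 1)\<bar> + \<bar>real_of_int (A $ 1 $ 2)\<bar>"
    using norm_le_3[of "plane_normal A"] by (simp add: plane_normal_def)
  then show ?thesis using e[of 2 1] e[of 2 2] e[of 1 1] e[of 1 2] by linarith
qed

lemma norm_second_normal: "norm (second_normal X M) \<le> 8 * mnorm X * mnorm M"
proof -
  have e: "\<bar>real_of_int (X $ i $ j) * of_int (M $ k $ l)\<bar> \<le> mnorm X * mnorm M" for i j k l
    unfolding abs_mult by (rule mult_mono') (use abs_le_mnorm in auto)
  have t2: "\<bar>a - b\<bar> \<le> 2 * m" if "\<bar>a\<bar> \<le> m" "\<bar>b\<bar> \<le> m" for a b m :: real using that by linarith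
  have t4: "\<bar>a - b + c - d\<bar> \<le> 4 * m" if "\<bar>a\<bar> \<le> m" "\<bar>b\<bar> \<le> m" "\<bar>c\<bar> \<le> m" "\<bar>d\<bar> \<le> m"
    for a b c d m :: real using that by linarith
  have "\<bar>second_normal X M $ 1\<bar> \<le> 2 * (mnorm X * mnorm M)" "\<bar>second_normal X M $ 3\<bar> \<le> 2 * (mnorm X * mnorm M)"
    "\<bar>second_normal X M $ 2\<bar> \<le> 4 * (mnorm X * mnorm M)"
    unfolding second_normal_def vector_3 of_int_diff of_int_add of_int_mult by (intro t2 t4 e)+
  then show ?thesis using norm_le_3[of "second_normal X M"] by linarith
qed

lemma mnorm_le_norm_point:
  assumes "symmetric X"
  shows "mnorm X \<le> norm (point X)"
  unfolding mnorm_le_iff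
proof (intro allI)
  fix i j :: 2
  have "real_of_int \<bar>X $ i $ j\<bar> \<in> {\<bar>point X $ 1\<bar>, \<bar>point X $ 2\<bar>, \<bar>point X $ 3\<bar>}"
    using exhaust_2[of i] exhaust_2[of j] assms unfolding point_sel symmetric_iff by auto
  then show "real_of_int \<bar>X $ i $ j\<bar> \<le> norm (point X)" using component_le_norm_cart[of "point X"] by auto
qed

lemma norm_point_le: "norm (point X) \<le> 3 * mnorm X"
  using norm_le_3[of "point X"] abs_le_mnorm[of X 1 1] abs_le_mnorm[of X 1 2] abs_le_mnorm[of X 2 2]
  unfolding point_sel by simp

lemma content_bezout:
  assumes "point Y \<noteq> 0"
  shows "\<exists>V\<in>integer_points. V \<bullet> point Y = of_int (content Y) \<and> content Y > 0"
proof -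
  obtain a b where 1: "a * Y $ 1 $ 2 + b * Y $ 2 $ 2 = gcd (Y $ 1 $ 2) (Y $ 2 $ 2)" using bezout_int by blast
  obtain c d where 2: "c * Y $ 1 $ 1 + d * gcd (Y $ 1 $ 2) (Y $ 2 $ 2) = content Y"
    unfolding content_def using bezout_int by blast
  have "c * Y $ 1 $ 1 + d * a * Y $ 1 $ 2 + d * b * Y $ 2 $ 2 = content Y"
    using 2 unfolding 1[symmetric] by (simp add: algebra_simps)
  then have "real_of_int (c * Y $ 1 $ 1 + d * a * Y $ 1 $ 2 + d * b * Y $ 2 $ 2) = of_int (content Y)" by simp
  then have "(vector [of_int c, of_int (d * a), of_int (d * b)] :: real^3) \<bullet> point Y = of_int (content Y)"
    unfolding inner_3 point_sel by simp
  moreover have "(vector [of_int c, of_int (d * a), of_int (d * b)] :: real^3) \<in> integer_points"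
    by (auto simp: integer_points_def forall_3)
  moreover have "content Y > 0"
  proof -
    have "Y $ 1 $ 1 \<noteq> 0 \<or> Y $ 1 $ 2 \<noteq> 0 \<or> Y $ 2 $ 2 \<noteq> 0"
      using assms by (auto simp: vec_eq_iff forall_3 point_sel)
    then have "content Y \<noteq> 0" unfolding content_def by simp
    moreover have "content Y \<ge> 0" unfolding content_def by simp
    ultimately show ?thesis by linarith
  qed
  ultimately show ?thesis by blast
qed

text \<open>Up to sign, two coordinates of the cross product of the points of \<open>A ** Y\<close>
  and \<open>Y\<close>; they are \<open>det Y\<close> times coordinates of
  \<open>plane_normal A\<close>. They are the numerators when the quotients
  \<open>Y $ 1 $ 2 / Y $ 1 $ 1\<close> and \<open>Y $ 2 $ 2 / Y $ 1 $ 1\<close> of consecutive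
  points are subtracted.\<close>

lemma wedge_identities:
  fixes A Y :: "int^2^2"
  assumes "symmetric Y" "symmetric (A ** Y)"
  defines "Y' \<equiv> A ** Y"
  shows "Y' $ 1 $ 1 * Y $ 1 $ 2 - Y $ 1 $ 1 * Y' $ 1 $ 2 = - det Y * A $ 1 $ 2"
    "Y' $ 1 $ 1 * Y $ 2 $ 2 - Y $ 1 $ 1 * Y' $ 2 $ 2 = det Y * (A $ 1 $ 1 - A $ 2 $ 2)"
proof -
  have s: "Y $ 2 $ 1 = Y $ 1 $ 2" using assms(1) by (simp add: symmetric_iff)
  have t: "A $ 1 $ 1 * Y $ 1 $ 2 + A $ 1 $ 2 * Y $ 2 $ 2 = A $ 2 $ 1 * Y $ 1 $ 1 + A $ 2 $ 2 * Y $ 1 $ 2"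
    using assms(2) s by (simp add: symmetric_iff matrix_mult_2)
  show "Y' $ 1 $ 1 * Y $ 1 $ 2 - Y $ 1 $ 1 * Y' $ 1 $ 2 = - det Y * A $ 1 $ 2"
    unfolding Y'_def matrix_mult_2 det_2 s by (simp add: algebra_simps)
  show "Y' $ 1 $ 1 * Y $ 2 $ 2 - Y $ 1 $ 1 * Y' $ 2 $ 2 = det Y * (A $ 1 $ 1 - A $ 2 $ 2)"
    unfolding Y'_def matrix_mult_2 det_2 s using t by algebra
qed

text \<open>The determinant is a quadratic form vanishing at \<open>u\<close>. Writing
  \<open>point Y = \<tau> *\<^sub>R u + R\<close>, every remaining monomial contains a coordinate of
  \<open>R\<close>. Read backwards, the determinant bounds from below the distance of
  \<open>point Y\<close> to the line of \<open>u\<close>.\<close>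

lemma det_le_distance:
  fixes \<xi> :: real
  assumes "symmetric Y"
  defines "u \<equiv> vector [1, \<xi>, \<xi>\<^sup>2] :: real^3"
  defines "R \<equiv> point Y - ((point Y \<bullet> u) / (u \<bullet> u)) *\<^sub>R u"
  shows "\<bar>real_of_int (det Y)\<bar> \<le> (3 + 2 * \<bar>\<xi>\<bar> + \<xi>\<^sup>2) * norm (point Y) * norm R"
proof -
  define \<tau> where "\<tau> = (point Y \<bullet> u) / (u \<bullet> u)"
  have u1: "1 \<le> norm u" using component_le_norm_cart[of u 1] by (simp add: u_def)
  then have uu: "u \<bullet> u \<noteq> 0" by auto
  have Y: "point Y = \<tau> *\<^sub>R u + R" by (simp add: R_def \<tau>_def)
  have orth: "R \<bullet> u = 0" unfolding R_def using uu by (simp add: inner_diff_left)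
  have pyth: "norm (point Y) ^ 2 = norm (\<tau> *\<^sub>R u) ^ 2 + norm R ^ 2"
    unfolding Y power2_norm_eq_inner using orth by (simp add: inner_add_left inner_add_right inner_commute)
  have "norm R \<le> norm (point Y)" by (rule power2_le_imp_le) (use pyth in auto)
  moreover have "norm (\<tau> *\<^sub>R u) \<le> norm (point Y)" by (rule power2_le_imp_le) (use pyth in auto)
  then have \<tau>: "\<bar>\<tau>\<bar> \<le> norm (point Y)" using mult_left_mono[OF u1, of "\<bar>\<tau>\<bar>"] by simp
  ultimately have R: "norm R \<le> norm (point Y)" by simp
  have d: "det Y = Y $ 1 $ 1 * Y $ 2 $ 2 - Y $ 1 $ 2 * Y $ 1 $ 2" using assms(1) by (simp add: symmetric_iff det_2)
  have c: "point Y $ 1 = \<tau> + R $ 1" "point Y $ 2 = \<tau> * \<xi> + R $ 2" "point Y $ 3 = \<tau> * \<xi>\<^sup>2 + R $ 3"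
    unfolding Y by (simp_all add: u_def)
  have "real_of_int (det Y) = point Y $ 1 * point Y $ 3 - point Y $ 2 * point Y $ 2"
    unfolding d point_sel by simp
  also have "\<dots> = \<tau> * R $ 3 + \<xi>\<^sup>2 * (\<tau> * R $ 1) + R $ 1 * R $ 3 - 2 * \<xi> * (\<tau> * R $ 2) - R $ 2 * R $ 2"
    unfolding c by (simp add: algebra_simps power2_eq_square)
  finally have eq: "real_of_int (det Y) = \<tau> * R $ 3 + \<xi>\<^sup>2 * (\<tau> * R $ 1) + R $ 1 * R $ 3 - 2 * \<xi> * (\<tau> * R $ 2) - R $ 2 * R $ 2" .
  define m where "m = norm (point Y) * norm R"
  have t: "\<bar>\<tau> * R $ i\<bar> \<le> m" for i
    unfolding abs_mult m_def by (rule mult_mono') (use \<tau> component_le_norm_cart[of R i] in auto)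
  have r: "\<bar>R $ i * R $ j\<bar> \<le> m" for i j
    unfolding abs_mult m_def
    by (rule mult_mono') (use R component_le_norm_cart[of R i] component_le_norm_cart[of R j] in auto)
  have a: "\<bar>\<xi>\<^sup>2 * (\<tau> * R $ 1)\<bar> \<le> \<xi>\<^sup>2 * m" unfolding abs_mult[of "\<xi>\<^sup>2"] by (rule mult_mono') (use t in auto)
  have b: "\<bar>2 * \<xi> * (\<tau> * R $ 2)\<bar> \<le> 2 * \<bar>\<xi>\<bar> * m" unfolding abs_mult[of "2 * \<xi>"] by (rule mult_mono') (use t in auto)
  have "\<bar>real_of_int (det Y)\<bar> \<le> m + \<xi>\<^sup>2 * m + m + 2 * \<bar>\<xi>\<bar> * m + m"
    unfolding eq using a b t[of 3] r[of 1 3] r[of 2 2] by linarith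
  then show ?thesis unfolding m_def by (simp add: algebra_simps)
qed

text \<open>As \<open>v\<close> is orthogonal to \<open>point Y\<close>, its product with
  \<open>u\<close> is its product with the difference between \<open>u\<close> and the multiple of
  \<open>point Y\<close> that has first coordinate 1.\<close>

lemma abs_inner_le_of_orth:
  fixes Y :: "int^2^2" and v u :: "real^3"
  assumes "v \<bullet> point Y = 0" "Y $ 1 $ 1 \<noteq> 0" "u $ 1 = 1"
    "\<bar>of_int (Y $ 1 $ 2) / of_int (Y $ 1 $ 1) - u $ 2\<bar> \<le> D"
    "\<bar>of_int (Y $ 2 $ 2) / of_int (Y $ 1 $ 1) - u $ 3\<bar> \<le> D"
  shows "\<bar>v \<bullet> u\<bar> \<le> norm v * (2 * D)"
proof -
  define a where "a = real_of_int (Y $ 1 $ 1)"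
  have a: "a \<noteq> 0" using assms by (simp add: a_def)
  have "v \<bullet> u = v \<bullet> (u - (1 / a) *\<^sub>R point Y)" using assms(1) by (simp add: inner_diff_right)
  then have "\<bar>v \<bullet> u\<bar> \<le> norm v * norm (u - (1 / a) *\<^sub>R point Y)" using Cauchy_Schwarz_ineq2 by metis
  moreover
  have "norm (u - (1 / a) *\<^sub>R point Y) \<le> 2 * D"
    using norm_le_3[of "u - (1 / a) *\<^sub>R point Y"] assms(3-5) a unfolding point_sel vector_minus_component vector_scaleR_component
    by (simp add: point_sel a_def[symmetric] abs_minus_commute)
  then have "norm v * norm (u - (1 / a) *\<^sub>R point Y) \<le> norm v * (2 * D)" by (rule mult_left_mono) simp
  ultimately show ?thesis by linarith
qed

lemma halving_limit_bound:
  fixes x D :: "nat \<Rightarrow> real"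
  assumes lim: "x \<longlonglongrightarrow> L" and step: "\<And>n. n \<ge> n0 \<Longrightarrow> \<bar>x (Suc n) - x n\<bar> \<le> D n"
    and half: "\<And>n. n \<ge> n0 \<Longrightarrow> D (Suc n) \<le> D n / 2" and n: "n \<ge> n0"
  shows "\<bar>x n - L\<bar> \<le> 2 * D n"
proof -
  have D0: "D n \<ge> 0" if "n \<ge> n0" for n using step[OF that] by linarith
  \<comment> \<open>The subtracted term makes the geometric sum telescope in the induction.\<close>
  have "\<bar>x (n + m) - x n\<bar> \<le> 2 * D n - 2 * D (n + m)" for m
  proof (induction m)
    case (Suc m)
    then show ?case using step[of "n + m"] half[of "n + m"] n by simp
  qed simp
  then have b: "\<bar>x (n + m) - x n\<bar> \<le> 2 * D n" for m using D0[of "n + m"] n by (smt (verit) trans_le_add1)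
  have "(\<lambda>m. \<bar>x (n + m) - x n\<bar>) \<longlonglongrightarrow> \<bar>L - x n\<bar>"
    using LIMSEQ_ignore_initial_segment[OF lim, of n] by (intro tendsto_intros) (simp add: add.commute)
  then have "\<bar>L - x n\<bar> \<le> 2 * D n" by (rule LIMSEQ_le_const2) (use b in auto)
  then show ?thesis by (simp add: abs_minus_commute)
qed

section \<open>Levels and growth\<close>

text \<open>Both sequences satisfy \<open>t (k + 1) = s (k + 2) + 1 / t k\<close>, and each step
  divides the difference of two solutions by their product. The fractions stay at least 1 and the
  ratios eventually above some \<open>\<rho> > 1\<close>, so the difference decays
  geometrically.\<close>

lemma cfrac_contracts_to_ratio:
  fixes s :: "nat \<Rightarrow> int" and x :: "nat \<Rightarrow> real"
  assumes s: "\<And>k. k \<ge> 1 \<Longrightarrow> s k \<ge> 1" "\<And>k. s k \<le> B"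
    and rec: "\<And>k. k \<ge> 1 \<Longrightarrow> x (k + 1) = s (k + 1) * x k + x (k - 1)"
    and pos: "\<And>k. k \<ge> K \<Longrightarrow> x k > 0"
  shows "(\<lambda>k. cfrac (map s (rev [1..<k + 2])) - x (k + 1) / x k) \<longlonglongrightarrow> 0"
    and "1 \<le> cfrac (map s (rev [1..<k + 2]))" and "cfrac (map s (rev [1..<k + 2])) \<le> real_of_int B + 1"
proof -
  define cf where "cf k = cfrac (map s (rev [1..<k + 2]))" for k
  have cf0: "cf 0 = s 1" by (simp add: cf_def numeral_2_eq_2)
  have cfS: "cf (Suc k) = s (k + 2) + 1 / cf k" for k
  proof -
    have "rev [1..<Suc k + 2] = (k + 2) # rev [1..<k + 2]" by simp
    moreover have "rev [1..<k + 2] = (k + 1) # rev [1..<k + 1]" by simp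
    ultimately show ?thesis unfolding cf_def by simp
  qed
  have cf1: "cf k \<ge> 1" for k
  proof (induction k)
    case 0
    then show ?case using s(1)[of 1] cf0 by simp
  next
    case (Suc k)
    then have "1 / cf k \<ge> 0" by simp
    moreover have "real_of_int (s (k + 2)) \<ge> 1" using s(1)[of "k + 2"] by simp
    ultimately show ?case unfolding cfS by linarith
  qed
  have cfB: "cf k \<le> real_of_int B + 1" for k
  proof (cases k)
    case 0
    then show ?thesis using s(2)[of 1] cf0 by simp
  next
    case (Suc m)
    have "1 / cf m \<le> 1" using cf1[of m] by simp
    moreover have "real_of_int (s (m + 2)) \<le> B" using s(2)[of "m + 2"] by simp
    ultimately show ?thesis unfolding Suc cfS by simp
  qed
  show "1 \<le> cfrac (map s (rev [1..<k + 2]))" "cfrac (map s (rev [1..<k + 2])) \<le> real_of_int B + 1"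
    using cf1[of k] cfB[of k] unfolding cf_def by simp_all
  define r where "r k = x (k + 1) / x k" for k
  have r_eq: "r (Suc k) = s (k + 2) + 1 / r k" if "k \<ge> K" for k
    using rec[of "Suc k"] pos[of "Suc k"] that unfolding r_def by (simp add: field_simps)
  have r_pos: "r k > 0" if "k \<ge> K" for k using pos that unfolding r_def by simp
  have r1: "r (Suc k) \<ge> 1" if "k \<ge> K" for k
  proof -
    have "real_of_int (s (k + 2)) \<ge> 1" using s(1)[of "k + 2"] by simp
    moreover have "1 / r k > 0" using r_pos[OF that] by simp
    ultimately show ?thesis unfolding r_eq[OF that] by linarith
  qed
  have rB: "r (Suc (Suc k)) \<le> real_of_int B + 1" if "k \<ge> K" for k
  proof -
    have "real_of_int (s (Suc k + 2)) \<le> B" using s(2)[of "Suc k + 2"] by simp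
    moreover have "1 / r (Suc k) \<le> 1" using r1[OF that] by simp
    ultimately show ?thesis using r_eq[of "Suc k"] that by simp
  qed
  have B1: "B \<ge> 1" using s(1)[of 1] s(2)[of 1] by simp
  \<comment> \<open>A ratio is at least 1 plus the inverse of the preceding one, which is at most B
    + 1.\<close>
  define \<rho> where "\<rho> = 1 + 1 / (real_of_int B + 1)"
  have \<rho>: "\<rho> > 1" using B1 unfolding \<rho>_def by simp
  have r\<rho>: "r (Suc (Suc (Suc k))) \<ge> \<rho>" if "k \<ge> K" for k
  proof -
    have "real_of_int (s (Suc (Suc k) + 2)) \<ge> 1" using s(1)[of "Suc (Suc k) + 2"] by simp
    moreover have "1 / r (Suc (Suc k)) \<ge> 1 / (real_of_int B + 1)" using rB[OF that] r_pos[of "Suc (Suc k)"] that by (intro divide_left_mono) auto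
    ultimately show ?thesis using r_eq[of "Suc (Suc k)"] that unfolding \<rho>_def by simp
  qed
  define E where "E k = \<bar>cf k - r k\<bar>" for k
  \<comment> \<open>Positivity from \<open>K\<close> on gives the lower bound 1, then the upper
    bound B + 1, then the lower bound \<open>\<rho>\<close>, each one step later.\<close>
  define K' where "K' = K + 3"
  have step: "E (Suc k) \<le> E k / \<rho>" if "k \<ge> K'" for k
  proof -
    obtain m where m: "k = Suc (Suc (Suc m))" "m \<ge> K"
    proof (rule that)
      show "k = Suc (Suc (Suc (k - 3)))" "k - 3 \<ge> K" using \<open>k \<ge> K'\<close> unfolding K'_def by simp_all
    qed
    have p: "r k \<ge> \<rho>" "cf k \<ge> 1" using r\<rho>[OF m(2)] cf1 m by auto
    have "cf (Suc k) - r (Suc k) = 1 / cf k - 1 / r k" using cfS[of k] r_eq[of k] m by simp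
    also have "\<dots> = (r k - cf k) / (cf k * r k)" using p \<rho> by (simp add: field_simps)
    finally have "E (Suc k) = E k / (cf k * r k)"
      unfolding E_def using p \<rho> by (simp add: abs_mult abs_minus_commute)
    also have "\<dots> \<le> E k / \<rho>"
    proof (rule divide_left_mono)
      show "\<rho> \<le> cf k * r k" using p \<rho> mult_mono[of 1 "cf k" \<rho> "r k"] by simp
    qed (use p \<rho> in \<open>auto simp: E_def\<close>)
    finally show ?thesis .
  qed
  have geo: "E (K' + n) \<le> E K' * (1 / \<rho>) ^ n" for n
  proof (induction n)
    case (Suc n)
    have "E (K' + Suc n) \<le> E (K' + n) / \<rho>" using step[of "K' + n"] by simp
    also have "\<dots> \<le> E K' * (1 / \<rho>) ^ n / \<rho>" using Suc \<rho> by (simp add: divide_right_mono)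
    finally show ?case by simp
  qed simp
  have "(\<lambda>n. E K' * (1 / \<rho>) ^ n) \<longlonglongrightarrow> E K' * 0"
    using \<rho> by (intro tendsto_mult tendsto_const LIMSEQ_realpow_zero) auto
  then have "(\<lambda>n. E (K' + n)) \<longlonglongrightarrow> 0"
    by (intro tendsto_sandwich[of "\<lambda>_. 0" "\<lambda>n. E (K' + n)" _ "\<lambda>n. E K' * (1 / \<rho>) ^ n"])
      (use geo in \<open>auto simp: E_def\<close>)
  then have "(\<lambda>n. E (n + K')) \<longlonglongrightarrow> 0" by (simp add: add.commute)
  then have "E \<longlonglongrightarrow> 0" by (rule LIMSEQ_offset)
  then show "(\<lambda>k. cfrac (map s (rev [1..<k + 2])) - x (k + 1) / x k) \<longlonglongrightarrow> 0"
    unfolding E_def cf_def r_def by (rule tendsto_rabs_zero_cancel)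
qed

text \<open>If \<open>l\<close> is the limsup of the continued fractions, then \<sigma> / (1 +
  \<sigma>) = 1 / (l + 1), so the hypothesis leaves room for \<delta> (x (k + 1) / x k + 1) < 1 for
  large k.\<close>

lemma eventually_exponent_small:
  fixes s :: "nat \<Rightarrow> int" and x :: "nat \<Rightarrow> real"
  assumes s: "\<And>k. k \<ge> 1 \<Longrightarrow> s k \<ge> 1" "\<And>k. s k \<le> B"
    and rec: "\<And>k. k \<ge> 1 \<Longrightarrow> x (k + 1) = s (k + 1) * x k + x (k - 1)"
    and pos: "\<And>k. k \<ge> K \<Longrightarrow> x k > 0"
    and \<delta>: "0 \<le> \<delta>" "\<delta> < sturm_sigma s / (1 + sturm_sigma s)"
  shows "\<forall>\<^sub>F k in sequentially. \<delta> * (x (k + 1) + x k) < x k"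
proof -
  define cf where "cf k = cfrac (map s (rev [1..<k + 2]))" for k
  have lim: "(\<lambda>k. cf k - x (k + 1) / x k) \<longlonglongrightarrow> 0" and b: "1 \<le> cf k" "cf k \<le> real_of_int B + 1" for k
    using cfrac_contracts_to_ratio[of s B x K, OF s rec pos] unfolding cf_def by blast+
  define lsup where "lsup = limsup (\<lambda>k. ereal (cf k))"
  \<comment> \<open>The bounds make the limsup finite, so no default value of
    \<open>real_of_ereal\<close> occurs.\<close>
  have "1 \<le> lsup" unfolding lsup_def using b by (intro le_Limsup) auto
  moreover have "lsup \<le> ereal (real_of_int B + 1)" unfolding lsup_def using b by (intro Limsup_bounded) auto
  ultimately obtain l where l: "lsup = ereal l" "l \<ge> 1" by (cases lsup) auto
  have sig: "sturm_sigma s = 1 / l" unfolding sturm_sigma_def using l(1) unfolding lsup_def cf_def by simp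
  have "sturm_sigma s / (1 + sturm_sigma s) = 1 / (l + 1)" unfolding sig using l(2) by (simp add: field_simps)
  then have "\<delta> < 1 / (l + 1)" using \<delta>(2) by simp
  then have d: "\<delta> * (l + 1) < 1" using l(2) by (subst (asm) pos_less_divide_eq) auto
  \<comment> \<open>One \<open>\<epsilon>\<close> is spent on the limsup and one on the distance
    between fraction and ratio, so \<open>2 * \<delta> * \<epsilon>\<close> must stay below the gap
    \<open>1 - \<delta> * (l + 1)\<close>.\<close>
  define \<epsilon> where "\<epsilon> = (1 - \<delta> * (l + 1)) / (2 * (\<delta> + 1))"
  have \<epsilon>: "\<epsilon> > 0" unfolding \<epsilon>_def using d \<delta>(1) by simp
  have d\<epsilon>: "\<delta> * (l + 2 * \<epsilon> + 1) < 1"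
  proof -
    have "2 * (\<delta> + 1) \<noteq> 0" using \<delta>(1) by simp
    then have "\<epsilon> * (2 * (\<delta> + 1)) = 1 - \<delta> * (l + 1)" using \<epsilon>_def nonzero_eq_divide_eq by blast
    then show ?thesis using \<epsilon> by (simp add: algebra_simps)
  qed
  have "lsup < ereal (l + \<epsilon>)" using l \<epsilon> by simp
  then have "\<forall>\<^sub>F k in sequentially. ereal (cf k) < ereal (l + \<epsilon>)" unfolding lsup_def by (rule Limsup_lessD)
  moreover have "\<forall>\<^sub>F k in sequentially. \<bar>cf k - x (k + 1) / x k\<bar> < \<epsilon>"
    using tendstoD[OF lim \<epsilon>] by (simp add: dist_real_def)
  moreover have "\<forall>\<^sub>F k in sequentially. k \<ge> K" by (rule eventually_ge_at_top)
  ultimately show ?thesis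
  proof eventually_elim
    case (elim k)
    then have "x (k + 1) / x k + 1 \<le> l + 2 * \<epsilon> + 1" by simp
    then have "\<delta> * (x (k + 1) / x k + 1) \<le> \<delta> * (l + 2 * \<epsilon> + 1)" using \<delta>(1) by (rule mult_left_mono)
    then have "\<delta> * (x (k + 1) / x k + 1) < 1" using d\<epsilon> by linarith
    moreover have "x k > 0" using pos elim by simp
    ultimately have "\<delta> * (x (k + 1) / x k + 1) * x k < 1 * x k" by (intro mult_strict_right_mono)
    moreover have "(x (k + 1) / x k + 1) * x k = x (k + 1) + x k" using \<open>x k > 0\<close> by (simp add: distrib_right)
    ultimately show ?case by (simp add: mult.assoc)
  qed
qed

section \<open>The indices t_k + l\<close>

locale sturm_index =
  fixes s :: "nat \<Rightarrow> int"
  assumes s0: "s 0 = -1" and s1: "s 1 = 1" and s_pos: "k \<ge> 1 \<Longrightarrow> s k \<ge> 1"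
begin

lemma tt_0: "tt s 0 = -1" and tt_1: "tt s (Suc 0) = 0" and tt_Suc: "tt s (Suc k) = tt s k + s (Suc k)"
  using s0 s1 by (simp_all add: tt_def)

lemma tt_less: "k < k' \<Longrightarrow> tt s k < tt s k'"
proof (induction k' rule: less_Suc_induct)
  case (1 k)
  then show ?case using s_pos[of "Suc k"] by (simp add: tt_Suc)
qed simp

lemma tt_le: "k \<le> k' \<Longrightarrow> tt s k \<le> tt s k'"
  using tt_less[of k k'] by (cases "k = k'") auto

lemma tt_ge: "tt s k \<ge> int k - 1"
proof (induction k)
  case (Suc k)
  then show ?case using s_pos[of "Suc k"] by (simp add: tt_Suc)
qed (simp add: tt_0)

lemma level_offset:
  assumes "int l < s (k + 1)"
  shows "level s (tt s k + int l) = k" "offset s (tt s k + int l) = l"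
proof -
  have in_k: "tt s k \<le> tt s k + int l \<and> tt s k + int l < tt s (k + 1)"
    using assms by (simp add: tt_Suc)
  show 1: "level s (tt s k + int l) = k" unfolding level_def
  proof (rule the_equality)
    show "tt s k \<le> tt s k + int l \<and> tt s k + int l < tt s (k + 1)" by (rule in_k)
    fix k' assume *: "tt s k' \<le> tt s k + int l \<and> tt s k + int l < tt s (k' + 1)"
    show "k' = k"
    proof (rule ccontr)
      assume "k' \<noteq> k"
      then have "k' + 1 \<le> k \<or> k + 1 \<le> k'" by linarith
      then show False using tt_le[of "k' + 1" k] tt_le[of "k + 1" k'] * in_k by linarith
    qed
  qed
  show "offset s (tt s k + int l) = l" unfolding offset_def 1 by simp
qed

lemma index_cases:
  assumes "i \<ge> tt s K"
  obtains k l where "i = tt s k + int l" "int l < s (k + 1)" "k \<ge> K"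
proof -
  define n where "n = (LEAST n. i < tt s (Suc n))"
  have "i < tt s (Suc (nat (i + 1)))" using tt_ge[of "Suc (nat (i + 1))"] assms tt_le[of 0 K] tt_0 by simp
  then have n: "i < tt s (Suc n)" unfolding n_def by (rule LeastI)
  have "K \<le> n"
  proof (rule ccontr)
    assume "\<not> K \<le> n"
    then show False using tt_le[of "Suc n" K] n assms by simp
  qed
  have "tt s n \<le> i"
  proof (cases n)
    case 0
    then show ?thesis using assms tt_le[of 0 K] by simp
  next
    case (Suc m)
    have "\<not> i < tt s (Suc m)" using not_less_Least[of m "\<lambda>n. i < tt s (Suc n)"] Suc unfolding n_def by simp
    then show ?thesis using Suc by simp
  qed
  then show ?thesis using that[of n "nat (i - tt s n)"] n \<open>K \<le> n\<close> by (simp add: tt_Suc)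
qed

lemma pred_index:
  assumes "int l < s (k + 1)" "0 < l \<or> k \<ge> 1"
  shows "0 < l \<Longrightarrow> level s (tt s k + int l - 1) = k \<and> offset s (tt s k + int l - 1) = l - 1"
    "l = 0 \<Longrightarrow> level s (tt s k + int l - 1) = k - 1 \<and> offset s (tt s k + int l - 1) = nat (s k) - 1"
proof -
  show "level s (tt s k + int l - 1) = k \<and> offset s (tt s k + int l - 1) = l - 1" if "0 < l"
  proof -
    have e: "tt s k + int l - 1 = tt s k + int (l - 1)" using that by simp
    show ?thesis unfolding e using level_offset[of "l - 1" k] assms by simp
  qed
  show "level s (tt s k + int l - 1) = k - 1 \<and> offset s (tt s k + int l - 1) = nat (s k) - 1" if "l = 0"
  proof -
    have k: "k \<ge> 1" using assms that by simp
    have sk: "s k \<ge> 1" using s_pos k by simp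
    have e: "tt s k + int l - 1 = tt s (k - 1) + int (nat (s k) - 1)"
      using tt_Suc[of "k - 1"] k sk that by simp
    show ?thesis unfolding e using level_offset[of "nat (s k) - 1" "k - 1"] k sk by simp
  qed
qed

end

section \<open>Logarithms of the weights and of the trajectories\<close>

locale sturm_weights = sturm_index s for s :: "nat \<Rightarrow> int" +
  fixes W :: "nat \<Rightarrow> real" and \<delta> :: real
  assumes W_pos: "W k > 0"
    and W_rec: "k \<ge> 1 \<Longrightarrow> W (k + 1) = W k ^ nat (s (k + 1)) * W (k - 1)"
    and \<delta>0: "0 \<le> \<delta>" and \<delta>1: "\<delta> \<le> 1"
begin

definition x where "x k = ln (W k)"
definition eta where "eta i = ln (Yhat s W i)"
definition gg where "gg i = x (level s i)"

lemma W_nonzero [simp]: "W k \<noteq> 0"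
  using W_pos[of k] by simp

lemma x_rec: "k \<ge> 1 \<Longrightarrow> x (k + 1) = s (k + 1) * x k + x (k - 1)"
  unfolding x_def using W_rec[of k] W_pos s_pos[of "k + 1"] by (simp add: ln_mult ln_realpow)

lemma Wpred_pos: "Wpred W k > 0"
  using W_pos by (simp add: Wpred_def)

lemma ln_Wpred: "ln (Wpred W k) = (if k = 0 then x 1 - x 0 else x (k - 1))"
  by (simp add: Wpred_def x_def ln_div)

lemma Yhat_pos: "Yhat s W i > 0"
  unfolding Yhat_def using W_pos Wpred_pos by simp

lemma eta_eq: "eta i = (offset s i + 1) * gg i + ln (Wpred W (level s i))"
  unfolding eta_def Yhat_def gg_def x_def using W_pos[of "level s i"] Wpred_pos[of "level s i"]
  by (simp add: ln_mult ln_realpow algebra_simps)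

lemma eta_level: "int l < s (k + 1) \<Longrightarrow> k \<ge> 1 \<Longrightarrow> eta (tt s k + int l) = (l + 1) * x k + x (k - 1)"
  unfolding eta_eq gg_def using level_offset[of l k] by (simp add: ln_Wpred)

lemma gg_level: "int l < s (k + 1) \<Longrightarrow> gg (tt s k + int l) = x k"
  unfolding gg_def using level_offset[of l k] by simp

text \<open>The last index of level k - 1 carries W_(k-1)^(s_k) W_(k-2) = W_k. This is the link
  between consecutive levels.\<close>

lemma eta_before_tt:
  assumes "k \<ge> 1"
  shows "eta (tt s k - 1) = x k" "gg (tt s k - 1) = x (k - 1)"
proof -
  have "int 0 < s (k + 1)" using s_pos[of "k + 1"] by simp
  then have p: "level s (tt s k - 1) = k - 1" "offset s (tt s k - 1) = nat (s k) - 1"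
    using pred_index(2)[of 0 k] assms by auto
  show g: "gg (tt s k - 1) = x (k - 1)" by (simp add: gg_def p)
  have "real (nat (s k) - 1 + 1) = s k" using s_pos[of k] assms by simp
  then have "eta (tt s k - 1) = s k * x (k - 1) + ln (Wpred W (k - 1))" unfolding eta_eq g p by simp
  also have "\<dots> = x k"
  proof (cases "k = 1")
    \<comment> \<open>For \<open>k = 1\<close> the preceding weight is W_(-1) = W_1 / W_0 by
      convention, which together with s_1 = 1 gives the same formula.\<close>
    case True
    then show ?thesis using s1 by (simp add: ln_Wpred)
  next
    case False
    then have "x (k - 1 + 1) = s (k - 1 + 1) * x (k - 1) + x (k - 1 - 1)" using assms by (intro x_rec) simp
    then show ?thesis using False assms by (simp add: ln_Wpred)
  qed
  finally show "eta (tt s k - 1) = x k" .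
qed

lemma gg_pred_same: "int l < s (k + 1) \<Longrightarrow> 0 < l \<Longrightarrow> gg (tt s k + int l - 1) = x k"
  using pred_index(1)[of l k] by (simp add: gg_def)

lemma eta_step:
  assumes "i \<ge> 0"
  shows "eta i = eta (i - 1) + gg (i - 1)"
proof -
  obtain k l where kl: "i = tt s k + int l" "int l < s (k + 1)" "k \<ge> 1" using index_cases[of 1 i] assms tt_1 by auto
  show ?thesis
  proof (cases "l = 0")
    case True
    then show ?thesis using eta_before_tt[OF kl(3)] eta_level[OF kl(2,3)] kl by simp
  next
    case False
    then have "i - 1 = tt s k + int (l - 1)" "int (l - 1) < s (k + 1)" using kl by auto
    then show ?thesis using eta_level[OF kl(2,3)] eta_level[of "l - 1" k] gg_level[of "l - 1" k] kl False
      by (simp add: algebra_simps)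
  qed
qed

lemma qq_eq: "qq s W \<delta> i = (2 - \<delta>) * eta i" and cc_eq: "cc s W \<delta> i = (2 - \<delta>) * eta i + gg i"
  by (simp_all add: qq_def cc_def eta_def gg_def x_def)

lemma dd_eq: "k \<ge> 1 \<Longrightarrow> dd W \<delta> k = (2 - \<delta>) * (x k + x (k - 1)) + x k - x (k - 1)"
  unfolding dd_def by (simp add: ln_Wpred x_def algebra_simps)

lemma ln_Zhat: "ln (Zhat s W i) = eta i - gg i"
proof -
  have "Yhat s W i = Zhat s W i * W (level s i)" unfolding Yhat_def Zhat_def by simp
  moreover have "Zhat s W i > 0" unfolding Zhat_def using W_pos Wpred_pos by simp
  ultimately show ?thesis unfolding eta_def gg_def x_def using W_pos[of "level s i"] by (simp add: ln_mult)
qed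

lemma ln_Estar: "ln (Estar s W \<delta> i) = (\<delta> - 1) * eta i"
  unfolding Estar_def eta_def using Yhat_pos[of i] by (simp add: ln_powr)

lemma ln_Ecal: "ln (Ecal s W \<delta> i) = (\<delta> - 1) * eta i - gg i"
proof -
  have "ln (Ecal s W \<delta> i) = ((\<delta> - 1) * (real (offset s i) + 1) - 1) * gg i + (\<delta> - 1) * ln (Wpred W (level s i))"
    unfolding Ecal_def gg_def x_def using W_pos[of "level s i"] Wpred_pos[of "level s i"]
    by (simp add: ln_mult ln_powr)
  then show ?thesis unfolding eta_eq by (simp add: algebra_simps)
qed

lemma Lhat_eq: "Lhat s W \<delta> i q = eta i - gg i + max 0 (q - (2 - \<delta>) * eta i)"
  unfolding Lhat_def ln_Zhat ln_Ecal by (simp add: max_def algebra_simps)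

lemma Lhat_star_eq: "- Lhat_star s W \<delta> i q = min ((1 - \<delta>) * eta i) (q - eta i)"
  unfolding Lhat_star_def ln_Estar eta_def[symmetric] by (simp add: max_def min_def algebra_simps)

end

section \<open>Evaluation of P on the intervals [c_(i-1), c_i]\<close>

context sturm_weights
begin

text \<open>The trajectory of index t_(k+1) is replaced by the constant value that it has on the
  relevant interval.\<close>

definition F :: "int \<Rightarrow> real \<Rightarrow> nat \<Rightarrow> real" where
  "F i q = Phi3 (gg i) (min ((1 - \<delta>) * eta i) (q - eta i)) (eta i - gg i + max 0 (q - (2 - \<delta>) * eta i))"

context
  fixes k0 assumes k0: "valid_start W k0"
begin

lemma k0_ge: "k0 \<ge> 1" and x_pos: "k \<ge> k0 - 1 \<Longrightarrow> x k > 0"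
  using k0 by (auto simp: valid_start_def x_def)

lemma tt_k0: "tt s k0 \<ge> 0"
  using tt_le[OF k0_ge] tt_1 by simp

lemma index_cases':
  assumes "i \<ge> tt s k0 - 1"
  obtains k l where "i = tt s k + int l" "int l < s (k + 1)" "k \<ge> k0 - 1"
proof -
  have "tt s (k0 - 1) \<le> tt s k0 - 1" using tt_less[of "k0 - 1" k0] k0_ge by simp
  then show ?thesis using index_cases[of "k0 - 1" i] assms that by auto
qed

lemma gg_pos: "i \<ge> tt s k0 - 1 \<Longrightarrow> gg i > 0"
  using index_cases'[of i] gg_level x_pos by metis

lemma cc_step: "i \<ge> tt s k0 \<Longrightarrow> cc s W \<delta> (i - 1) < cc s W \<delta> i"
proof -
  assume i: "i \<ge> tt s k0"
  have "eta i = eta (i - 1) + gg (i - 1)" using i tt_k0 by (intro eta_step) simp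
  then have "cc s W \<delta> i - cc s W \<delta> (i - 1) = (1 - \<delta>) * gg (i - 1) + gg i"
    unfolding cc_eq by (simp add: algebra_simps)
  moreover have "(1 - \<delta>) * gg (i - 1) \<ge> 0" using gg_pos[of "i - 1"] \<delta>1 i by simp
  ultimately show ?thesis using gg_pos[of i] i by simp
qed

lemma cc_less:
  assumes "tt s k0 - 1 \<le> i" "i < j"
  shows "cc s W \<delta> i < cc s W \<delta> j"
  using assms(2)
proof (induction j rule: int_gr_induct)
  case base
  show ?case using cc_step[of "i + 1"] assms(1) by simp
next
  case (step j)
  then show ?case using cc_step[of "j + 1"] assms(1) by simp
qed

lemma eta_nonneg:
  assumes "i \<ge> tt s k0 - 1"
  shows "eta i > 0"
  using assms
proof (induction i rule: int_ge_induct)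
  case base
  then show ?case using eta_before_tt[OF k0_ge] x_pos[of k0] by simp
next
  case (step i)
  then show ?case using eta_step[of "i + 1"] gg_pos[of i] tt_k0 by simp
qed

text \<open>Up to c_i the trajectory of index t_(k+1) has not begun to rise: eta_i is at most x (k +
  1), so c_i is at most q at t_(k+1). Its constant value is the logarithm of Zhat at t_(k+1), which
  is W_k.\<close>

lemma Lhat_next_const:
  assumes i: "i \<ge> tt s k0" and q: "q \<le> cc s W \<delta> i"
  shows "Lhat s W \<delta> (tt s (level s i + 1)) q = gg i"
proof -
  obtain k l where kl: "i = tt s k + int l" "int l < s (k + 1)" "k \<ge> k0" using index_cases[of k0 i] i by auto
  have k1: "k \<ge> 1" using kl k0_ge by simp
  have lev: "level s i = k" using level_offset kl by simp
  have xk: "x k > 0" by (rule x_pos) (use kl in simp)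
  define t where "t = tt s (k + 1)"
  have z: "int 0 < s (k + 1 + 1)" using s_pos[of "k + 1 + 1"] by simp
  have et: "eta t = x (k + 1) + x k" "gg t = x (k + 1)"
    using eta_level[OF z] gg_level[OF z] unfolding t_def by simp_all
  have "eta i \<le> x (k + 1)"
  proof -
    have "real l + 1 \<le> s (k + 1)" using kl(2) by linarith
    then have "(real l + 1) * x k \<le> s (k + 1) * x k" using xk by (intro mult_right_mono) auto
    then show ?thesis using eta_level[OF kl(2) k1] x_rec[OF k1] kl(1) by simp
  qed
  then have "(2 - \<delta>) * eta i \<le> (2 - \<delta>) * x (k + 1)" using \<delta>1 by (intro mult_left_mono) auto
  moreover have "1 * x k \<le> (2 - \<delta>) * x k" using \<delta>1 xk by (intro mult_right_mono) auto
  moreover have "(2 - \<delta>) * eta t = (2 - \<delta>) * x (k + 1) + (2 - \<delta>) * x k" unfolding et by (rule distrib_left)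
  moreover have "q \<le> (2 - \<delta>) * eta i + x k" using q gg_level[OF kl(2)] unfolding cc_eq kl(1)[symmetric] by simp
  ultimately have "q \<le> (2 - \<delta>) * eta t" by linarith
  then show ?thesis
    unfolding lev t_def[symmetric] Lhat_eq et using gg_level[OF kl(2)] kl(1) by simp
qed

text \<open>Makes the formula valid on closed intervals although \<open>Pmap\<close> uses half-open
  ones. At c_i both formulas list the same three numbers; at a level change the first and the third
  are exchanged.\<close>

lemma F_glue:
  assumes i: "i \<ge> tt s k0"
  shows "F i (cc s W \<delta> i) = F (i + 1) (cc s W \<delta> i)"
proof -
  have i0: "i \<ge> 0" using i tt_k0 by simp
  have e: "eta (i + 1) = eta i + gg i" using eta_step[of "i + 1"] i0 by simp
  have p: "gg i > 0" "gg (i + 1) > 0" "eta i > 0" "eta (i + 1) > 0"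
    using gg_pos[of i] gg_pos[of "i + 1"] eta_nonneg[of i] eta_nonneg[of "i + 1"] i by auto
  have d: "\<delta> * gg i \<le> gg i" "0 \<le> \<delta> * gg i" "0 \<le> \<delta> * eta i" "\<delta> * eta i \<le> eta i"
    using p \<delta>0 \<delta>1 mult_right_mono[of \<delta> 1] by auto
  have 1: "min ((1 - \<delta>) * eta i) (cc s W \<delta> i - eta i) = (1 - \<delta>) * eta i"
    "max 0 (cc s W \<delta> i - (2 - \<delta>) * eta i) = gg i"
    unfolding cc_eq using p by (simp_all add: algebra_simps)
  have 2: "min ((1 - \<delta>) * eta (i + 1)) (cc s W \<delta> i - eta (i + 1)) = (1 - \<delta>) * eta i"
    "max 0 (cc s W \<delta> i - (2 - \<delta>) * eta (i + 1)) = 0"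
    unfolding cc_eq e using p d by (simp_all add: algebra_simps)
  have L: "F i (cc s W \<delta> i) = Phi3 (gg i) ((1 - \<delta>) * eta i) (eta i)"
    unfolding F_def 1 by simp
  have R: "F (i + 1) (cc s W \<delta> i) = Phi3 (gg (i + 1)) ((1 - \<delta>) * eta i) (eta i + gg i - gg (i + 1))"
    unfolding F_def 2 unfolding e by simp
  obtain k l where kl: "i + 1 = tt s k + int l" "int l < s (k + 1)" "k \<ge> k0" using index_cases[of k0 "i + 1"] i by auto
  have "gg (i + 1) = gg i \<or> gg (i + 1) = eta i"
  proof (cases "l = 0")
    case True
    then have "i = tt s k - 1" using kl by simp
    then have "eta i = x k" using eta_before_tt[of k] kl k0_ge by simp
    moreover have "gg (i + 1) = x k" using gg_level[OF kl(2)] kl(1) by simp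
    ultimately show ?thesis by simp
  next
    case False
    then have "i = tt s k + int l - 1" "gg (i + 1) = x k" using gg_level[OF kl(2)] kl(1) by simp_all
    then have "gg i = x k" using gg_pred_same[OF kl(2)] False by simp
    then show ?thesis using \<open>gg (i + 1) = x k\<close> by simp
  qed
  then show ?thesis
  proof
    assume "gg (i + 1) = eta i"
    then show ?thesis unfolding L R by (simp add: Phi3_def fun_eq_iff)
  qed (simp add: L R)
qed

lemma Pmap_eq_F:
  assumes i: "i \<ge> tt s k0" and q: "cc s W \<delta> (i - 1) \<le> q" "q \<le> cc s W \<delta> i"
  shows "Pmap s W \<delta> k0 j q = F i q j"
proof -
  have main: "Pmap s W \<delta> k0 j q = F i q j"
    if i: "i \<ge> tt s k0" and q: "cc s W \<delta> (i - 1) \<le> q" "q < cc s W \<delta> i" for i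
  proof -
    \<comment> \<open>Strict growth of the c_i makes the described index unique; it is the
      predecessor of \<open>i\<close>.\<close>
    have the: "(THE i. tt s k0 - 1 \<le> i \<and> cc s W \<delta> i \<le> q \<and> q < cc s W \<delta> (i + 1)) = i - 1"
    proof (rule the_equality)
      show "tt s k0 - 1 \<le> i - 1 \<and> cc s W \<delta> (i - 1) \<le> q \<and> q < cc s W \<delta> (i - 1 + 1)" using i q by simp
      fix i' assume *: "tt s k0 - 1 \<le> i' \<and> cc s W \<delta> i' \<le> q \<and> q < cc s W \<delta> (i' + 1)"
      show "i' = i - 1"
      proof (rule ccontr)
        assume "i' \<noteq> i - 1"
        then have "i' + 1 = i - 1 \<or> i' + 1 < i - 1 \<or> i = i' \<or> i < i'" by linarith
        then show False using cc_less[of "i' + 1" "i - 1"] cc_less[of i i'] * q i by fastforce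
      qed
    qed
    show ?thesis unfolding Pmap_def the Let_def F_def Lhat_star_eq
      using Lhat_next_const[of i q] i q by (simp add: Lhat_eq)
  qed
  show ?thesis
  proof (cases "q < cc s W \<delta> i")
    case True
    then show ?thesis using main i q by simp
  next
    case False
    then have "q = cc s W \<delta> i" using q by simp
    then show ?thesis using main[of "i + 1"] cc_step[of "i + 1"] F_glue[OF i] i by simp
  qed
qed

end

text \<open>The last condition is \<open>\<delta> * eta i < gg (i - 1)\<close> at
  \<open>i = t_k\<close>. Positivity starts at \<open>K - 3\<close> so that both predecessors of any
  \<open>k \<ge> K - 1\<close> are covered, and \<open>K \<ge> 3\<close> keeps the truncated
  subtractions exact.\<close>

definition regular_from :: "nat \<Rightarrow> bool" where
  "regular_from K \<longleftrightarrow> K \<ge> 3 \<and> (\<forall>k\<ge>K - 3. x k > 0) \<and> (\<forall>k\<ge>K - 1. \<delta> * (x k + x (k - 1)) < x (k - 1))"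

lemma regular_from_mono: "regular_from K \<Longrightarrow> K \<le> K' \<Longrightarrow> regular_from K'"
  unfolding regular_from_def by (metis diff_le_mono order_trans)

lemma regular_imp_valid: "regular_from K \<Longrightarrow> valid_start W K"
  unfolding regular_from_def valid_start_def x_def
  by (auto simp: ln_gt_zero_iff[OF W_pos])

context
  fixes K assumes K: "regular_from K"
begin

lemma x_less_x:
  assumes "k \<ge> K - 1"
  shows "x (k - 1) < x k" "x (k - 1) + x (k - 2) \<le> x k"
proof -
  have k: "k \<ge> 2" "k - 1 \<ge> K - 3" "k - 2 \<ge> K - 3" using assms K by (auto simp: regular_from_def)
  have p: "x (k - 1) > 0" "x (k - 2) > 0" using K k by (auto simp: regular_from_def)
  have r: "x k = s k * x (k - 1) + x (k - 2)" using x_rec[of "k - 1"] k by (simp add: numeral_2_eq_2)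
  have "1 * x (k - 1) \<le> s k * x (k - 1)" using s_pos[of k] k p by (intro mult_right_mono) auto
  then show "x (k - 1) < x k" "x (k - 1) + x (k - 2) \<le> x k" using r p by linarith+
qed

lemma regular_small: "k \<ge> K - 1 \<Longrightarrow> \<delta> * (x k + x (k - 1)) < x (k - 1)"
  using K by (simp add: regular_from_def)

lemma regular_x_pos: "k \<ge> K - 3 \<Longrightarrow> x k > 0" and regular_ge_3: "K \<ge> 3"
  using K by (simp_all add: regular_from_def)

text \<open>Two ranks occur: \<open>k0\<close> fixes the function \<open>Pmap\<close>, while the
  inequalities are available from \<open>K\<close> on. Keeping them apart gives asymptotic
  statements for every valid \<open>k0\<close>.\<close>

lemma sturmian_system_Pmap:
  assumes V: "valid_start W k0" "k0 \<le> K" and W_lim: "filterlim W at_top sequentially"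
  shows "sturmian_system eta gg \<delta> (tt s K) (Pmap s W \<delta> k0)"
proof
  fix i assume i: "i \<ge> tt s K"
  obtain k l where kl: "i = tt s k + int l" "int l < s (k + 1)" "k \<ge> K" using index_cases[of K i] i by auto
  have k1: "k \<ge> 1" "k \<ge> K - 1" using kl regular_ge_3 by simp_all
  have p: "x k > 0" "x (k - 1) > 0" "x (k - 1) < x k" using regular_x_pos[of k] regular_x_pos[of "k - 1"] x_less_x(1)[of k] kl by auto
  have gi: "gg i = x k" using gg_level[OF kl(2)] kl(1) by simp
  have ei: "eta i = (l + 1) * x k + x (k - 1)" using eta_level[OF kl(2) k1(1)] kl(1) by simp
  show st: "eta i = eta (i - 1) + gg (i - 1)" using eta_step[of i] i tt_le[of 1 K] tt_1 regular_ge_3 by simp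
  have cases: "l = 0 \<and> eta (i - 1) = x k \<and> gg (i - 1) = x (k - 1) \<or> l > 0 \<and> gg (i - 1) = x k"
  proof (cases "l = 0")
    case True
    then show ?thesis using eta_before_tt[OF k1(1)] kl by simp
  next
    case False
    then show ?thesis using gg_pred_same[OF kl(2)] kl by simp
  qed
  show "gg i = gg (i - 1) \<or> eta i = gg i + gg (i - 1)" using cases gi st by auto
  show "gg (i - 1) \<le> gg i" using cases gi p by auto
  show "gg i \<le> eta (i - 1)"
  proof (cases "l = 0")
    case False
    then have "1 * x k \<le> l * x k" using p by (intro mult_right_mono) auto
    moreover have "eta (i - 1) = l * x k + x (k - 1)" using st ei cases False by (simp add: algebra_simps)
    ultimately show ?thesis using gi p by linarith
  qed (use cases gi in auto)
  show "0 < gg (i - 1)" using cases p by auto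
  \<comment> \<open>For \<open>l = 0\<close> this is regularity at \<open>k\<close>. For
    \<open>l > 0\<close> it is regularity at \<open>k + 1\<close>, as eta_i is at most x (k + 1) + x
    k, the value at t_(k+1).\<close>
  show "\<delta> * eta i < gg (i - 1)"
  proof (cases "l = 0")
    case True
    then show ?thesis using cases ei regular_small[OF k1(2)] by simp
  next
    case False
    have "real l + 1 \<le> s (k + 1)" using kl(2) by linarith
    then have "(real l + 1) * x k \<le> s (k + 1) * x k" using p by (intro mult_right_mono) auto
    then have "eta i \<le> x (k + 1) + x k" using ei x_rec[OF k1(1)] p unfolding of_nat_add of_nat_1 by linarith
    then have "\<delta> * eta i \<le> \<delta> * (x (k + 1) + x k)" using \<delta>0 by (rule mult_left_mono)
    also have "\<dots> < x k" using regular_small[of "k + 1"] kl(3) by simp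
    finally show ?thesis using cases False by simp
  qed
next
  show "0 \<le> \<delta>" by (rule \<delta>0)
  show "gg (tt s K - 1) \<le> (1 - \<delta>) * eta (tt s K - 1)"
  proof -
    have k1: "K \<ge> 1" using regular_ge_3 by simp
    have p: "x (K - 1) > 0" "x (K - 2) > 0" using regular_x_pos[of "K - 1"] regular_x_pos[of "K - 2"] regular_ge_3 by simp_all
    have r: "x K = s K * x (K - 1) + x (K - 2)" using x_rec[of "K - 1"] regular_ge_3 by (simp add: numeral_2_eq_2)
    \<comment> \<open>If s_K = 1, the difference x_K - x_(K-1) is only x_(K-2) and regularity at
      \<open>K - 1\<close> is used; otherwise it is at least x_(K-1) and regularity at
      \<open>K\<close> suffices.\<close>
    have "x (K - 1) + \<delta> * x K \<le> x K"
    proof (cases "s K = 1")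
      case True
      then have "\<delta> * x K < x (K - 2)" using regular_small[of "K - 1"] r by (simp add: numeral_2_eq_2)
      then show ?thesis using r True by simp
    next
      case False
      then have "2 \<le> s K" using s_pos[of K] k1 by simp
      then have "2 * x (K - 1) \<le> s K * x (K - 1)" using p by (intro mult_right_mono) auto
      moreover have "\<delta> * x K + \<delta> * x (K - 1) < x (K - 1)" using regular_small[of K] by (simp add: algebra_simps)
      moreover have "\<delta> * x (K - 1) \<ge> 0" using p \<delta>0 by simp
      ultimately show ?thesis using r p by linarith
    qed
    then show ?thesis using eta_before_tt[OF k1] by (simp add: algebra_simps)
  qed
  show "\<exists>i\<ge>tt s K. z < (2 - \<delta>) * eta i + gg i" for z
  proof -
    have "\<forall>\<^sub>F k in sequentially. exp z < W k" using W_lim filterlim_at_top_dense by blast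
    then have "\<forall>\<^sub>F k in sequentially. exp z < W k \<and> k \<ge> K"
      using eventually_ge_at_top[of K] by eventually_elim simp
    then obtain k where k: "exp z < W k" "k \<ge> K" by (auto dest: eventually_happens)
    have "z < x k" using k(1) W_pos[of k] unfolding x_def by (metis exp_gt_zero ln_exp ln_less_cancel_iff)
    moreover have z: "int 0 < s (k + 1)" using s_pos[of "k + 1"] by simp
    moreover have "x k > 0" "x (k - 1) > 0" by (rule regular_x_pos; use k(2) regular_ge_3 in linarith)+
    then have "eta (tt s k) > 0" using eta_level[OF z] k regular_ge_3 by simp
    then have "(2 - \<delta>) * eta (tt s k) > 0" using \<delta>1 by simp
    ultimately have "z < (2 - \<delta>) * eta (tt s k) + gg (tt s k)" using gg_level[OF z] by simp
    then show ?thesis using tt_le[OF k(2)] by blast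
  qed
  fix i q j assume "i \<ge> tt s K" "(2 - \<delta>) * eta (i - 1) + gg (i - 1) \<le> q" "q \<le> (2 - \<delta>) * eta i + gg i"
  then show "Pmap s W \<delta> k0 j q = Phi3 (gg i) (min ((1 - \<delta>) * eta i) (q - eta i))
        (eta i - gg i + max 0 (q - (2 - \<delta>) * eta i)) j"
    using Pmap_eq_F[OF V(1), of i q j] tt_le[OF V(2)] unfolding cc_eq F_def by simp
qed

end

context
  fixes K k0 assumes K: "regular_from K" and V: "valid_start W k0" "k0 \<le> K"
    and W_lim: "filterlim W at_top sequentially"
begin

interpretation P: sturmian_system eta gg \<delta> "tt s K" "Pmap s W \<delta> k0"
  by (rule sturmian_system_Pmap[OF K V W_lim])

lemma P_abscissas: "P.q = qq s W \<delta>" "P.c = cc s W \<delta>"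
  unfolding P.q_def P.c_def qq_eq cc_eq by (auto simp: fun_eq_iff P.q_def P.c_def qq_eq cc_eq)

lemma Iset_eq:
  assumes "i \<ge> tt s K"
  shows "Iset s W \<delta> k0 i = {P.a i..P.b i}" "aa s W \<delta> k0 i = P.a i" "bb s W \<delta> k0 i = P.b i"
proof -
  show 1: "Iset s W \<delta> k0 i = {P.a i..P.b i}"
    unfolding Iset_def Lhat_star_eq P.P3_maximal_set[OF assms, symmetric] P_abscissas ..
  have "P.a i \<le> P.b i" using P.order[OF assms] by simp
  then show "aa s W \<delta> k0 i = P.a i" "bb s W \<delta> k0 i = P.b i" unfolding aa_def bb_def 1 by simp_all
qed

text \<open>Over one level P_1 rises from x (k - 1) to x k right after q at t_k and then stays flat.
  In this form P_1 displays \<open>x\<close> and \<delta>, which the comparison of two sequences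
  exploits.\<close>

lemma Pmap_1_eq:
  assumes k: "k \<ge> K" and z: "qq s W \<delta> (tt s k) \<le> z" "z \<le> qq s W \<delta> (tt s (k + 1))"
  shows "Pmap s W \<delta> k0 1 z = min (x k) (x (k - 1) + z - qq s W \<delta> (tt s k))"
proof -
  have k1: "k \<ge> 1" "k \<ge> K - 1" using k regular_ge_3[OF K] by simp_all
  have tk: "tt s K \<le> tt s k" using k by (rule tt_le)
  define i where "i = tt s k"
  have z0: "int 0 < s (k + 1)" using s_pos[of "k + 1"] by simp
  have g: "gg i = x k" "gg (i - 1) = x (k - 1)" using gg_level[OF z0] eta_before_tt[OF k1(1)] by (simp_all add: i_def)
  have lt: "x (k - 1) < x k" using x_less_x(1)[OF K k1(2)] .
  have i: "i \<ge> tt s K" using tk by (simp add: i_def)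
  have d: "P.d i = P.q i + x k - x (k - 1)" by (simp add: P.d_def g)
  have zq: "P.q i \<le> z" "z \<le> P.q (tt s (k + 1))" using z unfolding P_abscissas i_def by simp_all
  have O: "P.c (i - 1) \<le> P.q i" using P.order[OF i] by simp
  have "P.c (tt s K - 1) \<le> z"
  proof -
    have "P.c (tt s K - 1) \<le> P.c (i - 1)"
    proof (cases "i = tt s K")
      case False
      then show ?thesis
        using cc_less[OF V(1), of "tt s K - 1" "i - 1"] tt_le[OF V(2)] i unfolding P_abscissas by simp
    qed simp
    then show ?thesis using O zq by simp
  qed
  then obtain j where j: "j \<ge> tt s K" "P.c (j - 1) \<le> z" "z < P.c j" using P.index_exists_right by blast
  have cl: "P.c m < P.c n" if "tt s K - 1 \<le> m" "m < n" for m n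
    using cc_less[OF V(1), of m n] tt_le[OF V(2)] that unfolding P_abscissas by simp
  have "i \<le> j"
  proof (rule ccontr)
    assume "\<not> i \<le> j"
    then have "P.c j \<le> P.c (i - 1)" using cl[of j "i - 1"] j by (cases "j = i - 1") auto
    then show False using j O zq by simp
  qed
  have "j \<le> tt s (k + 1)"
  proof (rule ccontr)
    assume n: "\<not> j \<le> tt s (k + 1)"
    have t: "tt s (k + 1) \<ge> tt s K" using tt_le[of K "k + 1"] k by simp
    have "P.c (tt s (k + 1)) \<le> P.c (j - 1)" using cl[of "tt s (k + 1)" "j - 1"] n t by (cases "tt s (k + 1) = j - 1") auto
    moreover have "P.q (tt s (k + 1)) < P.c (tt s (k + 1))" using P.order[OF t] by simp
    ultimately show False using j zq by simp
  qed
  note S = P.pieces[OF j(1), of z 1]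
  \<comment> \<open>Only the interval of index t_k contains the rise; for the later indices up to
    t_(k+1) the value is already x k.\<close>
  have main: "Pmap s W \<delta> k0 1 z = min (x k) (x (k - 1) + z - P.q i)"
  proof (cases "j = i")
    case True
    note S = S[unfolded True] and Oi = P.order[OF i]
    consider "z \<in> {P.q i..P.d i}" | "z \<in> {P.d i..P.b i}" | "z \<in> {P.b i..P.c i}"
      using zq j True by fastforce
    then show ?thesis
    proof cases
      case 1
      then show ?thesis using S(3) d g by simp
    next
      case 2
      then show ?thesis using S(4) d g by simp
    next
      case 3
      then have "P.d i \<le> z" using Oi by simp
      then show ?thesis using S(5) d g 3 by simp
    qed
  next
    case False
    then have ij: "i < j" using \<open>i \<le> j\<close> by simp
    have "P.c i \<le> P.c (j - 1)" using cl[of i "j - 1"] i ij by (cases "i = j - 1") auto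
    then have zd: "P.d i \<le> z" using j P.order[OF i] by simp
    have j1: "gg (j - 1) = x k"
    proof -
      have "j - 1 = tt s k + int (nat (j - 1 - i))" "int (nat (j - 1 - i)) < s (k + 1)"
        using ij \<open>j \<le> tt s (k + 1)\<close> unfolding i_def by (simp_all add: tt_Suc)
      then show ?thesis using gg_level by metis
    qed
    have "Pmap s W \<delta> k0 1 z = x k"
    proof (cases "j = tt s (k + 1)")
      case True
      then have "z \<in> {P.c (j - 1)..P.a j} \<or> z \<in> {P.a j..P.q j}" using zq j by auto
      then show ?thesis using S j1 by auto
    next
      case False
      then have "j = tt s k + int (nat (j - i))" "int (nat (j - i)) < s (k + 1)"
        using ij \<open>j \<le> tt s (k + 1)\<close> unfolding i_def by (simp_all add: tt_Suc)
      then have gj: "gg j = x k" using gg_level by metis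
      then have dj: "P.d j = P.q j" by (simp add: P.d_def j1)
      have "z \<in> {P.c (j - 1)..P.a j} \<or> z \<in> {P.a j..P.q j} \<or> z \<in> {P.d j..P.b j} \<or> z \<in> {P.b j..P.c j}"
        using j unfolding dj by auto
      then show ?thesis using S j1 gj by auto
    qed
    then show ?thesis using zd d by simp
  qed
  then show ?thesis unfolding P_abscissas i_def .
qed

lemma graph_type:
  assumes "k0 = K"
  shows "three_system (qq s W \<delta> (tt s k0)) (Pmap s W \<delta> k0)"
    "combined_graph_type s k0 (Pmap s W \<delta> k0)
         (aa s W \<delta> k0) (qq s W \<delta>) (bb s W \<delta> k0) (cc s W \<delta>) (dd W \<delta>)"
proof -
  show "three_system (qq s W \<delta> (tt s k0)) (Pmap s W \<delta> k0)"
    using P.three_system unfolding P_abscissas assms .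
  show "combined_graph_type s k0 (Pmap s W \<delta> k0)
         (aa s W \<delta> k0) (qq s W \<delta>) (bb s W \<delta> k0) (cc s W \<delta>) (dd W \<delta>)"
    unfolding combined_graph_type_def
  proof (intro allI impI, goal_cases)
    case (1 i)
    then have i: "i \<ge> tt s K" using assms by simp
    note G = P.graph[OF i, unfolded P_abscissas] and O = P.order[OF i, unfolded P_abscissas]
      and M = P.meets[OF i, unfolded P_abscissas]
    have M': "Pmap s W \<delta> k0 2 (P.a (i + 1)) = Pmap s W \<delta> k0 3 (P.a (i + 1))"
      using P.meets(1)[of "i + 1"] i by simp
    have same: "slope_on 0 (Pmap s W \<delta> k0 1) {P.a i..P.b i} \<and>
        slope_on 0 (Pmap s W \<delta> k0 2) {P.a i..qq s W \<delta> i} \<and> slope_on 1 (Pmap s W \<delta> k0 2) {qq s W \<delta> i..P.b i}"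
      if kl: "i = tt s k + l" "0 < l" "l < s (k + 1)" for k l
    proof -
      have "int (nat l) < s (k + 1)" "0 < nat l" using kl by auto
      then have "gg i = gg (i - 1)" using gg_pred_same[of "nat l" k] gg_level[of "nat l" k] kl by simp
      then show ?thesis using G(3) by simp
    qed
    have turn: "qq s W \<delta> i < dd W \<delta> k \<and> dd W \<delta> k < P.b i \<and>
        slope_on 0 (Pmap s W \<delta> k0 1) {P.a i..qq s W \<delta> i} \<and> slope_on 1 (Pmap s W \<delta> k0 1) {qq s W \<delta> i..dd W \<delta> k} \<and>
        slope_on 0 (Pmap s W \<delta> k0 1) {dd W \<delta> k..P.b i} \<and>
        slope_on 0 (Pmap s W \<delta> k0 2) {P.a i..dd W \<delta> k} \<and> slope_on 1 (Pmap s W \<delta> k0 2) {dd W \<delta> k..P.b i} \<and>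
        Pmap s W \<delta> k0 1 (dd W \<delta> k) = Pmap s W \<delta> k0 2 (dd W \<delta> k)"
      if k: "i = tt s k" for k
    proof -
      have "k \<ge> K" using i k tt_less[of k K] by (meson not_le_imp_less not_le)
      then have k1: "k \<ge> 1" "k \<ge> K - 1" using regular_ge_3[OF K] by simp_all
      have z: "int 0 < s (k + 1)" using s_pos[of "k + 1"] by simp
      have "P.d i = dd W \<delta> k"
        using dd_eq[OF k1(1)] eta_level[OF z k1(1)] gg_level[OF z] eta_before_tt[OF k1(1)] k
        by (simp add: P.d_def P.q_def)
      moreover have "qq s W \<delta> i < P.d i"
        using x_less_x(1)[OF K k1(2)] gg_level[OF z] eta_before_tt[OF k1(1)] k P_abscissas(1)
        by (simp add: P.d_def)
      ultimately show ?thesis using G(4) O M(3) by simp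
    qed
    have ai: "aa s W \<delta> k0 i = P.a i" "bb s W \<delta> k0 i = P.b i" "aa s W \<delta> k0 (i + 1) = P.a (i + 1)"
      using Iset_eq[OF i] Iset_eq[of "i + 1"] i by auto
    show ?case
      unfolding ai using G(1,2,5-9) O(2,5,7,8) M(2) M' same turn by (intro conjI allI impI) blast+
  qed
qed

end

end

section \<open>Rigidity of the staircase\<close>

text \<open>What is left of a sequence when only P_1 is looked at: \<open>p\<close> stands for P_1,
  and no matrix occurs. This is the form in which two sequences with the same \<xi> are
  compared.\<close>

locale staircase =
  fixes s :: "nat \<Rightarrow> int" and x :: "nat \<Rightarrow> real" and \<delta> :: real and p :: "real \<Rightarrow> real" and K :: nat and B :: int
  assumes s_pos: "k \<ge> K \<Longrightarrow> s k \<ge> 1" and s_le: "s k \<le> B"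
    and K: "K \<ge> 2"
    and rec: "k \<ge> K \<Longrightarrow> x (k + 1) = s (k + 1) * x k + x (k - 1)"
    and pos: "k \<ge> K - 1 \<Longrightarrow> x k > 0"
    and x_less: "k \<ge> K \<Longrightarrow> x (k - 1) < x k"
    and x_lim: "filterlim x at_top sequentially"
    and \<delta>: "0 \<le> \<delta>" "\<delta> < 1"
    and p: "k \<ge> K \<Longrightarrow> (2 - \<delta>) * (x k + x (k - 1)) \<le> z \<Longrightarrow> z \<le> (2 - \<delta>) * (x (k + 1) + x k) \<Longrightarrow>
        p z = min (x k) (x (k - 1) + z - (2 - \<delta>) * (x k + x (k - 1)))"
begin

text \<open>The flat part of height \<open>x (k - 1)\<close> ends at \<open>u k\<close>, that of height \<open>x k\<close> begins at \<open>f k\<close>.\<close>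

definition u where "u k = (2 - \<delta>) * (x k + x (k - 1))"
definition f where "f k = u k + x k - x (k - 1)"

lemma p_eq: "k \<ge> K \<Longrightarrow> u k \<le> z \<Longrightarrow> z \<le> u (k + 1) \<Longrightarrow> p z = min (x k) (x (k - 1) + z - u k)"
  using p[of k z] by (simp add: u_def)

lemma x_pos: "k \<ge> K \<Longrightarrow> x k > 0" "k \<ge> K \<Longrightarrow> x (k - 1) > 0"
  by (rule pos; linarith)+

lemma mono:
  assumes "K - 1 \<le> k" "k \<le> k'"
  shows "x k \<le> x k'"
  using assms(2)
proof (induction rule: dec_induct)
  case (step n)
  have "K \<le> Suc n" using step(1) assms(1) by linarith
  then show ?case using x_less[of "Suc n"] step by simp
qed simp

lemma mono': "K \<le> k \<Longrightarrow> k \<le> k' \<Longrightarrow> x k \<le> x k'"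
  by (rule mono) linarith+

lemma gap:
  assumes "k \<ge> K"
  shows "x (k + 1) - x k \<ge> x (k - 1)"
proof -
  have "1 * x k \<le> s (k + 1) * x k" using s_pos[of "k + 1"] x_pos[OF assms] assms by (intro mult_right_mono) auto
  then show ?thesis using rec[OF assms] by linarith
qed

lemma u_Suc: "k \<ge> K \<Longrightarrow> u (k + 1) - u k \<ge> x (k + 1) - x (k - 1)"
proof -
  assume k: "k \<ge> K"
  have "u (k + 1) - u k = (2 - \<delta>) * (x (k + 1) - x (k - 1))" unfolding u_def by (simp add: algebra_simps)
  moreover have "1 * (x (k + 1) - x (k - 1)) \<le> (2 - \<delta>) * (x (k + 1) - x (k - 1))"
    using \<delta> mono[of "k - 1" "k + 1"] k by (intro mult_right_mono) auto
  ultimately show ?thesis unfolding mult_1_left by linarith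
qed

text \<open>The flat parts have length at least x (k - 1), hence become arbitrarily long. This is
  what prevents a flat part of one staircase from running along a ramp of another.\<close>

lemma flat_length: "k \<ge> K \<Longrightarrow> u k \<le> f k \<and> f k + x (k - 1) \<le> u (k + 1)"
  using u_Suc[of k] gap[of k] x_less[of k] unfolding f_def by linarith

lemma u_mono:
  assumes "K \<le> k" "k \<le> k'"
  shows "u k \<le> u k'"
  using assms(2)
proof (induction rule: dec_induct)
  case (step n)
  have "K \<le> n" using step(1) assms(1) by linarith
  then show ?case using flat_length[of n] x_pos[of n] step by simp
qed simp

lemma u_ge_x: "k \<ge> K \<Longrightarrow> x k \<le> u k"
proof -
  assume k: "k \<ge> K"
  have "1 * (x k + x (k - 1)) \<le> u k" unfolding u_def using \<delta> x_pos[OF k] by (intro mult_right_mono) auto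
  then show ?thesis using x_pos[OF k] unfolding mult_1_left by linarith
qed

lemma x_eventually_gt: "\<exists>M\<ge>K. \<forall>k\<ge>M. x k > c"
proof -
  have "\<forall>\<^sub>F k in sequentially. c < x k" using x_lim filterlim_at_top_dense by blast
  then obtain M where "\<forall>k\<ge>M. c < x k" unfolding eventually_sequentially by blast
  then show ?thesis by (intro exI[of _ "max M K"]) auto
qed

lemma locate:
  assumes "u M \<le> z" "M \<ge> K"
  obtains k where "k \<ge> M" "u k \<le> z" "z < u (k + 1)"
proof -
  obtain M' where M': "M' \<ge> K" "\<forall>k\<ge>M'. x k > z" using x_eventually_gt by blast
  define n where "n = (LEAST n. z < u (M + n + 1))"
  have "z < u (M + (M' + M) + 1)"
    using M'(2)[rule_format, of "M + (M' + M) + 1"] u_ge_x[of "M + (M' + M) + 1"] assms(2) by simp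
  then have n: "z < u (M + n + 1)" unfolding n_def by (rule LeastI)
  have "u (M + n) \<le> z"
  proof (cases n)
    case 0
    then show ?thesis using assms by simp
  next
    case (Suc m)
    have "\<not> z < u (M + m + 1)" using not_less_Least[of m "\<lambda>n. z < u (M + n + 1)"] Suc unfolding n_def by simp
    then show ?thesis using Suc by simp
  qed
  then show ?thesis using that[of "M + n"] n by simp
qed

lemma p_flat:
  assumes "k \<ge> K" "f k \<le> z" "z \<le> u (k + 1)"
  shows "p z = x k"
proof -
  have "u k \<le> z" using flat_length[OF assms(1)] assms(2) by linarith
  then show ?thesis using p_eq[OF assms(1) _ assms(3)] assms(2) unfolding f_def by simp
qed

lemma p_ramp:
  assumes "k \<ge> K" "u k \<le> z" "z \<le> f k"
  shows "p z = x (k - 1) + z - u k"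
proof -
  have "z \<le> u (k + 1)" using flat_length[OF assms(1)] x_pos[OF assms(1)] assms(3) by linarith
  then show ?thesis using p_eq[OF assms(1,2)] assms(3) unfolding f_def by simp
qed

lemma p_le:
  assumes "k \<ge> K" "u K \<le> z" "z < u k"
  shows "p z \<le> x (k - 1)"
proof -
  obtain j where j: "j \<ge> K" "u j \<le> z" "z < u (j + 1)" using locate[OF assms(2)] by auto
  have "j < k"
  proof (rule ccontr)
    assume "\<not> j < k"
    then show False using u_mono[of k j] assms j by simp
  qed
  then have "x j \<le> x (k - 1)" using mono'[of j "k - 1"] j by simp
  then show ?thesis using p_eq[OF j(1,2)] j by simp
qed

text \<open>On a window of length 2C + 1 inside a flat part of \<open>p\<close> the function
  \<open>p'\<close> varies by at most 2C, so it cannot rise with slope 1 throughout and takes one of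
  its own flat values there.\<close>

lemma flat_value_approximated:
  assumes "staircase s' x' \<delta>' p' K' B'"
    and close: "\<And>z. z \<ge> Z \<Longrightarrow> \<bar>p z - p' z\<bar> \<le> C" and C: "C \<ge> 1"
  shows "\<exists>M\<ge>K. \<forall>k\<ge>M. \<exists>k'\<ge>M'. \<bar>x' k' - x k\<bar> \<le> C"
proof -
  interpret S: staircase s' x' \<delta>' p' K' B' by (rule assms)
  define M2 where "M2 = max M' K'"
  obtain M where M: "M \<ge> K" "\<forall>k\<ge>M. x k > max (max Z (S.u M2)) (2 * C + 1)" using x_eventually_gt by blast
  have "\<exists>k'\<ge>M'. \<bar>x' k' - x k\<bar> \<le> C" if k: "k \<ge> M + 1" for k
  proof -
    have kK: "k \<ge> K" using k M by simp
    have xb: "x k > Z" "x k > S.u M2" "x (k - 1) > 2 * C + 1" using M(2) k by auto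
    define z where "z = f k"
    have F: "u k \<le> f k" "f k + (2 * C + 1) \<le> u (k + 1)" using flat_length[OF kK] xb by auto
    have z: "z \<ge> Z" "z \<ge> S.u M2" using F u_ge_x[OF kK] xb unfolding z_def by auto
    obtain k' where k': "k' \<ge> M2" "S.u k' \<le> z" "z < S.u (k' + 1)"
      using S.locate[OF z(2)] M2_def by auto
    have k'K: "k' \<ge> K'" "k' \<ge> M'" using k' by (auto simp: M2_def)
    have pz: "p t = x k" if "z \<le> t" "t \<le> z + (2 * C + 1)" for t
      using p_flat[OF kK, of t] that F unfolding z_def by auto
    have Fl: "S.u k' \<le> S.f k'" "S.f k' \<le> S.u (k' + 1)"
      using S.flat_length[OF k'K(1)] S.x_pos[OF k'K(1)] by linarith+
    have "\<bar>x' k' - x k\<bar> \<le> C"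
    proof (cases "S.f k' \<le> z")
      case True
      then have "p' z = x' k'" using S.p_flat[OF k'K(1), of z] k' by simp
      then show ?thesis using close[OF z(1)] pz[of z] C by simp
    next
      case False
      show ?thesis
      proof (cases "S.f k' \<le> z + (2 * C + 1)")
        case True
        then have "p' (S.f k') = x' k'" using S.p_flat[OF k'K(1), of "S.f k'"] Fl by simp
        then show ?thesis using close[of "S.f k'"] pz[of "S.f k'"] False True z by simp
      next
        case n: False
        have "p' z = x' (k' - 1) + z - S.u k'" using S.p_ramp[OF k'K(1) k'(2)] False by simp
        moreover have "p' (z + (2 * C + 1)) = x' (k' - 1) + (z + (2 * C + 1)) - S.u k'"
          by (rule S.p_ramp[OF k'K(1)]) (use k' n C in auto)
        moreover have "\<bar>p z - p' z\<bar> \<le> C" "\<bar>p (z + (2 * C + 1)) - p' (z + (2 * C + 1))\<bar> \<le> C"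
          using close[of z] close[of "z + (2 * C + 1)"] z C by auto
        moreover have "p z = x k" "p (z + (2 * C + 1)) = x k" using pz[of z] pz[of "z + (2 * C + 1)"] C by auto
        ultimately show ?thesis using C by linarith
      qed
    qed
    then show ?thesis using k'K by blast
  qed
  then show ?thesis using M(1) by (intro exI[of _ "M + 1"]) auto
qed

end

text \<open>The products \<open>e (n + 1) * e n\<close> are bounded and grow by at least \<open>(e (n + 1))\<^sup>2\<close> at each step.\<close>

lemma bounded_linear_recurrence_tendsto_0:
  fixes e :: "nat \<Rightarrow> real" and s :: "nat \<Rightarrow> int"
  assumes b: "\<And>n. \<bar>e n\<bar> \<le> C" and s: "\<And>n. s n \<ge> 1"
    and rec: "\<And>n. e (n + 2) = s n * e (n + 1) + e n"
  shows "e \<longlonglongrightarrow> 0"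
proof -
  define m where "m n = e (n + 1) * e n" for n
  have C: "C \<ge> 0" using b[of 0] by linarith
  have inc: "m (Suc n) - m n \<ge> (e (Suc n))\<^sup>2" for n
  proof -
    have "m (Suc n) - m n = s n * (e (Suc n))\<^sup>2"
      unfolding m_def using rec[of n] by (simp add: algebra_simps power2_eq_square)
    also have "\<dots> \<ge> 1 * (e (Suc n))\<^sup>2" using s[of n] by (intro mult_right_mono) auto
    finally show ?thesis by simp
  qed
  have mb: "\<bar>m n\<bar> \<le> C * C" for n unfolding m_def abs_mult by (rule mult_mono') (use b in auto)
  have "incseq m" by (rule incseq_SucI) (use inc in \<open>smt (verit) zero_le_power2\<close>)
  moreover have "m n \<le> C * C" for n using mb[of n] by simp
  ultimately obtain l where l: "m \<longlonglongrightarrow> l" using incseq_convergent by blast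
  have diff: "(\<lambda>n. m (Suc n) - m n) \<longlonglongrightarrow> l - l" by (intro tendsto_diff LIMSEQ_Suc l)
  have "(\<lambda>n. (e (Suc n))\<^sup>2) \<longlonglongrightarrow> 0"
  proof (rule tendsto_sandwich[rotated 3])
    show "(\<lambda>n. m (Suc n) - m n) \<longlonglongrightarrow> 0" using diff by simp
    show "\<forall>\<^sub>F n in sequentially. 0 \<le> (e (Suc n))\<^sup>2" by simp
    show "\<forall>\<^sub>F n in sequentially. (e (Suc n))\<^sup>2 \<le> m (Suc n) - m n" using inc by simp
  qed simp
  then have "(\<lambda>n. sqrt ((e (Suc n))\<^sup>2)) \<longlonglongrightarrow> sqrt 0" by (rule tendsto_real_sqrt)
  then have "(\<lambda>n. \<bar>e (Suc n)\<bar>) \<longlonglongrightarrow> 0" by simp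
  then have "(\<lambda>n. e (Suc n)) \<longlonglongrightarrow> 0" by (rule tendsto_rabs_zero_cancel)
  then show ?thesis by (rule LIMSEQ_imp_Suc)
qed

text \<open>The heights are matched in order, after shifts \<open>a\<close> and \<open>b\<close>,
  with bounded differences. The recurrences then force equal coefficients, and the differences solve
  the recurrence with these coefficients, so they tend to 0. The abscissas of the corners, being at
  bounded distance, determine \<delta>.\<close>

lemma staircases_asymptotic:
  assumes "staircase s x \<delta> p K B" and "staircase s' x' \<delta>' p' K' B'"
    and close: "\<And>z. z \<ge> Z \<Longrightarrow> \<bar>p z - p' z\<bar> \<le> C"
  shows "\<delta>' = \<delta> \<and> (\<exists>a b. (\<lambda>n. x' (n + b) - x (n + a)) \<longlonglongrightarrow> 0 \<and> (\<forall>n. s' (n + b + 1) = s (n + a + 1)))"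
proof -
  interpret S: staircase s x \<delta> p K B by (rule assms)
  interpret S': staircase s' x' \<delta>' p' K' B' by (rule assms)
  define D where "D = max C 1"
  have D: "D \<ge> 1" and cl: "\<And>z. z \<ge> Z \<Longrightarrow> \<bar>p z - p' z\<bar> \<le> D" and cl': "\<And>z. z \<ge> Z \<Longrightarrow> \<bar>p' z - p z\<bar> \<le> D"
    using close by (auto simp: D_def abs_minus_commute max.coboundedI1)
  obtain T where T: "T \<ge> K" "\<forall>k\<ge>T. x k > 4 * D + 2" using S.x_eventually_gt by blast
  obtain T' where T': "T' \<ge> K'" "\<forall>k\<ge>T'. x' k > 4 * D + 2" using S'.x_eventually_gt by blast
  obtain M2 where M2: "M2 \<ge> K'" "\<forall>k'\<ge>M2. \<exists>k\<ge>T + 1. \<bar>x k - x' k'\<bar> \<le> D"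
    using S'.flat_value_approximated[OF assms(1) cl' D] by blast
  obtain M where M: "M \<ge> K" "\<forall>k\<ge>M. \<exists>k'\<ge>max (T' + 1) M2. \<bar>x' k' - x k\<bar> \<le> D"
    using S.flat_value_approximated[OF assms(2) cl D] by blast
  have gap: "x (k + 1) - x k > 4 * D + 2" if "k \<ge> T + 1" for k
  proof -
    have "k \<ge> K" "k - 1 \<ge> T" using T(1) that by auto
    then show ?thesis using S.gap[of k] T(2) by (meson less_le_trans)
  qed
  have gap': "x' (k + 1) - x' k > 4 * D + 2" if "k \<ge> T' + 1" for k
  proof -
    have "k \<ge> K'" "k - 1 \<ge> T'" using T'(1) that by auto
    then show ?thesis using S'.gap[of k] T'(2) by (meson less_le_trans)
  qed
  define a where "a = max M (T + 1)"
  have "a \<ge> M" by (simp add: a_def)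
  then obtain b where b: "b \<ge> max (T' + 1) M2" "\<bar>x' b - x a\<bar> \<le> D" using M(2) by blast
  have match: "\<bar>x' (n + b) - x (n + a)\<bar> \<le> D" for n
  proof (induction n)
    case 0
    then show ?case using b by simp
  next
    case (Suc n)
    define k where "k = n + a"
    define k' where "k' = n + b"
    have k: "k \<ge> T + 1" "k \<ge> M" "k' \<ge> T' + 1" "k' \<ge> M2" "k \<ge> K" "k' \<ge> K'"
      using T T' M b unfolding k_def k'_def a_def by auto
    have IH: "\<bar>x' k' - x k\<bar> \<le> D" using Suc by (simp add: k_def k'_def)
    obtain j where j: "j \<ge> max (T' + 1) M2" "\<bar>x' j - x (k + 1)\<bar> \<le> D" using M(2) k by (meson trans_le_add1)
    have jK: "j \<ge> K'" using j T' by simp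
    have "x' j > x' k'" using j IH gap[OF k(1)] D by linarith
    then have "k' < j" using S'.mono'[of j k'] jK by (meson linorder_not_le)
    \<comment> \<open>A skipped height of the second staircase would be close to a height of the
      first lying strictly between two consecutive ones; the gaps above \<open>4 * D + 2\<close> on
      both sides leave room for this conclusion.\<close>
    have "j = k' + 1"
    proof (rule ccontr)
      assume "j \<noteq> k' + 1"
      then have jj: "k' + 1 + 1 \<le> j" using \<open>k' < j\<close> by simp
      obtain l where l: "l \<ge> T + 1" "\<bar>x l - x' (k' + 1)\<bar> \<le> D" using M2(2) k by (meson trans_le_add1)
      have "x' (k' + 1 + 1) \<le> x' j" using S'.mono'[of "k' + 1 + 1" j] jj k by simp
      then have h: "x' (k' + 1) > x' k' + 4 * D + 2" "x' (k' + 1) + 4 * D + 2 < x' j"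
        using gap'[of k'] gap'[of "k' + 1"] k by auto
      then have "x k < x l" "x l < x (k + 1)" using l j IH D by linarith+
      moreover have "l \<ge> K" "k + 1 \<ge> K" using l T k by auto
      ultimately have "k < l" "l < k + 1"
        using S.mono'[of l k] S.mono'[of "k + 1" l] by (meson linorder_not_le)+
      then show False by simp
    qed
    then show ?case using j(2) by (simp add: k_def k'_def)
  qed
  have aK: "a \<ge> K + 1" "b \<ge> K' + 1" using T T' M b unfolding a_def by auto
  define e where "e n = x' (n + b) - x (n + a)" for n
  have eb: "\<bar>e n\<bar> \<le> D" for n using match by (simp add: e_def)
  have rec: "x (n + a + 2) = s (n + a + 2) * x (n + a + 1) + x (n + a)" for n
    using S.rec[of "n + a + 1"] aK by simp
  have rec': "x' (n + b + 2) = s' (n + b + 2) * x' (n + b + 1) + x' (n + b)" for n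
    using S'.rec[of "n + b + 1"] aK by simp
  have e_rec: "e (n + 2) = (s' (n + b + 2) - s (n + a + 2)) * x (n + a + 1) + s' (n + b + 2) * e (n + 1) + e n" for n
    unfolding e_def using rec[of n] rec'[of n] by (simp add: algebra_simps)
  have "B' \<ge> 1" using S'.s_pos[of K'] S'.s_le[of K'] by simp
  obtain T2 where T2: "T2 \<ge> K" "\<forall>k\<ge>T2. x k > 2 * D + B' * D" using S.x_eventually_gt by blast
  \<comment> \<open>In \<open>e_rec\<close> the difference of the coefficients is multiplied by the
    unbounded \<open>x (n + a + 1)\<close>, whereas the other terms together stay within
    \<open>2 * D + B' * D\<close>.\<close>
  have s_eq: "s' (n + b + 2) = s (n + a + 2)" if n: "n \<ge> T2" for n
  proof (rule ccontr)
    assume ne: "s' (n + b + 2) \<noteq> s (n + a + 2)"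
    have xx: "x (n + a + 1) > 2 * D + B' * D" using T2 n by simp
    have "0 \<le> B' * D" using \<open>B' \<ge> 1\<close> D by simp
    then have x0: "0 \<le> x (n + a + 1)" using xx D by linarith
    have "real_of_int (s' (n + b + 2)) \<le> B'" "real_of_int (s' (n + b + 2)) \<ge> 0"
      using S'.s_le[of "n + b + 2"] S'.s_pos[of "n + b + 2"] aK by auto
    then have "\<bar>s' (n + b + 2) * e (n + 1)\<bar> \<le> B' * D" unfolding abs_mult using eb[of "n + 1"] by (intro mult_mono') auto
    then have "\<bar>(real_of_int (s' (n + b + 2)) - s (n + a + 2)) * x (n + a + 1)\<bar> \<le> 2 * D + B' * D"
      using e_rec[of n] eb[of n] eb[of "n + 2"] unfolding of_int_diff by linarith
    moreover have "1 * x (n + a + 1) \<le> \<bar>real_of_int (s' (n + b + 2)) - s (n + a + 2)\<bar> * x (n + a + 1)"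
      using ne x0 by (intro mult_right_mono) auto
    ultimately show False using xx x0 unfolding abs_mult mult_1_left by simp
  qed
  have e2: "e (n + T2 + 2) = s (n + T2 + a + 2) * e (n + T2 + 1) + e (n + T2)" for n
    using e_rec[of "n + T2"] s_eq[of "n + T2"] by simp
  have "(\<lambda>n. e (n + T2)) \<longlonglongrightarrow> 0"
  proof (rule bounded_linear_recurrence_tendsto_0)
    show "\<bar>e (n + T2)\<bar> \<le> D" for n using eb by simp
    show "1 \<le> s (n + T2 + a + 2)" for n using S.s_pos[of "n + T2 + a + 2"] aK by simp
    show "e (n + 2 + T2) = s (n + T2 + a + 2) * e (n + 1 + T2) + e (n + T2)" for n
      using e2[of n] by (simp add: ac_simps)
  qed
  then have lim: "(\<lambda>n. x' (n + (b + T2 + 1)) - x (n + (a + T2 + 1))) \<longlonglongrightarrow> 0"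
    using LIMSEQ_ignore_initial_segment[of "\<lambda>n. e (n + T2)" 0 1] by (simp add: e_def ac_simps)
  have ss: "s' (n + (b + T2 + 1) + 1) = s (n + (a + T2 + 1) + 1)" for n
    using s_eq[of "n + T2"] by (simp add: ac_simps)
  \<comment> \<open>If the first corner came more than \<open>2 * D + 1\<close> later, then at
    \<open>z\<close> the second staircase would have climbed \<open>2 * D + 1\<close> above its old
    height while the first had not yet left a height that differs from it by at most
    \<open>D\<close>.\<close>
  have u_close: "S.u (n + a) \<le> S'.u (n + b) + (2 * D + 1)" if "n \<ge> 1" "S'.u (n + b) \<ge> max Z (S.u K)" for n
  proof (rule ccontr)
    assume h: "\<not> S.u (n + a) \<le> S'.u (n + b) + (2 * D + 1)"
    define z where "z = S'.u (n + b) + (2 * D + 1)"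
    have b1: "n + b \<ge> K'" "n + a \<ge> K" using aK by auto
    have x1: "x' (n + b) - x' (n + b - 1) > 2 * D + 1"
    proof -
      have "n + b - 1 \<ge> T' + 1" "n + b - 1 + 1 = n + b" using b(1) that(1) by auto
      then show ?thesis using gap'[of "n + b - 1"] D by simp
    qed
    have "p' z = x' (n + b - 1) + z - S'.u (n + b)"
      by (rule S'.p_ramp[OF b1(1)]) (use x1 D in \<open>auto simp: z_def S'.f_def\<close>)
    then have "p' z = x' (n + b - 1) + (2 * D + 1)" by (simp add: z_def)
    moreover have "p z \<le> x (n + a - 1)" by (rule S.p_le[OF b1(2)]) (use h that D in \<open>auto simp: z_def\<close>)
    moreover have "\<bar>p z - p' z\<bar> \<le> D" by (rule cl) (use that D in \<open>auto simp: z_def\<close>)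
    moreover have "\<bar>x' (n + b - 1) - x (n + a - 1)\<bar> \<le> D" using match[of "n - 1"] that(1) by simp
    ultimately show False by linarith
  qed
  have u_close': "S'.u (n + b) \<le> S.u (n + a) + (2 * D + 1)" if "n \<ge> 1" "S.u (n + a) \<ge> max Z (S'.u K')" for n
  proof (rule ccontr)
    assume h: "\<not> S'.u (n + b) \<le> S.u (n + a) + (2 * D + 1)"
    define z where "z = S.u (n + a) + (2 * D + 1)"
    have b1: "n + b \<ge> K'" "n + a \<ge> K" using aK by auto
    have x1: "x (n + a) - x (n + a - 1) > 2 * D + 1"
    proof -
      have "n + a - 1 \<ge> T + 1" "n + a - 1 + 1 = n + a" using that(1) unfolding a_def by auto
      then show ?thesis using gap[of "n + a - 1"] D by simp
    qed
    have "p z = x (n + a - 1) + z - S.u (n + a)"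
      by (rule S.p_ramp[OF b1(2)]) (use x1 D in \<open>auto simp: z_def S.f_def\<close>)
    then have "p z = x (n + a - 1) + (2 * D + 1)" by (simp add: z_def)
    moreover have "p' z \<le> x' (n + b - 1)" by (rule S'.p_le[OF b1(1)]) (use h that D in \<open>auto simp: z_def\<close>)
    moreover have "\<bar>p z - p' z\<bar> \<le> D" by (rule cl) (use that D in \<open>auto simp: z_def\<close>)
    moreover have "\<bar>x' (n + b - 1) - x (n + a - 1)\<bar> \<le> D" using match[of "n - 1"] that(1) by simp
    ultimately show False by linarith
  qed
  have "\<delta>' = \<delta>"
  proof (rule ccontr)
    assume ne: "\<delta>' \<noteq> \<delta>"
    \<comment> \<open>The distance of the corners is at most 2D + 1, and it is (\<delta>' -
      \<delta>) X up to an error 4D. This is impossible for \<open>X > c\<close>.\<close>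
    define c where "c = (6 * D + 1) / \<bar>\<delta>' - \<delta>\<bar>"
    obtain A where A: "\<forall>k\<ge>A. x k > max (max c (max Z (S'.u K'))) (max Z (S.u K))" using S.x_eventually_gt by blast
    obtain A' where A': "\<forall>k\<ge>A'. x' k > max (max Z (S'.u K')) (max Z (S.u K))" using S'.x_eventually_gt by blast
    define n where "n = A + A' + 1"
    have xs: "x (n + a) > c" "x (n + a) > max Z (S'.u K')" using A unfolding n_def by auto
    have "x' (n + b) > max Z (S.u K)" using A' unfolding n_def by auto
    then have "S'.u (n + b) \<ge> max Z (S.u K)" "S.u (n + a) \<ge> max Z (S'.u K')"
      using S'.u_ge_x[of "n + b"] S.u_ge_x[of "n + a"] xs aK by auto
    then have uu: "\<bar>S.u (n + a) - S'.u (n + b)\<bar> \<le> 2 * D + 1"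
      using u_close[of n] u_close'[of n] unfolding n_def by (simp add: abs_le_iff)
    define X where "X = x (n + a) + x (n + a - 1)"
    define X' where "X' = x' (n + b) + x' (n + b - 1)"
    have XX: "\<bar>X' - X\<bar> \<le> 2 * D" using match[of n] match[of "n - 1"] unfolding X_def X'_def n_def by simp
    have "S.u (n + a) - S'.u (n + b) = (\<delta>' - \<delta>) * X - (2 - \<delta>') * (X' - X)"
      unfolding S.u_def S'.u_def X_def[symmetric] X'_def[symmetric] by (simp add: algebra_simps)
    moreover have "\<bar>(2 - \<delta>') * (X' - X)\<bar> \<le> 2 * (2 * D)"
      unfolding abs_mult by (rule mult_mono') (use XX S'.\<delta> in auto)
    ultimately have "\<bar>(\<delta>' - \<delta>) * X\<bar> \<le> 6 * D + 1" using uu by linarith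
    moreover have "X > c" using xs(1) S.x_pos(2)[of "n + a"] aK unfolding X_def by simp
    then have "\<bar>\<delta>' - \<delta>\<bar> * c < \<bar>\<delta>' - \<delta>\<bar> * X" using ne by simp
    moreover have "\<bar>\<delta>' - \<delta>\<bar> * c = 6 * D + 1" using ne by (simp add: c_def)
    moreover have "c \<ge> 0" using D by (simp add: c_def)
    ultimately show False using \<open>X > c\<close> by (simp add: abs_mult)
  qed
  then show ?thesis using lim ss by blast
qed

section \<open>Integer points from a Sturmian sequence\<close>

lemma bigtheta_ln_bounded:
  fixes f g :: "nat \<Rightarrow> real"
  assumes "f \<in> \<Theta>(g)" "\<And>k. f k > 0" "\<And>k. g k > 0"
  shows "\<exists>T\<ge>0. \<forall>\<^sub>F k in sequentially. \<bar>ln (f k) - ln (g k)\<bar> \<le> T"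
proof -
  have "f \<in> O(g)" "g \<in> O(f)" using assms(1) by (auto simp: bigtheta_def bigomega_iff_bigo)
  then obtain c d where c: "c > 0" "\<forall>\<^sub>F k in sequentially. norm (f k) \<le> c * norm (g k)"
    and d: "d > 0" "\<forall>\<^sub>F k in sequentially. norm (g k) \<le> d * norm (f k)"
    by (elim landau_o.bigE) blast
  have "\<forall>\<^sub>F k in sequentially. \<bar>ln (f k) - ln (g k)\<bar> \<le> max \<bar>ln c\<bar> \<bar>ln d\<bar>"
    using c(2) d(2)
  proof eventually_elim
    case (elim k)
    have p: "f k > 0" "g k > 0" using assms by auto
    have "ln (f k) \<le> ln (c * g k)" using elim p c(1) by (subst ln_le_cancel_iff) auto
    moreover have "ln (g k) \<le> ln (d * f k)" using elim p d(1) by (subst ln_le_cancel_iff) auto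
    moreover have "ln (c * g k) = ln c + ln (g k)" "ln (d * f k) = ln d + ln (f k)"
      using p c(1) d(1) by (simp_all add: ln_mult)
    ultimately show ?case by linarith
  qed
  then show ?thesis by (intro exI[of _ "max \<bar>ln c\<bar> \<bar>ln d\<bar>"]) auto
qed

text \<open>The conditions |y_2 - v_2 y_1| < \<epsilon> |y_1| and |y_3 - v_3 y_1| < \<epsilon> |y_1|
  define an open set that is stable under non-zero scaling, avoids the origin and contains
  \<open>v\<close>; such sets test convergence in the projective plane.\<close>

lemma proj_tendsto_coordinates:
  assumes P: "proj_tendsto p v" and v: "v $ 1 = 1"
  shows "\<forall>\<^sub>F n in sequentially. p n $ 1 \<noteq> 0"
    "(\<lambda>n. p n $ 2 / p n $ 1) \<longlonglongrightarrow> v $ 2" "(\<lambda>n. p n $ 3 / p n $ 1) \<longlonglongrightarrow> v $ 3"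
proof -
  have ev: "\<forall>\<^sub>F n in sequentially. \<bar>p n $ 2 - v $ 2 * p n $ 1\<bar> < \<epsilon> * \<bar>p n $ 1\<bar> \<and> \<bar>p n $ 3 - v $ 3 * p n $ 1\<bar> < \<epsilon> * \<bar>p n $ 1\<bar>"
    if "\<epsilon> > 0" for \<epsilon>
  proof -
    define U where "U = {y :: real^3. \<bar>y $ 2 - v $ 2 * y $ 1\<bar> < \<epsilon> * \<bar>y $ 1\<bar>} \<inter> {y. \<bar>y $ 3 - v $ 3 * y $ 1\<bar> < \<epsilon> * \<bar>y $ 1\<bar>}"
    have "open U" unfolding U_def by (intro open_Int open_Collect_less continuous_intros)
    moreover have "0 \<notin> U" by (simp add: U_def)
    moreover have "c *\<^sub>R y \<in> U" if "y \<in> U" "c \<noteq> 0" for y c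
    proof -
      have 1: "c *\<^sub>R y $ 2 - v $ 2 * (c *\<^sub>R y $ 1) = c * (y $ 2 - v $ 2 * y $ 1)"
        "c *\<^sub>R y $ 3 - v $ 3 * (c *\<^sub>R y $ 1) = c * (y $ 3 - v $ 3 * y $ 1)" by (simp_all add: algebra_simps)
      show ?thesis using that unfolding U_def by (simp add: 1[simplified] abs_mult mult.left_commute[of \<epsilon>])
    qed
    moreover have "v \<in> U" using v \<open>\<epsilon> > 0\<close> by (simp add: U_def)
    ultimately have "\<forall>\<^sub>F n in sequentially. p n \<in> U" using P unfolding proj_tendsto_def by blast
    then show ?thesis by eventually_elim (auto simp: U_def)
  qed
  show nz: "\<forall>\<^sub>F n in sequentially. p n $ 1 \<noteq> 0" using ev[of 1] by (rule eventually_mono) auto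
  have "(\<lambda>n. p n $ j / p n $ 1) \<longlonglongrightarrow> v $ j" if "j = 2 \<or> j = 3" for j
  proof (rule tendstoI)
    fix \<epsilon> :: real assume "\<epsilon> > 0"
    show "\<forall>\<^sub>F n in sequentially. dist (p n $ j / p n $ 1) (v $ j) < \<epsilon>"
      using ev[OF \<open>\<epsilon> > 0\<close>] nz
    proof eventually_elim
      case (elim n)
      then have "\<bar>p n $ j - v $ j * p n $ 1\<bar> / \<bar>p n $ 1\<bar> < \<epsilon>" using that by (subst pos_divide_less_eq) auto
      moreover have "p n $ j / p n $ 1 - v $ j = (p n $ j - v $ j * p n $ 1) / p n $ 1" using elim by (simp add: field_simps)
      ultimately show ?case by (simp add: dist_real_def)
    qed
  qed
  then show "(\<lambda>n. p n $ 2 / p n $ 1) \<longlonglongrightarrow> v $ 2" "(\<lambda>n. p n $ 3 / p n $ 1) \<longlonglongrightarrow> v $ 3" by auto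
qed

locale sturmian_matrices = sturm_weights s W \<delta> for s :: "nat \<Rightarrow> int" and W :: "nat \<Rightarrow> real" and \<delta> :: real +
  fixes w :: "nat \<Rightarrow> int^2^2" and N :: "int^2^2" and \<xi> :: real and B C :: int
  assumes s_le: "s k \<le> B"
    and sturmian: "sturmian s w" and admissible: "admissible_with w N" and growth: "multiplicative_growth s w"
    and N_not_sym: "\<not> symmetric N"
    and det_theta: "(\<lambda>i. \<bar>real_of_int (det (w i))\<bar>) \<in> \<Theta>(\<lambda>i. mnorm (w i) powr \<delta>)"
    and content_le: "i \<ge> -2 \<Longrightarrow> content (sturm_y s w N i) \<le> C"
    and proj: "proj_tendsto (\<lambda>n. point (sturm_y s w N (int n))) (vector [1, \<xi>, \<xi>^2])"
    and W_theta: "W \<in> \<Theta>(\<lambda>k. mnorm (w k))"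
    and W_lim: "filterlim W at_top sequentially"
begin

definition "Nk k = (if even k then N else transpose N)"
text \<open>\<open>X k (l + 1)\<close> is y_i for i = t_k + l. The exponent 0 is allowed because it
  enters the second normal when \<open>l = 0\<close>.\<close>

definition "X k n = mpow (w k) n ** w (k - 1) ** Nk k"
definition "u = (vector [1, \<xi>, \<xi>^2] :: real^3)"

lemma u_simps: "u $ 1 = 1" "u $ 2 = \<xi>" "u $ 3 = \<xi>\<^sup>2" by (simp_all add: u_def)

lemma det_w: "det (w k) \<noteq> 0" and w_rec: "k \<ge> 1 \<Longrightarrow> w (k + 1) = mpow (w k) (nat (s (k + 1))) ** w (k - 1)"
  using sturmian by (auto simp: sturmian_def)

lemma det_N: "det N \<noteq> 0" using admissible by (simp add: admissible_with_def)

lemma Nk_Suc: "Nk (Suc k) = transpose (Nk k)" by (simp add: Nk_def transpose_transpose)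

lemma det_Nk: "det (Nk k) = det N" by (simp add: Nk_def det_transpose)

lemma mnorm_Nk: "mnorm (Nk k) = mnorm N" by (simp add: Nk_def mnorm_transpose)

lemma Nk_not_sym: "\<not> symmetric (Nk k)"
  using N_not_sym unfolding Nk_def symmetric_def by (metis transpose_transpose)

lemma det_X: "det (X k n) = det (w k) ^ n * det (w (k - 1)) * det N"
  by (simp add: X_def det_mul det_mpow det_Nk)

lemma det_X_nonzero: "det (X k n) \<noteq> 0"
  unfolding det_X using det_w det_N by simp

lemma X_Suc: "X k (Suc n) = w k ** X k n"
  by (simp add: X_def matrix_mul_assoc)

lemma symmetric_triple:
  assumes "k \<ge> 1"
  shows "symmetric (w k ** transpose (Nk k)) \<and> symmetric (w (k - 1) ** Nk k) \<and> symmetric (w k ** w (k - 1) ** Nk k)"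
  using assms
proof (induction k rule: dec_induct)
  case base
  then show ?case using admissible by (simp add: admissible_with_def Nk_def transpose_transpose)
next
  case (step k)
  then have IH: "symmetric (w k ** transpose (Nk k))" "symmetric (w (k - 1) ** Nk k)" "symmetric (w k ** w (k - 1) ** Nk k)"
    by auto
  have "w (Suc k) = mpow (w k) (nat (s (k + 1))) ** w (k - 1)" using w_rec[of k] step by simp
  then show ?case using symmetric_next[OF IH, of "nat (s (k + 1))"] IH(1)
    by (simp add: Nk_Suc transpose_transpose)
qed

lemma X_symmetric: "k \<ge> 1 \<Longrightarrow> symmetric (X k n)"
  using symmetric_mpow_mult[of "w (k - 1) ** Nk k" "w k" n] symmetric_triple[of k]
  unfolding X_def by (simp add: matrix_mul_assoc)

lemma X_next:
  assumes "k \<ge> 1"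
  shows "X (k + 1) 1 = X k (nat (s (k + 1)) + 1)"
proof -
  note T = symmetric_triple[OF assms]
  show ?thesis
    using symmetric_next(3)[of "w k" "Nk k" "w (k - 1)" "nat (s (k + 1))"] T w_rec[OF assms]
    by (simp add: X_def Nk_Suc)
qed

lemma sturm_y_eq:
  assumes "int l < s (k + 1)" "k \<ge> 1"
  shows "sturm_y s w N (tt s k + int l) = X k (l + 1)"
proof -
  have "tt s k \<ge> 0" using tt_le[of 1 k] tt_1 assms by simp
  then show ?thesis unfolding sturm_y_def Let_def X_def Nk_def using level_offset[OF assms(1)] by simp
qed

text \<open>The successor of y_i is \<open>w k\<close> times y_i even if it belongs to the next
  level, so the wedge identities apply to all consecutive points.\<close>

lemma sturm_y_Suc:
  assumes "int l < s (k + 1)" "k \<ge> 1"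
  shows "sturm_y s w N (tt s k + int l + 1) = X k (l + 2)"
proof (cases "int (l + 1) < s (k + 1)")
  case True
  then show ?thesis using sturm_y_eq[of "l + 1" k] assms by (simp add: ac_simps)
next
  case False
  then have l: "l + 1 = nat (s (k + 1))" using assms(1) by simp
  have e: "tt s k + int l + 1 = tt s (k + 1) + int 0" using l assms(1) by (simp add: tt_Suc)
  have "int 0 < s (k + 1 + 1)" using s_pos[of "k + 1 + 1"] by simp
  then show ?thesis unfolding e using sturm_y_eq[of 0 "k + 1"] X_next[OF assms(2)] l by simp
qed

lemma mnorm_w_pos: "mnorm (w k) > 0"
  using mnorm_ge_1[OF det_w] by (meson less_le_trans zero_less_one)

lemma mnorm_X_pos: "mnorm (X k n) > 0"
  using mnorm_ge_1[OF det_X_nonzero] by (meson less_le_trans zero_less_one)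

definition "ell k l = l * x k + x (k - 1)" for l :: nat

text \<open>Multiplicative growth costs a constant per factor. The error grows with
  \<open>l\<close>, which stays bounded because the s_k are.\<close>

lemma ln_mnorm_product:
  "\<exists>G\<ge>0. \<forall>k\<ge>1. \<forall>l. int l \<le> s (k + 1) + 1 \<longrightarrow>
     \<bar>ln (mnorm (mpow (w k) l ** w (k - 1))) - (l * ln (mnorm (w k)) + ln (mnorm (w (k - 1))))\<bar> \<le> l * G"
proof -
  obtain c1 c2 where c: "c1 > 0" "c2 > 0" and
    g: "\<And>k l. k \<ge> 1 \<Longrightarrow> l \<ge> 1 \<Longrightarrow> int l \<le> s (k + 1) + 1 \<Longrightarrow>
     c1 * mnorm (w k) * mnorm (mpow (w k) (l - 1) ** w (k - 1)) \<le> mnorm (mpow (w k) l ** w (k - 1)) \<and>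
     mnorm (mpow (w k) l ** w (k - 1)) \<le> c2 * mnorm (w k) * mnorm (mpow (w k) (l - 1) ** w (k - 1))"
    using growth unfolding multiplicative_growth_def by blast
  define G where "G = max \<bar>ln c1\<bar> \<bar>ln c2\<bar>"
  have pos: "mnorm (mpow (w k) l ** w (k - 1)) > 0" for k l
  proof -
    have "det (mpow (w k) l ** w (k - 1)) \<noteq> 0" using det_w by (simp add: det_mul det_mpow)
    from mnorm_ge_1[OF this] show ?thesis by linarith
  qed
  have "\<bar>ln (mnorm (mpow (w k) l ** w (k - 1))) - (l * ln (mnorm (w k)) + ln (mnorm (w (k - 1))))\<bar> \<le> l * G"
    if k: "k \<ge> 1" and "int l \<le> s (k + 1) + 1" for k l
    using that(2)
  proof (induction l)
    case (Suc l)
    define m where "m = mnorm (mpow (w k) (Suc l) ** w (k - 1))"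
    define m' where "m' = mnorm (mpow (w k) l ** w (k - 1))"
    have p: "m > 0" "m' > 0" "mnorm (w k) > 0" unfolding m_def m'_def by (rule pos mnorm_w_pos)+
    have gg: "c1 * mnorm (w k) * m' \<le> m" "m \<le> c2 * mnorm (w k) * m'"
      using g[OF k, of "Suc l"] Suc.prems unfolding m_def m'_def by auto
    have "ln (c1 * mnorm (w k) * m') \<le> ln m" using gg p c by (subst ln_le_cancel_iff) auto
    moreover have "ln m \<le> ln (c2 * mnorm (w k) * m')" using gg p c by (subst ln_le_cancel_iff) auto
    moreover have "ln (c1 * mnorm (w k) * m') = ln c1 + ln (mnorm (w k)) + ln m'"
      "ln (c2 * mnorm (w k) * m') = ln c2 + ln (mnorm (w k)) + ln m'" using p c by (simp_all add: ln_mult)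
    moreover have "\<bar>ln c1\<bar> \<le> G" "\<bar>ln c2\<bar> \<le> G" by (simp_all add: G_def)
    ultimately have "\<bar>ln m - (ln (mnorm (w k)) + ln m')\<bar> \<le> G" by linarith
    moreover have "\<bar>ln m' - (l * ln (mnorm (w k)) + ln (mnorm (w (k - 1))))\<bar> \<le> l * G"
      using Suc unfolding m'_def by simp
    moreover have "real (Suc l) * G = l * G + G" "real (Suc l) * ln (mnorm (w k)) = l * ln (mnorm (w k)) + ln (mnorm (w k))"
      by (simp_all add: algebra_simps)
    ultimately show ?case unfolding m_def[symmetric] by linarith
  qed simp
  moreover have "G \<ge> 0" by (simp add: G_def)
  ultimately show ?thesis by blast
qed

definition sizes_within :: "real \<Rightarrow> nat \<Rightarrow> nat \<Rightarrow> bool" where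
  "sizes_within E k l \<longleftrightarrow>
     \<bar>ln (mnorm (X k l)) - ell k l\<bar> \<le> E \<and> \<bar>ln (mnorm (w k)) - x k\<bar> \<le> E \<and>
     \<bar>ln \<bar>real_of_int (det (X k l))\<bar> - \<delta> * ell k l\<bar> \<le> E"

lemma ln_mnorm_X:
  "\<exists>E\<ge>0. \<forall>\<^sub>F k in sequentially. \<forall>l. int l \<le> s (k + 1) + 1 \<longrightarrow> sizes_within E k l"
proof -
  obtain G where G: "G \<ge> 0" "\<And>k l. k \<ge> 1 \<Longrightarrow> int l \<le> s (k + 1) + 1 \<Longrightarrow>
     \<bar>ln (mnorm (mpow (w k) l ** w (k - 1))) - (l * ln (mnorm (w k)) + ln (mnorm (w (k - 1))))\<bar> \<le> l * G"
    using ln_mnorm_product by blast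
  obtain T where T: "T \<ge> 0" "\<forall>\<^sub>F k in sequentially. \<bar>ln (W k) - ln (mnorm (w k))\<bar> \<le> T"
    using bigtheta_ln_bounded[OF W_theta W_pos mnorm_w_pos] by blast
  have dp: "\<bar>real_of_int (det (w k))\<bar> > 0" for k using det_w by simp
  have pp: "mnorm (w k) powr \<delta> > 0" for k using mnorm_w_pos[of k] by simp
  obtain D where D: "D \<ge> 0" "\<forall>\<^sub>F k in sequentially. \<bar>ln \<bar>real_of_int (det (w k))\<bar> - ln (mnorm (w k) powr \<delta>)\<bar> \<le> D"
    using bigtheta_ln_bounded[OF det_theta dp pp] by blast
  obtain K where K: "\<And>k. k \<ge> K \<Longrightarrow> \<bar>ln (W k) - ln (mnorm (w k))\<bar> \<le> T"
    "\<And>k. k \<ge> K \<Longrightarrow> \<bar>ln \<bar>real_of_int (det (w k))\<bar> - ln (mnorm (w k) powr \<delta>)\<bar> \<le> D"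
    using eventually_conj[OF T(2) D(2)] unfolding eventually_sequentially by blast
  \<comment> \<open>\<open>\<nu>\<close> and \<open>\<mu>\<close> account for the factor
    \<open>N\<close>, \<open>T\<close> for passing from norms to weights, \<open>D\<close> for the
    determinants, and \<open>R\<close> bounds the number of factors.\<close>
  define \<nu> where "\<nu> = \<bar>ln (2 * mnorm N)\<bar>"
  define \<mu> where "\<mu> = \<bar>ln \<bar>real_of_int (det N)\<bar>\<bar>"
  define R where "R = real_of_int B + 2"
  have B1: "B \<ge> 1" using s_le[of 1] s_pos[of 1] by simp
  define E where "E = \<nu> + \<mu> + T + D + R * (G + T + D)"
  have nn: "0 \<le> \<nu>" "0 \<le> \<mu>" "0 \<le> R * (G + T + D)" using G T D B1 unfolding \<nu>_def \<mu>_def R_def by auto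
  have Nm: "mnorm N \<ge> 1" using mnorm_ge_1 det_N by blast
  have main: "\<bar>ln (mnorm (X k l)) - ell k l\<bar> \<le> E \<and> \<bar>ln (mnorm (w k)) - x k\<bar> \<le> E \<and>
     \<bar>ln \<bar>real_of_int (det (X k l))\<bar> - \<delta> * ell k l\<bar> \<le> E"
    if k: "k \<ge> K + 1" and l: "int l \<le> s (k + 1) + 1" for k l
  proof -
    have k1: "k \<ge> 1" "k \<ge> K" "k - 1 \<ge> K" using k by auto
    have lB: "real l + 1 \<le> R" using l s_le[of "k + 1"] unfolding R_def by linarith
    define P where "P = mpow (w k) l ** w (k - 1)"
    have XP: "X k l = P ** Nk k" by (simp add: X_def P_def)
    have "det P \<noteq> 0" unfolding P_def using det_w by (simp add: det_mul det_mpow)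
    then have Pp: "mnorm P \<ge> 1" by (rule mnorm_ge_1)
    have Xp: "mnorm (X k l) > 0" by (rule mnorm_X_pos)
    have w1: "\<bar>ln (mnorm (w k)) - x k\<bar> \<le> T" "\<bar>ln (mnorm (w (k - 1))) - x (k - 1)\<bar> \<le> T"
      using K(1)[OF k1(2)] K(1)[OF k1(3)] unfolding x_def by linarith+
    have dN: "det (Nk k) \<noteq> 0" unfolding det_Nk by (rule det_N)
    have "ln (mnorm (X k l)) \<le> ln (mnorm P * (2 * mnorm N))"
      using mnorm_mult[of P "Nk k"] Pp Nm Xp unfolding XP mnorm_Nk by (subst ln_le_cancel_iff) (auto simp: ac_simps)
    moreover have "ln (mnorm P) \<le> ln (mnorm (X k l) * (2 * mnorm N))"
      using mnorm_mult_ge[OF dN, of P] Pp Nm Xp unfolding XP mnorm_Nk by (subst ln_le_cancel_iff) (auto simp: ac_simps)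
    moreover have "ln (mnorm P * (2 * mnorm N)) = ln (mnorm P) + ln (2 * mnorm N)"
      using Pp Nm by (intro ln_mult_pos) auto
    moreover have "ln (mnorm (X k l) * (2 * mnorm N)) = ln (mnorm (X k l)) + ln (2 * mnorm N)"
      using Xp Nm by (intro ln_mult_pos) auto
    ultimately have XPn: "\<bar>ln (mnorm (X k l)) - ln (mnorm P)\<bar> \<le> \<nu>" unfolding \<nu>_def by linarith
    have lT: "\<bar>l * ln (mnorm (w k)) - l * x k\<bar> \<le> l * T"
      using mult_left_mono[OF w1(1), of "real l"] by (simp add: abs_mult flip: right_diff_distrib)
    have RR: "l * G + l * T \<le> R * (G + T + D)" "l * (D + T) + (D + T) \<le> R * (G + T + D)"
    proof -
      have "l * (G + T) \<le> R * (G + T + D)" using lB G T D by (intro mult_mono) auto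
      then show "l * G + l * T \<le> R * (G + T + D)" by (simp add: distrib_left)
      have "(l + 1) * (D + T) \<le> R * (G + T + D)" using lB G T D by (intro mult_mono) auto
      then show "l * (D + T) + (D + T) \<le> R * (G + T + D)" by (simp add: distrib_right)
    qed
    have "\<bar>ln (mnorm P) - (l * ln (mnorm (w k)) + ln (mnorm (w (k - 1))))\<bar> \<le> l * G"
      using G(2)[OF k1(1) l] by (simp add: P_def)
    then have a: "\<bar>ln (mnorm (X k l)) - ell k l\<bar> \<le> E"
      unfolding ell_def E_def using XPn lT w1(2) RR(1) nn T(1) D(1) by linarith
    have b: "\<bar>ln (mnorm (w k)) - x k\<bar> \<le> E" unfolding E_def using w1(1) nn T(1) D(1) by linarith
    define dk where "dk j = ln \<bar>real_of_int (det (w j))\<bar>" for j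
    have dd: "\<bar>dk j - \<delta> * x j\<bar> \<le> D + T" if "j \<ge> K" for j
    proof -
      have 1: "\<bar>dk j - \<delta> * ln (mnorm (w j))\<bar> \<le> D"
        using K(2)[OF that] mnorm_w_pos[of j] unfolding dk_def by (simp add: ln_powr)
      have "\<bar>\<delta>\<bar> * \<bar>ln (mnorm (w j)) - x j\<bar> \<le> 1 * T"
        using K(1)[OF that] \<delta>0 \<delta>1 unfolding x_def by (intro mult_mono) (auto simp: abs_minus_commute)
      then have "\<bar>\<delta> * ln (mnorm (w j)) - \<delta> * x j\<bar> \<le> T" by (simp flip: abs_mult right_diff_distrib)
      with 1 show ?thesis by linarith
    qed
    have "ln \<bar>real_of_int (det (X k l))\<bar> = l * dk k + dk (k - 1) + ln \<bar>real_of_int (det N)\<bar>"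
      unfolding det_X dk_def using det_w[of k] det_w[of "k - 1"] det_N
      by (simp add: abs_mult power_abs ln_mult ln_realpow)
    moreover have "\<bar>l * dk k - l * (\<delta> * x k)\<bar> \<le> l * (D + T)"
      using mult_left_mono[OF dd[OF k1(2)], of "real l"] by (simp add: abs_mult flip: right_diff_distrib)
    moreover have "\<delta> * ell k l = l * (\<delta> * x k) + \<delta> * x (k - 1)" by (simp add: ell_def algebra_simps)
    moreover have "\<bar>ln \<bar>real_of_int (det N)\<bar>\<bar> = \<mu>" by (simp add: \<mu>_def)
    ultimately have c: "\<bar>ln \<bar>real_of_int (det (X k l))\<bar> - \<delta> * ell k l\<bar> \<le> E"
      unfolding E_def using dd[OF k1(3)] RR(2) nn T(1) D(1) by linarith
    show ?thesis using a b c by blast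
  qed
  have "E \<ge> 0" unfolding E_def using nn T(1) D(1) by simp
  then show ?thesis using main unfolding sizes_within_def eventually_sequentially by blast
qed

lemma ell_Suc: "ell k (Suc l) = ell k l + x k"
  by (simp add: ell_def algebra_simps)

lemma x_tendsto: "filterlim x at_top sequentially"
  unfolding x_def by (rule filterlim_compose[OF ln_at_top W_lim])

definition yy :: "nat \<Rightarrow> int^2^2" where "yy n = sturm_y s w N (int n)"
definition slope2 :: "nat \<Rightarrow> real" where "slope2 n = of_int (yy n $ 1 $ 2) / of_int (yy n $ 1 $ 1)"
definition slope3 :: "nat \<Rightarrow> real" where "slope3 n = of_int (yy n $ 2 $ 2) / of_int (yy n $ 1 $ 1)"

lemma slopes: "\<forall>\<^sub>F n in sequentially. yy n $ 1 $ 1 \<noteq> 0" "slope2 \<longlonglongrightarrow> \<xi>" "slope3 \<longlonglongrightarrow> \<xi>\<^sup>2"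
  using proj_tendsto_coordinates[OF proj] unfolding point_sel yy_def[symmetric] slope2_def slope3_def by simp_all

lemma mnorm_yy_le: "yy n $ 1 $ 1 \<noteq> 0 \<Longrightarrow> symmetric (yy n) \<Longrightarrow> mnorm (yy n) \<le> (1 + \<bar>slope2 n\<bar> + \<bar>slope3 n\<bar>) * \<bar>real_of_int (yy n $ 1 $ 1)\<bar>"
  unfolding mnorm_le_iff
proof (intro allI)
  fix i j :: 2
  assume nz: "yy n $ 1 $ 1 \<noteq> 0" and sy: "symmetric (yy n)"
  define a where "a = \<bar>real_of_int (yy n $ 1 $ 1)\<bar>"
  have 2: "\<bar>real_of_int (yy n $ 1 $ 2)\<bar> = \<bar>slope2 n\<bar> * a" "\<bar>real_of_int (yy n $ 2 $ 2)\<bar> = \<bar>slope3 n\<bar> * a"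
    using nz by (simp_all add: slope2_def slope3_def a_def)
  have "real_of_int \<bar>yy n $ i $ j\<bar> \<in> {a, \<bar>slope2 n\<bar> * a, \<bar>slope3 n\<bar> * a}"
    using exhaust_2[of i] exhaust_2[of j] sy 2 unfolding symmetric_iff a_def by auto
  moreover have "0 \<le> a" "0 \<le> \<bar>slope2 n\<bar> * a" "0 \<le> \<bar>slope3 n\<bar> * a" by (simp_all add: a_def)
  ultimately have "real_of_int \<bar>yy n $ i $ j\<bar> \<le> a + \<bar>slope2 n\<bar> * a + \<bar>slope3 n\<bar> * a" by auto
  then show "real_of_int \<bar>yy n $ i $ j\<bar> \<le> (1 + \<bar>slope2 n\<bar> + \<bar>slope3 n\<bar>) * \<bar>real_of_int (yy n $ 1 $ 1)\<bar>"
    unfolding a_def[symmetric] by (simp add: algebra_simps)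
qed

text \<open>Consecutive slopes differ by \<open>det Y\<close> times entries of \<open>w k\<close>,
  divided by the product of the two leading entries: with e = eta_n and x = x k this is of order
  exp(\<delta> e + x) / exp(2 e + x). The bounds are at least halved at each step, so they also
  control the distance to the limit.\<close>

lemma slope_rate:
  "\<exists>\<kappa>>0. \<forall>\<^sub>F n in sequentially. \<bar>slope2 n - \<xi>\<bar> \<le> \<kappa> * exp ((\<delta> - 2) * eta (int n)) \<and>
     \<bar>slope3 n - \<xi>\<^sup>2\<bar> \<le> \<kappa> * exp ((\<delta> - 2) * eta (int n))"
proof -
  obtain E where E: "E \<ge> 0" "\<forall>\<^sub>F k in sequentially. \<forall>l. int l \<le> s (k + 1) + 1 \<longrightarrow> sizes_within E k l" using ln_mnorm_X by blast
  then obtain K where K: "\<And>k l. k \<ge> K \<Longrightarrow> int l \<le> s (k + 1) + 1 \<Longrightarrow>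
     sizes_within E k l"
    unfolding eventually_sequentially by blast
  obtain K1 where K1: "\<And>k. k \<ge> K1 \<Longrightarrow> x k \<ge> 1"
    using x_tendsto unfolding filterlim_at_top eventually_sequentially by blast
  \<comment> \<open>Eventually the slopes are within 1 of their limits, so the norm of a point is at
    most \<open>c0\<close> times its leading entry in absolute value.\<close>
  define c0 where "c0 = 3 + \<bar>\<xi>\<bar> + \<xi>\<^sup>2"
  have c0: "c0 > 0" unfolding c0_def by (simp add: add_pos_nonneg)
  have "\<forall>\<^sub>F n in sequentially. \<bar>slope2 n - \<xi>\<bar> < 1" "\<forall>\<^sub>F n in sequentially. \<bar>slope3 n - \<xi>\<^sup>2\<bar> < 1"
    using tendstoD[OF slopes(2), of 1] tendstoD[OF slopes(3), of 1] by (simp_all add: dist_real_def)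
  then have "\<forall>\<^sub>F n in sequentially. yy n $ 1 $ 1 \<noteq> 0 \<and> 1 + \<bar>slope2 n\<bar> + \<bar>slope3 n\<bar> \<le> c0"
    using slopes(1)
  proof eventually_elim
    case (elim n)
    have "\<bar>\<xi>\<^sup>2\<bar> = \<xi>\<^sup>2" by simp
    then show ?case using elim unfolding c0_def by linarith
  qed
  then obtain n1 where n1: "\<And>n. n \<ge> n1 \<Longrightarrow> yy n $ 1 $ 1 \<noteq> 0 \<and> 1 + \<bar>slope2 n\<bar> + \<bar>slope3 n\<bar> \<le> c0"
    unfolding eventually_sequentially by blast
  define K' where "K' = max (max K K1) 1"
  define n0 where "n0 = max n1 (nat (tt s K'))"
  have idx: "\<exists>k l. k \<ge> K' \<and> int n = tt s k + int l \<and> int l < s (k + 1)" if "n \<ge> n0" for n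
  proof -
    have "nat (tt s K') \<le> n" using that unfolding n0_def by simp
    then have "int n \<ge> tt s K'" by (rule nat_le_iff[THEN iffD1])
    then show ?thesis using index_cases[of K' "int n"] by metis
  qed
  \<comment> \<open>\<open>c0\<^sup>2\<close> comes from two comparisons of norm and leading entry,
    2 from the wedge, \<open>exp (4 * E)\<close> from four size estimates.\<close>
  define \<kappa> where "\<kappa> = c0\<^sup>2 * 2 * exp (4 * E)"
  have \<kappa>: "\<kappa> > 0" using c0 by (simp add: \<kappa>_def)
  define D where "D n = \<kappa> * exp ((\<delta> - 2) * eta (int n))" for n
  have step: "\<bar>slope2 (Suc n) - slope2 n\<bar> \<le> D n \<and> \<bar>slope3 (Suc n) - slope3 n\<bar> \<le> D n \<and> D (Suc n) \<le> D n / 2"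
    if n: "n \<ge> n0" for n
  proof -
    obtain k l where kl: "k \<ge> K'" "int n = tt s k + int l" "int l < s (k + 1)" using idx[OF n] by blast
    have k1: "k \<ge> 1" "k \<ge> K" "k \<ge> K1" using kl(1) by (auto simp: K'_def)
    define Y where "Y = X k (l + 1)"
    define Y' where "Y' = X k (l + 2)"
    have yY: "yy n = Y" unfolding yy_def Y_def kl(2) by (rule sturm_y_eq[OF kl(3) k1(1)])
    have yY': "yy (Suc n) = Y'"
    proof -
      have "int (Suc n) = tt s k + int l + 1" using kl(2) by simp
      then show ?thesis unfolding yy_def Y'_def by (simp only: sturm_y_Suc[OF kl(3) k1(1)])
    qed
    have YY: "Y' = w k ** Y" unfolding Y'_def Y_def using X_Suc[of k "l + 1"] by simp
    have sy: "symmetric Y" "symmetric Y'" unfolding Y_def Y'_def using X_symmetric[OF k1(1)] by blast+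
    have e: "eta (int n) = ell k (l + 1)" unfolding kl(2) ell_def using eta_level[OF kl(3) k1(1)] by simp
    define a where "a = real_of_int (Y $ 1 $ 1)"
    define a' where "a' = real_of_int (Y' $ 1 $ 1)"
    have a: "a \<noteq> 0" "mnorm Y \<le> c0 * \<bar>a\<bar>"
    proof -
      have *: "yy n $ 1 $ 1 \<noteq> 0" "1 + \<bar>slope2 n\<bar> + \<bar>slope3 n\<bar> \<le> c0" using n1[of n] n unfolding n0_def by auto
      then show "a \<noteq> 0" unfolding a_def yY by simp
      have "mnorm (yy n) \<le> (1 + \<bar>slope2 n\<bar> + \<bar>slope3 n\<bar>) * \<bar>real_of_int (yy n $ 1 $ 1)\<bar>" by (rule mnorm_yy_le) (use * sy yY in auto)
      also have "\<dots> \<le> c0 * \<bar>real_of_int (yy n $ 1 $ 1)\<bar>" using * by (intro mult_right_mono) auto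
      finally show "mnorm Y \<le> c0 * \<bar>a\<bar>" unfolding yY a_def .
    qed
    have a': "a' \<noteq> 0" "mnorm Y' \<le> c0 * \<bar>a'\<bar>"
    proof -
      have *: "yy (Suc n) $ 1 $ 1 \<noteq> 0" "1 + \<bar>slope2 (Suc n)\<bar> + \<bar>slope3 (Suc n)\<bar> \<le> c0" using n1[of "Suc n"] n unfolding n0_def by auto
      then show "a' \<noteq> 0" unfolding a'_def yY' by simp
      have "mnorm (yy (Suc n)) \<le> (1 + \<bar>slope2 (Suc n)\<bar> + \<bar>slope3 (Suc n)\<bar>) * \<bar>real_of_int (yy (Suc n) $ 1 $ 1)\<bar>"
        by (rule mnorm_yy_le) (use * sy yY' in auto)
      also have "\<dots> \<le> c0 * \<bar>real_of_int (yy (Suc n) $ 1 $ 1)\<bar>" using * by (intro mult_right_mono) auto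
      finally show "mnorm Y' \<le> c0 * \<bar>a'\<bar>" unfolding yY' a'_def .
    qed
    have l1: "int (l + 1) \<le> s (k + 1) + 1" "int (l + 2) \<le> s (k + 1) + 1" using kl(3) by auto
    have lnb: "ln (mnorm Y) \<ge> ell k (l + 1) - E" "ln (mnorm Y') \<ge> ell k (l + 1) + x k - E"
      "ln (mnorm (w k)) \<le> x k + E" "ln \<bar>real_of_int (det Y)\<bar> \<le> \<delta> * ell k (l + 1) + E"
      using K[OF k1(2) l1(1)] K[OF k1(2) l1(2)] ell_Suc[of k "l + 1"] unfolding Y_def Y'_def sizes_within_def by (auto simp: abs_le_iff)
    have dp: "\<bar>real_of_int (det Y)\<bar> > 0" using det_X_nonzero unfolding Y_def by simp
    have "exp (ell k (l + 1) - E) \<le> mnorm Y" using lnb(1) mnorm_X_pos unfolding Y_def by (simp add: ln_ge_iff)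
    then have A: "exp (ell k (l + 1) - E) \<le> c0 * \<bar>a\<bar>" using a by linarith
    have "exp (ell k (l + 1) + x k - E) \<le> mnorm Y'" using lnb(2) mnorm_X_pos unfolding Y'_def by (simp add: ln_ge_iff)
    then have A': "exp (ell k (l + 1) + x k - E) \<le> c0 * \<bar>a'\<bar>" using a' by linarith
    have W: "mnorm (w k) \<le> exp (x k + E)" using lnb(3) mnorm_w_pos[of k] by (metis exp_le_cancel_iff exp_ln)
    have Dt: "\<bar>real_of_int (det Y)\<bar> \<le> exp (\<delta> * ell k (l + 1) + E)" using lnb(4) dp by (metis exp_le_cancel_iff exp_ln)
    have AA: "exp (2 * ell k (l + 1) + x k - 2 * E) \<le> c0\<^sup>2 * \<bar>a * a'\<bar>"
    proof -
      have "exp (ell k (l + 1) - E) * exp (ell k (l + 1) + x k - E) \<le> (c0 * \<bar>a\<bar>) * (c0 * \<bar>a'\<bar>)"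
        by (rule mult_mono'[OF A A']) auto
      moreover have "exp (ell k (l + 1) - E) * exp (ell k (l + 1) + x k - E) = exp (2 * ell k (l + 1) + x k - 2 * E)"
        unfolding exp_add[symmetric] by (rule arg_cong[where f = exp]) linarith
      moreover have "(c0 * \<bar>a\<bar>) * (c0 * \<bar>a'\<bar>) = c0\<^sup>2 * \<bar>a * a'\<bar>" by (simp add: abs_mult power2_eq_square)
      ultimately show ?thesis by simp
    qed
    have DW: "\<bar>real_of_int (det Y)\<bar> * mnorm (w k) \<le> exp (\<delta> * ell k (l + 1) + x k + 2 * E)"
    proof -
      have "\<bar>real_of_int (det Y)\<bar> * mnorm (w k) \<le> exp (\<delta> * ell k (l + 1) + E) * exp (x k + E)"
        by (rule mult_mono'[OF Dt W]) (auto simp: mnorm_nonneg)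
      then show ?thesis by (simp add: ac_simps flip: exp_add)
    qed
    have key: "\<bar>v / (a * a')\<bar> \<le> D n" if v: "\<bar>v\<bar> \<le> 2 * (\<bar>real_of_int (det Y)\<bar> * mnorm (w k))" for v
    proof -
      have "\<bar>v\<bar> \<le> 2 * exp (\<delta> * ell k (l + 1) + x k + 2 * E)" using v DW by linarith
      also have "\<dots> = 2 * exp (4 * E) * exp ((\<delta> - 2) * ell k (l + 1)) * exp (2 * ell k (l + 1) + x k - 2 * E)"
        by (simp add: mult.assoc algebra_simps flip: exp_add)
      also have "\<dots> \<le> 2 * exp (4 * E) * exp ((\<delta> - 2) * ell k (l + 1)) * (c0\<^sup>2 * \<bar>a * a'\<bar>)"
        by (rule mult_left_mono[OF AA]) simp
      also have "\<dots> = D n * \<bar>a * a'\<bar>" by (simp add: D_def \<kappa>_def e ac_simps)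
      finally have "\<bar>v\<bar> \<le> D n * \<bar>a * a'\<bar>" .
      then show ?thesis using a(1) a'(1) by (simp add: abs_divide pos_divide_le_eq)
    qed
    have W1: "Y' $ 1 $ 1 * Y $ 1 $ 2 - Y $ 1 $ 1 * Y' $ 1 $ 2 = - det Y * w k $ 1 $ 2"
      "Y' $ 1 $ 1 * Y $ 2 $ 2 - Y $ 1 $ 1 * Y' $ 2 $ 2 = det Y * (w k $ 1 $ 1 - w k $ 2 $ 2)"
      using wedge_identities[of Y "w k"] sy unfolding YY by auto
    have s2: "slope2 (Suc n) - slope2 n = of_int (det Y * w k $ 1 $ 2) / (a * a')"
    proof -
      have "slope2 (Suc n) - slope2 n = - of_int (Y' $ 1 $ 1 * Y $ 1 $ 2 - Y $ 1 $ 1 * Y' $ 1 $ 2) / (a * a')"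
        unfolding slope2_def yY yY' using a(1) a'(1) by (simp add: a_def a'_def field_simps)
      then show ?thesis unfolding W1 by simp
    qed
    have s3: "slope3 (Suc n) - slope3 n = - of_int (det Y * (w k $ 1 $ 1 - w k $ 2 $ 2)) / (a * a')"
    proof -
      have "slope3 (Suc n) - slope3 n = - of_int (Y' $ 1 $ 1 * Y $ 2 $ 2 - Y $ 1 $ 1 * Y' $ 2 $ 2) / (a * a')"
        unfolding slope3_def yY yY' using a(1) a'(1) by (simp add: a_def a'_def field_simps)
      then show ?thesis unfolding W1 .
    qed
    have wk: "\<bar>real_of_int (w k $ i $ j)\<bar> \<le> mnorm (w k)" for i j using abs_le_mnorm[of "w k" i j] by simp
    have b2: "\<bar>slope2 (Suc n) - slope2 n\<bar> \<le> D n"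
      unfolding s2
    proof (rule key)
      have "\<bar>real_of_int (det Y * w k $ 1 $ 2)\<bar> \<le> \<bar>real_of_int (det Y)\<bar> * mnorm (w k)"
        unfolding of_int_mult abs_mult using wk by (intro mult_left_mono) auto
      moreover have "0 \<le> \<bar>real_of_int (det Y)\<bar> * mnorm (w k)" using mnorm_nonneg by simp
      ultimately show "\<bar>real_of_int (det Y * w k $ 1 $ 2)\<bar> \<le> 2 * (\<bar>real_of_int (det Y)\<bar> * mnorm (w k))" by linarith
    qed
    have b3: "\<bar>slope3 (Suc n) - slope3 n\<bar> \<le> D n"
      unfolding s3
    proof (rule key)
      have "\<bar>real_of_int (w k $ 1 $ 1 - w k $ 2 $ 2)\<bar> \<le> 2 * mnorm (w k)"
        unfolding of_int_diff using wk[of 1 1] wk[of 2 2] by linarith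
      then have "\<bar>real_of_int (det Y)\<bar> * \<bar>real_of_int (w k $ 1 $ 1 - w k $ 2 $ 2)\<bar> \<le> \<bar>real_of_int (det Y)\<bar> * (2 * mnorm (w k))"
        by (rule mult_left_mono) simp
      then show "\<bar>- real_of_int (det Y * (w k $ 1 $ 1 - w k $ 2 $ 2))\<bar> \<le> 2 * (\<bar>real_of_int (det Y)\<bar> * mnorm (w k))"
        by (simp add: abs_mult)
    qed
    have "D (Suc n) \<le> D n / 2"
    proof -
      have ge0: "int n \<ge> 0" by simp
      have "gg (int n) = x k" unfolding kl(2) by (rule gg_level[OF kl(3)])
      then have es: "eta (int (Suc n)) = eta (int n) + x k" using eta_step[of "int (Suc n)"] by simp
      \<comment> \<open>From one step to the next the bound is multiplied by
        \<open>exp (- (2 - \<delta>) * x k)\<close>, which is at most 1/2.\<close>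
      have "ln 2 \<le> (1::real)" using ln_2_less_1 by simp
      moreover have "1 * 1 \<le> (2 - \<delta>) * x k" by (rule mult_mono) (use K1[OF k1(3)] \<delta>1 in auto)
      ultimately have "(\<delta> - 2) * eta (int (Suc n)) \<le> (\<delta> - 2) * eta (int n) - ln 2" unfolding es by (simp add: algebra_simps)
      then have "exp ((\<delta> - 2) * eta (int (Suc n))) \<le> exp ((\<delta> - 2) * eta (int n) - ln 2)" by simp
      also have "\<dots> = exp ((\<delta> - 2) * eta (int n)) / 2" by (simp add: exp_diff)
      finally have "\<kappa> * exp ((\<delta> - 2) * eta (int (Suc n))) \<le> \<kappa> * (exp ((\<delta> - 2) * eta (int n)) / 2)"
        using \<kappa> by (intro mult_left_mono) auto
      then show ?thesis unfolding D_def by simp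
    qed
    with b2 b3 show ?thesis by blast
  qed
  have "\<bar>slope2 n - \<xi>\<bar> \<le> 2 * D n \<and> \<bar>slope3 n - \<xi>\<^sup>2\<bar> \<le> 2 * D n" if n: "n \<ge> n0" for n
    using halving_limit_bound[OF slopes(2), of n0 D n] halving_limit_bound[OF slopes(3), of n0 D n] step n by blast
  then have "\<forall>\<^sub>F n in sequentially. \<bar>slope2 n - \<xi>\<bar> \<le> (2 * \<kappa>) * exp ((\<delta> - 2) * eta (int n)) \<and>
     \<bar>slope3 n - \<xi>\<^sup>2\<bar> \<le> (2 * \<kappa>) * exp ((\<delta> - 2) * eta (int n))"
    unfolding eventually_sequentially D_def by (metis mult.assoc)
  then show ?thesis using \<kappa> by (intro exI[of _ "2 * \<kappa>"]) simp
qed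

text \<open>The witnesses are the normal of \<open>w k\<close>, the second normal of
  \<open>X k l\<close> and \<open>transpose (Nk k)\<close>, the point y_i and a Bezout vector for
  its content. Sizes come from \<open>ln_mnorm_X\<close>, products with \<open>u\<close> from
  \<open>slope_rate\<close>, and the distance of y_i to the line of \<open>u\<close> from its
  determinant.\<close>

theorem eventually_approximable:
  "\<exists>\<kappa>\<ge>1. \<forall>\<^sub>F k in sequentially. \<forall>l. int l < s (k + 1) \<longrightarrow> approximable \<kappa> u \<delta> (x k) (ell k (l + 1))"
proof -
  obtain E where E: "E \<ge> 0" "\<forall>\<^sub>F k in sequentially. \<forall>l. int l \<le> s (k + 1) + 1 \<longrightarrow> sizes_within E k l" using ln_mnorm_X by blast
  obtain \<rho> where \<rho>: "\<rho> > 0" "\<forall>\<^sub>F n in sequentially. \<bar>slope2 n - \<xi>\<bar> \<le> \<rho> * exp ((\<delta> - 2) * eta (int n)) \<and>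
     \<bar>slope3 n - \<xi>\<^sup>2\<bar> \<le> \<rho> * exp ((\<delta> - 2) * eta (int n))" using slope_rate by blast
  have "\<forall>\<^sub>F n in sequentially. yy n $ 1 $ 1 \<noteq> 0 \<and> \<bar>slope2 n - \<xi>\<bar> \<le> \<rho> * exp ((\<delta> - 2) * eta (int n)) \<and>
     \<bar>slope3 n - \<xi>\<^sup>2\<bar> \<le> \<rho> * exp ((\<delta> - 2) * eta (int n))"
    using \<rho>(2) slopes(1) by eventually_elim simp
  then obtain n0 where n0: "\<And>n. n \<ge> n0 \<Longrightarrow> yy n $ 1 $ 1 \<noteq> 0 \<and> \<bar>slope2 n - \<xi>\<bar> \<le> \<rho> * exp ((\<delta> - 2) * eta (int n)) \<and>
     \<bar>slope3 n - \<xi>\<^sup>2\<bar> \<le> \<rho> * exp ((\<delta> - 2) * eta (int n))" unfolding eventually_sequentially by blast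
  have ev_x: "\<forall>\<^sub>F k in sequentially. x k \<ge> 0" using x_tendsto unfolding filterlim_at_top by blast
  define c\<xi> where "c\<xi> = 3 + 2 * \<bar>\<xi>\<bar> + \<xi>\<^sup>2"
  have c\<xi>: "c\<xi> > 0" by (simp add: c\<xi>_def add_pos_nonneg)
  define \<nu> where "\<nu> = mnorm N"
  have \<nu>: "\<nu> \<ge> 1" using mnorm_ge_1 det_N by (simp add: \<nu>_def)
  \<comment> \<open>A sum of non-negative terms, chosen to dominate each constant met below.\<close>
  define \<kappa> where "\<kappa> = max 1 C + (4 * exp E + 8 * \<nu> * exp E) * (1 + 2 * \<rho>) + c\<xi> * 3 * exp (2 * E) + exp E"
  have parts: "0 \<le> 4 * exp E" "0 \<le> 8 * \<nu> * exp E" "0 \<le> (4 * exp E + 8 * \<nu> * exp E) * (2 * \<rho>)" "0 \<le> c\<xi> * 3 * exp (2 * E)" "0 \<le> exp E"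
    using \<nu> \<rho>(1) c\<xi> by auto
  have \<kappa>_split: "\<kappa> = max 1 C + 4 * exp E + 8 * \<nu> * exp E + (4 * exp E + 8 * \<nu> * exp E) * (2 * \<rho>) + c\<xi> * 3 * exp (2 * E) + exp E"
    unfolding \<kappa>_def by (simp add: algebra_simps)
  have \<kappa>1: "\<kappa> \<ge> 1" "\<kappa> \<ge> C" unfolding \<kappa>_split using parts by linarith+
  have \<kappa>2: "4 * exp E \<le> \<kappa>" "8 * \<nu> * exp E \<le> \<kappa>" "c\<xi> * 3 * exp (2 * E) \<le> \<kappa>" "exp E \<le> \<kappa>"
    unfolding \<kappa>_split using parts by linarith+
  have \<kappa>3: "4 * exp E * (2 * \<rho>) \<le> \<kappa>" "8 * \<nu> * exp E * (2 * \<rho>) \<le> \<kappa>"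
  proof -
    have "(4 * exp E + 8 * \<nu> * exp E) * (2 * \<rho>) = 4 * exp E * (2 * \<rho>) + 8 * \<nu> * exp E * (2 * \<rho>)" by (rule distrib_right)
    moreover have "0 \<le> 4 * exp E * (2 * \<rho>)" "0 \<le> 8 * \<nu> * exp E * (2 * \<rho>)" using \<nu> \<rho>(1) by auto
    ultimately show "4 * exp E * (2 * \<rho>) \<le> \<kappa>" "8 * \<nu> * exp E * (2 * \<rho>) \<le> \<kappa>"
      unfolding \<kappa>_split using parts by linarith+
  qed
  have "\<forall>\<^sub>F k in sequentially. \<forall>l. int l < s (k + 1) \<longrightarrow> approximable \<kappa> u \<delta> (x k) (ell k (l + 1))"
    using E(2) ev_x eventually_ge_at_top[of "n0 + 1"]
  proof eventually_elim
    case (elim k)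
    show ?case
    proof (intro allI impI)
      fix l assume l: "int l < s (k + 1)"
      have k1: "k \<ge> 1" and xk: "x k \<ge> 0" using elim by auto
      define e where "e = ell k (l + 1)"
      define Y where "Y = X k (l + 1)"
      have em: "e - x k = ell k l" using ell_Suc[of k l] by (simp add: e_def)
      have kE: "\<bar>ln (mnorm (X k j)) - ell k j\<bar> \<le> E" "\<bar>ln (mnorm (w k)) - x k\<bar> \<le> E"
        "\<bar>ln \<bar>real_of_int (det (X k j))\<bar> - \<delta> * ell k j\<bar> \<le> E" if "int j \<le> s (k + 1) + 1" for j
        using elim(1) that unfolding sizes_within_def by auto
      have l0: "int l \<le> s (k + 1) + 1" "int (l + 1) \<le> s (k + 1) + 1" using l by auto
      define n where "n = nat (tt s k + int l)"
      have tk: "tt s k \<ge> int n0" using tt_ge[of k] elim(3) by simp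
      then have n: "int n = tt s k + int l" "n \<ge> n0" unfolding n_def by auto
      have yY: "yy n = Y" unfolding yy_def n(1) Y_def by (rule sturm_y_eq[OF l k1])
      have yY': "yy (Suc n) = X k (l + 2)"
      proof -
        have "int (Suc n) = tt s k + int l + 1" using n(1) by simp
        then show ?thesis unfolding yy_def by (simp only: sturm_y_Suc[OF l k1])
      qed
      have en: "eta (int n) = e" unfolding n(1) e_def ell_def using eta_level[OF l k1] by simp
      have en': "eta (int (Suc n)) = e + x k"
        using eta_step[of "int (Suc n)"] gg_level[OF l] n(1) en by simp
      have sy: "symmetric (X k j)" for j using X_symmetric[OF k1] .
      have XS: "X k (Suc j) = w k ** X k j" for j by (rule X_Suc)
      have wX: "symmetric (w k ** X k j)" for j using sy[of "Suc j"] unfolding XS .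
      have wM: "symmetric (w k ** transpose (Nk k))" using symmetric_triple[OF k1] by blast
      have Msym: "\<not> symmetric (transpose (Nk k))" using Nk_not_sym[of "Suc k"] by (simp add: Nk_Suc)
      define A where "A = plane_normal (w k)"
      define Z where "Z = second_normal (X k l) (transpose (Nk k))"
      have AX: "A \<bullet> point (X k j) = 0" for j
        unfolding A_def by (rule plane_normal_orth) (rule sy wX)+
      have ZY: "Z \<bullet> point Y = 0"
        unfolding Z_def Y_def using second_normal_orth[of "X k l" "w k" "transpose (Nk k)"] sy XS[of l] wX wM by simp
      have ind: "independent {A, Z}" "A \<noteq> Z"
        unfolding A_def Z_def
        by (rule normals_independent; rule sy wX wM Msym det_w det_X_nonzero)+
      have int: "A \<in> integer_points" "Z \<in> integer_points" unfolding A_def Z_def by (rule normals_integer)+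
      have nYm: "mnorm Y \<le> norm (point Y)" unfolding Y_def by (rule mnorm_le_norm_point[OF sy])
      have mY: "mnorm Y > 0" unfolding Y_def by (rule mnorm_X_pos)
      then have Y0: "point Y \<noteq> 0" using nYm by auto
      obtain V where V: "V \<in> integer_points" "V \<bullet> point Y = of_int (content Y)" "content Y > 0"
        using content_bezout[OF Y0] by blast
      have cY: "content Y \<le> C" using content_le[of "int n"] yY unfolding yy_def by simp
      have bw: "mnorm (w k) \<le> exp (x k + E)" 
        using kE(2)[OF l0(1)] mnorm_w_pos[of k] by (metis abs_le_D1 diff_le_eq exp_le_cancel_iff exp_ln add.commute)
      have bX: "mnorm (X k j) \<le> exp (ell k j + E)" if "int j \<le> s (k + 1) + 1" for j
        using kE(1)[OF that] mnorm_X_pos[of k j] by (metis abs_le_D1 diff_le_eq exp_le_cancel_iff exp_ln add.commute)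
      have nA: "norm A \<le> 4 * exp E * exp (x k)"
      proof -
        have "norm A \<le> 4 * mnorm (w k)" unfolding A_def by (rule norm_plane_normal)
        also have "\<dots> \<le> 4 * exp (x k + E)" using bw by simp
        finally show ?thesis by (simp add: exp_add ac_simps)
      qed
      have nZ: "norm Z \<le> 8 * \<nu> * exp E * exp (e - x k)"
      proof -
        have "norm Z \<le> 8 * mnorm (X k l) * \<nu>" unfolding Z_def \<nu>_def
          using norm_second_normal[of "X k l" "transpose (Nk k)"] by (simp add: mnorm_transpose mnorm_Nk)
        also have "\<dots> \<le> 8 * exp (ell k l + E) * \<nu>" using bX[OF l0(1)] \<nu> by simp
        finally show ?thesis unfolding em by (simp add: exp_add ac_simps)
      qed
      have r: "yy m $ 1 $ 1 \<noteq> 0" "\<bar>of_int (yy m $ 1 $ 2) / of_int (yy m $ 1 $ 1) - u $ 2\<bar> \<le> \<rho> * exp ((\<delta> - 2) * eta (int m))"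
        "\<bar>of_int (yy m $ 2 $ 2) / of_int (yy m $ 1 $ 1) - u $ 3\<bar> \<le> \<rho> * exp ((\<delta> - 2) * eta (int m))" if "m \<ge> n0" for m
        using n0[OF that] unfolding slope2_def slope3_def u_simps by auto
      \<comment> \<open>\<open>A\<close> is also orthogonal to the next point, whose direction is
        closer to \<open>u\<close>. This gains \<open>(2 - \<delta>) * x k\<close> in the exponent,
        which absorbs the norm of \<open>A\<close> because \<open>\<delta> \<le> 1\<close>. For
        \<open>Z\<close> the point y_i itself is used.\<close>
      have uA: "\<bar>A \<bullet> u\<bar> \<le> 4 * exp E * (2 * \<rho>) * exp (- (2 - \<delta>) * e)"
      proof -
        have "\<bar>A \<bullet> u\<bar> \<le> norm A * (2 * (\<rho> * exp ((\<delta> - 2) * (e + x k))))"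
          by (rule abs_inner_le_of_orth[of A "yy (Suc n)"])
            (use r[of "Suc n"] n(2) AX[of "l + 2"] yY' en' u_simps in auto)
        also have "\<dots> \<le> 4 * exp E * exp (x k) * (2 * (\<rho> * exp ((\<delta> - 2) * (e + x k))))"
          using nA \<rho>(1) by (intro mult_right_mono) auto
        also have "\<dots> = 4 * exp E * (2 * \<rho>) * exp (x k + (\<delta> - 2) * (e + x k))" by (simp add: exp_add ac_simps)
        also have "\<dots> \<le> 4 * exp E * (2 * \<rho>) * exp (- (2 - \<delta>) * e)"
        proof -
          have "\<delta> * x k \<le> 1 * x k" using \<delta>1 xk by (intro mult_right_mono) auto
          then have "x k + (\<delta> - 2) * (e + x k) \<le> - (2 - \<delta>) * e" by (simp add: algebra_simps)
          then show ?thesis using \<rho>(1) by (intro mult_left_mono) auto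
        qed
        finally show ?thesis .
      qed
      have uZ: "\<bar>Z \<bullet> u\<bar> \<le> 8 * \<nu> * exp E * (2 * \<rho>) * exp (e - x k - (2 - \<delta>) * e)"
      proof -
        have "\<bar>Z \<bullet> u\<bar> \<le> norm Z * (2 * (\<rho> * exp ((\<delta> - 2) * e)))"
          by (rule abs_inner_le_of_orth[of Z "yy n"]) (use r[of n] n(2) ZY yY en u_simps in auto)
        also have "\<dots> \<le> 8 * \<nu> * exp E * exp (e - x k) * (2 * (\<rho> * exp ((\<delta> - 2) * e)))"
          using nZ \<rho>(1) by (intro mult_right_mono) auto
        also have "\<dots> = 8 * \<nu> * exp E * (2 * \<rho>) * (exp (e - x k) * exp ((\<delta> - 2) * e))" by (simp add: ac_simps)
        also have "exp (e - x k) * exp ((\<delta> - 2) * e) = exp (e - x k - (2 - \<delta>) * e)"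
          by (simp add: algebra_simps flip: exp_add)
        finally show ?thesis .
      qed
      have nY: "exp e \<le> exp E * norm (point Y)"
      proof -
        have "e - E \<le> ln (mnorm Y)" using kE(1)[OF l0(2)] unfolding e_def Y_def by (simp add: abs_le_iff)
        then have "exp (e - E) \<le> mnorm Y" using mY by (simp add: ln_ge_iff)
        then have "exp E * exp (e - E) \<le> exp E * norm (point Y)" using nYm by (intro mult_left_mono) auto
        then show ?thesis by (simp flip: exp_add)
      qed
      define R where "R = point Y - ((point Y \<bullet> u) / (u \<bullet> u)) *\<^sub>R u"
      \<comment> \<open>The determinant of y_i is of order exp(\<delta> e) and its norm of order
        exp(e), so the distance to the line of \<open>u\<close> is at least of order exp((\<delta> -
        1) e).\<close>
      have nR: "exp ((\<delta> - 1) * e) \<le> c\<xi> * 3 * exp (2 * E) * norm R"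
      proof -
        have dp: "\<bar>real_of_int (det Y)\<bar> > 0" unfolding Y_def using det_X_nonzero by simp
        have "\<delta> * e - E \<le> ln \<bar>real_of_int (det Y)\<bar>" using kE(3)[OF l0(2)] unfolding e_def Y_def by (simp add: abs_le_iff)
        then have "exp (\<delta> * e - E) \<le> \<bar>real_of_int (det Y)\<bar>" using dp by (simp add: ln_ge_iff)
        also have "\<dots> \<le> c\<xi> * norm (point Y) * norm R"
          using det_le_distance[of Y \<xi>] sy[of "l + 1"] unfolding c\<xi>_def R_def u_def Y_def by simp
        also have "\<dots> \<le> c\<xi> * (3 * exp (e + E)) * norm R"
        proof -
          have "norm (point Y) \<le> 3 * mnorm Y" by (rule norm_point_le)
          then have "norm (point Y) \<le> 3 * exp (e + E)" using bX[OF l0(2)] unfolding Y_def e_def by simp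
          then show ?thesis using c\<xi> by (intro mult_right_mono mult_left_mono) auto
        qed
        finally have "exp (\<delta> * e - E) * exp (E - e) \<le> c\<xi> * (3 * exp (e + E)) * norm R * exp (E - e)"
          by (intro mult_right_mono) auto
        also have "\<dots> = c\<xi> * 3 * norm R * (exp (e + E) * exp (E - e))" by (simp only: ac_simps)
        also have "exp (e + E) * exp (E - e) = exp (2 * E)" by (simp flip: exp_add)
        also have "exp (\<delta> * e - E) * exp (E - e) = exp ((\<delta> - 1) * e)" by (simp add: algebra_simps flip: exp_add)
        finally show ?thesis by (simp add: ac_simps)
      qed
      have up: "v \<le> \<kappa> * t" if "v \<le> c * t" "c \<le> \<kappa>" "0 \<le> t" for v c t
        using that mult_right_mono[of c \<kappa> t] by linarith
      show "approximable \<kappa> u \<delta> (x k) (ell k (l + 1))"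
        unfolding approximable_def e_def[symmetric]
      proof (intro exI conjI)
        show "A \<in> integer_points" "Z \<in> integer_points" "V \<in> integer_points" by fact+
        show "A \<bullet> point Y = 0" unfolding Y_def by (rule AX)
        show "Z \<bullet> point Y = 0" "independent {A, Z}" "A \<noteq> Z" by fact+
        show "V \<bullet> point Y \<noteq> 0" using V by simp
        have "real_of_int (content Y) \<le> \<kappa>" using \<kappa>1(2) cY by linarith
        then show "\<bar>V \<bullet> point Y\<bar> \<le> \<kappa>" using V(2,3) by simp
        show "norm A \<le> \<kappa> * exp (x k)" by (rule up[OF nA \<kappa>2(1)]) simp
        show "\<bar>A \<bullet> u\<bar> \<le> \<kappa> * exp (- (2 - \<delta>) * e)" by (rule up[OF uA \<kappa>3(1)]) simp
        show "norm Z \<le> \<kappa> * exp (e - x k)" by (rule up[OF nZ \<kappa>2(2)]) simp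
        show "\<bar>Z \<bullet> u\<bar> \<le> \<kappa> * exp (e - x k - (2 - \<delta>) * e)" by (rule up[OF uZ \<kappa>3(2)]) simp
        show "exp e \<le> \<kappa> * norm (point Y)" by (rule up[OF nY \<kappa>2(4)]) simp
        show "exp ((\<delta> - 1) * e) \<le> \<kappa> * norm (point Y - ((point Y \<bullet> u) / (u \<bullet> u)) *\<^sub>R u)"
          using up[OF nR \<kappa>2(3)] unfolding R_def by simp
      qed
    qed
  qed
  then show ?thesis using \<kappa>1(1) by blast
qed

end

section \<open>Uniformity of the constant\<close>

context sturm_weights
begin

text \<open>All estimates are made from a rank beyond \<open>k0\<close>, beyond regularity and
  beyond the start of the approximations, so \<open>k0\<close> may be any valid index. The constant
  involves only \<open>\<kappa>\<close> and \<open>u\<close>.\<close>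

lemma close_if_approximable:
  fixes u :: "real^3"
  assumes u: "u $ 1 = 1" and \<kappa>: "\<kappa> \<ge> 1" and W_lim: "filterlim W at_top sequentially"
    and reg: "regular_from K" and V: "valid_start W k0"
    and ap: "\<forall>\<^sub>F k in sequentially. \<forall>l. int l < s (k + 1) \<longrightarrow> approximable \<kappa> u \<delta> (x k) ((l + 1) * x k + x (k - 1))"
  defines "P \<equiv> Pmap s W \<delta> k0" and "a \<equiv> aa s W \<delta> k0" and "b \<equiv> bb s W \<delta> k0"
    and "D \<equiv> 2 * ln (\<kappa>\<^sup>2 * norm u + 2 * \<kappa>) + ln 6"
  shows "\<forall>\<^sub>F q in at_top. \<bar>Lmap u 1 q - P 1 q\<bar> \<le> D"
    "\<forall>\<^sub>F j in at_top. \<forall>q\<in>{a j..b j}. \<bar>Lmap u 2 q - P 2 q\<bar> \<le> D \<and> \<bar>Lmap u 3 q - P 3 q\<bar> \<le> D"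
    "\<forall>\<^sub>F j in at_top. \<forall>q\<in>{b (j - 1)..a j}.
        P 2 q - D \<le> Lmap u 2 q \<and> Lmap u 2 q \<le> Lmap u 3 q \<and> Lmap u 3 q \<le> P 3 q + D"
proof -
  obtain K1 where K1: "\<And>k l. k \<ge> K1 \<Longrightarrow> int l < s (k + 1) \<Longrightarrow> approximable \<kappa> u \<delta> (x k) ((l + 1) * x k + x (k - 1))"
    using ap unfolding eventually_sequentially by blast
  define K' where "K' = max (max K K1) k0"
  have reg': "regular_from K'" using regular_from_mono[OF reg, of K'] by (simp add: K'_def)
  have V': "k0 \<le> K'" by (simp add: K'_def)
  interpret S: sturmian_system eta gg \<delta> "tt s K'" "Pmap s W \<delta> k0"
    by (rule sturmian_system_Pmap[OF reg' V V' W_lim])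
  have K3: "K' \<ge> 3" using reg' by (simp add: regular_from_def)
  have approx: "\<forall>i\<ge>tt s K'. approximable \<kappa> u \<delta> (gg i) (eta i)"
  proof (intro allI impI)
    fix i assume i: "i \<ge> tt s K'"
    obtain k l where kl: "i = tt s k + int l" "int l < s (k + 1)" "k \<ge> K'" using index_cases[OF i] by blast
    then have "k \<ge> K1" "k \<ge> 1" using K3 by (auto simp: K'_def)
    then show "approximable \<kappa> u \<delta> (gg i) (eta i)"
      using K1[of k l] kl eta_level[OF kl(2)] gg_level[OF kl(2)] by (simp add: add.commute)
  qed
  have D: "D = 2 * deviation \<kappa> u + ln 6" unfolding D_def deviation_def ..
  note close = S.close_1[OF u \<kappa> order_refl approx, folded D P_def]
    S.close_on_I[OF u \<kappa> order_refl approx, folded D P_def] S.close_on_I'[OF u \<kappa> order_refl approx, folded D P_def]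
  note I = Iset_eq[OF reg' V V' W_lim]
  show "\<forall>\<^sub>F q in at_top. \<bar>Lmap u 1 q - P 1 q\<bar> \<le> D"
    unfolding eventually_at_top_linorder using close(1) by blast
  show "\<forall>\<^sub>F j in at_top. \<forall>q\<in>{a j..b j}. \<bar>Lmap u 2 q - P 2 q\<bar> \<le> D \<and> \<bar>Lmap u 3 q - P 3 q\<bar> \<le> D"
    unfolding eventually_at_top_linorder
  proof (intro exI allI impI ballI)
    fix j q assume j: "tt s K' \<le> j" and "q \<in> {a j..b j}"
    then have "q \<in> {S.a j..S.b j}" using I(2,3)[OF j] by (simp add: a_def b_def)
    then show "\<bar>Lmap u 2 q - P 2 q\<bar> \<le> D \<and> \<bar>Lmap u 3 q - P 3 q\<bar> \<le> D" using close(3,4)[OF j] by blast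
  qed
  show "\<forall>\<^sub>F j in at_top. \<forall>q\<in>{b (j - 1)..a j}.
        P 2 q - D \<le> Lmap u 2 q \<and> Lmap u 2 q \<le> Lmap u 3 q \<and> Lmap u 3 q \<le> P 3 q + D"
    unfolding eventually_at_top_linorder
  proof (intro exI allI impI ballI)
    fix j q assume j: "tt s K' + 1 \<le> j" and "q \<in> {b (j - 1)..a j}"
    then have jj: "tt s K' \<le> j - 1" and "q \<in> {S.b (j - 1)..S.a j}" using I(2)[of j] I(3)[of "j - 1"] by (simp_all add: a_def b_def)
    then show "P 2 q - D \<le> Lmap u 2 q \<and> Lmap u 2 q \<le> Lmap u 3 q \<and> Lmap u 3 q \<le> P 3 q + D"
      using close(6,7)[OF jj] Lmap_2_le_3 by blast
  qed
qed

lemma staircase_Pmap: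
  assumes reg: "regular_from K" and V: "valid_start W k0" "k0 \<le> K" and W_lim: "filterlim W at_top sequentially"
    and sB: "\<And>k. s k \<le> B"
  shows "staircase s x \<delta> (Pmap s W \<delta> k0 1) K B"
proof
  have K3: "K \<ge> 3" using reg by (simp add: regular_from_def)
  have xp: "x k > 0" if "k \<ge> K - 3" for k using reg that by (simp add: regular_from_def)
  show "1 \<le> s k" if "K \<le> k" for k using s_pos that K3 by simp
  show "s k \<le> B" for k by (rule sB)
  show "2 \<le> K" using K3 by simp
  show "x (k + 1) = s (k + 1) * x k + x (k - 1)" if "K \<le> k" for k using x_rec that K3 by simp
  show "0 < x k" if "K - 1 \<le> k" for k by (rule xp) (use that in linarith)
  show "x (k - 1) < x k" if "K \<le> k" for k using x_less_x(1)[OF reg, of k] that by simp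
  show "filterlim x at_top sequentially" unfolding x_def by (rule filterlim_compose[OF ln_at_top W_lim])
  show "0 \<le> \<delta>" by (rule \<delta>0)
  \<comment> \<open>With \<open>\<delta> \<ge> 1\<close> regularity at \<open>K\<close> would force
    \<open>x K\<close> to be negative.\<close>
  show "\<delta> < 1"
  proof (rule ccontr)
    have xK: "x (K - 1) > 0" by (rule xp) linarith
    assume "\<not> \<delta> < 1"
    then have "1 * (x K + x (K - 1)) \<le> \<delta> * (x K + x (K - 1))"
      using xp[of K] xK by (intro mult_right_mono) auto
    moreover have "\<delta> * (x K + x (K - 1)) < x (K - 1)" using reg by (simp add: regular_from_def)
    moreover have "x K > 0" using xp by simp
    ultimately show False unfolding mult_1_left by linarith
  qed
  fix k z assume k: "K \<le> k" and z: "(2 - \<delta>) * (x k + x (k - 1)) \<le> z" "z \<le> (2 - \<delta>) * (x (k + 1) + x k)"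
  have k1: "k \<ge> 1" using k K3 by simp
  have z0: "int 0 < s (k + 1)" "int 0 < s (k + 1 + 1)" using s_pos[of "k + 1"] s_pos[of "k + 1 + 1"] by simp_all
  have e: "qq s W \<delta> (tt s k) = (2 - \<delta>) * (x k + x (k - 1))" "qq s W \<delta> (tt s (k + 1)) = (2 - \<delta>) * (x (k + 1) + x k)"
    using eta_level[OF z0(1) k1] eta_level[OF z0(2)] by (simp_all add: qq_eq)
  show "Pmap s W \<delta> k0 1 z = min (x k) (x (k - 1) + z - (2 - \<delta>) * (x k + x (k - 1)))"
    using Pmap_1_eq[OF reg V W_lim k, of z] z unfolding e by simp
qed

end

text \<open>The hypotheses of the theorem, verbatim, with \<open>\<xi>\<close> as a parameter, so
  that uniformity in the other data can be expressed.\<close>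

definition sturmian_data ::
  "real \<Rightarrow> (nat \<Rightarrow> int) \<Rightarrow> (nat \<Rightarrow> int^2^2) \<Rightarrow> int^2^2 \<Rightarrow> real \<Rightarrow> (nat \<Rightarrow> real) \<Rightarrow> bool" where
  "sturmian_data \<xi> s w N \<delta> W \<longleftrightarrow>
    s 0 = -1 \<and> s 1 = 1 \<and> (\<forall>k\<ge>1. s k \<ge> 1) \<and> (\<exists>B. \<forall>k. \<bar>s k\<bar> \<le> B) \<and>
    sturmian s w \<and> admissible_with w N \<and> multiplicative_growth s w \<and>
    filterlim (\<lambda>i. mnorm (w i)) at_top sequentially \<and> \<not> symmetric N \<and>
    \<delta> \<ge> 0 \<and> (\<lambda>i. \<bar>real_of_int (det (w i))\<bar>) \<in> \<Theta>(\<lambda>i. mnorm (w i) powr \<delta>) \<and>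
    \<delta> < sturm_sigma s / (1 + sturm_sigma s) \<and>
    (\<exists>B. \<forall>i\<ge>-2. content (sturm_y s w N i) \<le> B) \<and>
    proj_tendsto (\<lambda>n. point (sturm_y s w N (int n))) (vector [1, \<xi>, \<xi>^2]) \<and>
    is_What s w W"

text \<open>Supplies what the locale adds to the hypotheses: the weights tend to infinity because
  they are comparable to the norms, and \<open>\<delta> \<le> 1\<close> follows from the eventual
  inequality on positive \<open>x k\<close>.\<close>

lemma sturmian_data_locale:
  assumes "sturmian_data \<xi> s w N \<delta> W"
  shows "\<exists>B C. sturmian_matrices s W \<delta> w N \<xi> B C \<and> (\<exists>K. sturm_weights.regular_from W \<delta> K)"
proof -
  have s: "s 0 = -1" "s 1 = 1" "\<And>k. k \<ge> 1 \<Longrightarrow> s k \<ge> 1"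
    and m: "sturmian s w" "admissible_with w N" "multiplicative_growth s w"
      "filterlim (\<lambda>i. mnorm (w i)) at_top sequentially" "\<not> symmetric N"
    and d: "\<delta> \<ge> 0" "(\<lambda>i. \<bar>real_of_int (det (w i))\<bar>) \<in> \<Theta>(\<lambda>i. mnorm (w i) powr \<delta>)"
      "\<delta> < sturm_sigma s / (1 + sturm_sigma s)"
    and pr: "proj_tendsto (\<lambda>n. point (sturm_y s w N (int n))) (vector [1, \<xi>, \<xi>^2])"
    and Wh: "\<And>k. W k > 0" "\<And>k. k \<ge> 1 \<Longrightarrow> W (k + 1) = W k ^ nat (s (k + 1)) * W (k - 1)"
      "W \<in> \<Theta>(\<lambda>k. mnorm (w k))"
    using assms unfolding sturmian_data_def is_What_def by auto
  obtain B where B: "\<And>k. \<bar>s k\<bar> \<le> B" using assms unfolding sturmian_data_def by blast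
  have sB: "s k \<le> B" for k using B[of k] by linarith
  obtain C where C: "\<And>i. i \<ge> -2 \<Longrightarrow> content (sturm_y s w N i) \<le> C" using assms unfolding sturmian_data_def by blast
  have mp: "mnorm (w k) > 0" for k
  proof -
    have "det (w k) \<noteq> 0" using m(1) by (simp add: sturmian_def)
    from mnorm_ge_1[OF this] show ?thesis by linarith
  qed
  have W_lim: "filterlim W at_top sequentially"
  proof -
    obtain T where T: "\<forall>\<^sub>F k in sequentially. \<bar>ln (W k) - ln (mnorm (w k))\<bar> \<le> T"
      using bigtheta_ln_bounded[OF Wh(3) Wh(1) mp] by blast
    have "filterlim (\<lambda>k. exp (- T) * mnorm (w k)) at_top sequentially"
      by (rule filterlim_tendsto_pos_mult_at_top[OF tendsto_const _ m(4)]) simp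
    moreover have "\<forall>\<^sub>F k in sequentially. exp (- T) * mnorm (w k) \<le> W k"
      using T
    proof eventually_elim
      case (elim k)
      then have "- T + ln (mnorm (w k)) \<le> ln (W k)" by linarith
      then have "exp (- T + ln (mnorm (w k))) \<le> W k" using Wh(1)[of k] by (simp add: ln_ge_iff)
      then show ?case by (simp only: exp_add exp_ln[OF mp])
    qed
    ultimately show ?thesis by (rule filterlim_at_top_mono)
  qed
  define x where "x k = ln (W k)" for k
  have x_rec: "x (k + 1) = s (k + 1) * x k + x (k - 1)" if "k \<ge> 1" for k
  proof -
    have "W k \<noteq> 0" "W (k - 1) \<noteq> 0" using Wh(1)[of k] Wh(1)[of "k - 1"] by simp_all
    then show ?thesis unfolding x_def Wh(2)[OF that] using s(3)[of "k + 1"] Wh(1)[of k] by (simp add: ln_mult ln_realpow)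
  qed
  have "\<forall>\<^sub>F k in sequentially. 1 < W k" using W_lim filterlim_at_top_dense by blast
  then obtain K0 where K0: "\<And>k. k \<ge> K0 \<Longrightarrow> W k > 1" unfolding eventually_sequentially by blast
  have xp: "x k > 0" if "k \<ge> K0" for k unfolding x_def using K0[OF that] by simp
  have "\<forall>\<^sub>F k in sequentially. \<delta> * (x (k + 1) + x k) < x k"
    by (rule eventually_exponent_small[OF s(3) sB x_rec xp d(1,3)])
  then obtain K1 where K1: "\<And>k. k \<ge> K1 \<Longrightarrow> \<delta> * (x (k + 1) + x k) < x k" unfolding eventually_sequentially by blast
  have \<delta>1: "\<delta> \<le> 1"
  proof (rule ccontr)
    define k where "k = max K0 K1"
    have p: "x k > 0" "x (k + 1) > 0" using xp unfolding k_def by auto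
    assume "\<not> \<delta> \<le> 1"
    then have "1 * (x (k + 1) + x k) \<le> \<delta> * (x (k + 1) + x k)" using p by (intro mult_right_mono) auto
    then show False using K1[of k] p unfolding mult_1_left by (simp add: k_def)
  qed
  interpret S: sturm_weights s W \<delta>
    by unfold_locales (use s Wh d(1) \<delta>1 in auto)
  have M: "sturmian_matrices s W \<delta> w N \<xi> B C"
    by unfold_locales (use sB m d C pr Wh W_lim in auto)
  have "S.regular_from (K0 + K1 + 3)"
    unfolding S.regular_from_def
  proof (intro conjI allI impI)
    fix k assume k: "K0 + K1 + 3 - 1 \<le> k"
    then have "k - 1 \<ge> K1" "k - 1 + 1 = k" by auto
    then show "\<delta> * (S.x k + S.x (k - 1)) < S.x (k - 1)" using K1[of "k - 1"] unfolding S.x_def x_def by simp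
  next
    fix k assume "K0 + K1 + 3 - 3 \<le> k"
    then show "0 < S.x k" using xp[of k] unfolding S.x_def x_def by simp
  qed simp
  then show ?thesis using M by blast
qed

text \<open>The own constant of the sequence only serves to place its P_1 at some bounded distance
  from L_1. The comparison of staircases then identifies its parameters, up to o(1), with those of
  the other sequence, whose integer points and constant can be used instead.\<close>

lemma (in sturmian_matrices) approximable_of_other_data:
  assumes O: "sturmian_matrices s' W' \<delta>' w' N' \<xi> B' C'" "sturm_weights.regular_from W' \<delta>' K'"
    and ap: "\<forall>\<^sub>F k in sequentially. \<forall>l. int l < s' (k + 1) \<longrightarrow>
      approximable \<kappa> u \<delta>' (sturm_weights.x W' k) (sturmian_matrices.ell W' k (l + 1))"
    and \<kappa>: "\<kappa> \<ge> 1" and reg: "regular_from K"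
  shows "\<forall>\<^sub>F k in sequentially. \<forall>l. int l < s (k + 1) \<longrightarrow>
      approximable (3 * \<kappa>) u \<delta> (x k) ((l + 1) * x k + x (k - 1))"
proof -
  interpret S: sturmian_matrices s' W' \<delta>' w' N' \<xi> B' C' by (rule O)
  obtain \<kappa>1 where \<kappa>1: "\<kappa>1 \<ge> 1" "\<forall>\<^sub>F k in sequentially. \<forall>l. int l < s (k + 1) \<longrightarrow> approximable \<kappa>1 u \<delta> (x k) ((l + 1) * x k + x (k - 1))"
    using eventually_approximable unfolding ell_def of_nat_add of_nat_1 by (elim exE conjE) (rule that)
  have ap': "\<forall>\<^sub>F k in sequentially. \<forall>l. int l < s' (k + 1) \<longrightarrow> approximable \<kappa> u \<delta>' (S.x k) ((l + 1) * S.x k + S.x (k - 1))"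
    using ap unfolding S.ell_def of_nat_add of_nat_1 .
  have u1: "u $ 1 = 1" by (rule u_simps)
  have V: "valid_start W K" "valid_start W' K'" using regular_imp_valid[OF reg] S.regular_imp_valid[OF O(2)] by auto
  obtain c where c: "\<forall>\<^sub>F q in at_top. \<bar>Lmap u 1 q - Pmap s W \<delta> K 1 q\<bar> \<le> c"
    using close_if_approximable(1)[OF u1 \<kappa>1(1) W_lim reg V(1) \<kappa>1(2)] by blast
  obtain c' where c': "\<forall>\<^sub>F q in at_top. \<bar>Lmap u 1 q - Pmap s' W' \<delta>' K' 1 q\<bar> \<le> c'"
    using S.close_if_approximable(1)[OF u1 \<kappa> S.W_lim O(2) V(2) ap'] by blast
  have "\<forall>\<^sub>F q in at_top. \<bar>Pmap s' W' \<delta>' K' 1 q - Pmap s W \<delta> K 1 q\<bar> \<le> c + c'"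
    using c c' by eventually_elim linarith
  then obtain Z where Z: "\<And>z. z \<ge> Z \<Longrightarrow> \<bar>Pmap s' W' \<delta>' K' 1 z - Pmap s W \<delta> K 1 z\<bar> \<le> c + c'"
    unfolding eventually_at_top_linorder by blast
  have \<delta>': "\<delta> = \<delta>'" and "\<exists>a b. (\<lambda>n. x (n + b) - S.x (n + a)) \<longlonglongrightarrow> 0 \<and> (\<forall>n. s (n + b + 1) = s' (n + a + 1))"
    using staircases_asymptotic[OF S.staircase_Pmap[OF O(2) V(2) order_refl S.W_lim S.s_le]
      staircase_Pmap[OF reg V(1) order_refl W_lim s_le] Z] by auto
  then obtain a b where lim: "(\<lambda>n. x (n + b) - S.x (n + a)) \<longlonglongrightarrow> 0" and ss: "\<And>n. s (n + b + 1) = s' (n + a + 1)" by blast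
  have B1: "B \<ge> 1" using s_le[of 1] s_pos[of 1] by simp
  \<comment> \<open>The second parameter is \<open>(l + 1) * x k + x (k - 1)\<close> with
    \<open>l + 1 \<le> B\<close>, so errors below \<open>\<epsilon>\<close> add up to at most
    \<open>(B + 1) * \<epsilon> = 1 / 4\<close>, the tolerance of
    \<open>approximable_perturb\<close>.\<close>
  define \<epsilon> where "\<epsilon> = 1 / (4 * (real_of_int B + 1))"
  have \<epsilon>: "\<epsilon> > 0" "(real_of_int B + 1) * \<epsilon> = 1 / 4" using B1 unfolding \<epsilon>_def by (simp_all add: field_simps)
  obtain n0 where n0: "\<And>n. n \<ge> n0 \<Longrightarrow> \<bar>x (n + b) - S.x (n + a)\<bar> < \<epsilon>"
    using tendstoD[OF lim \<epsilon>(1)] unfolding eventually_sequentially dist_real_def by auto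
  obtain M where M: "\<And>k l. k \<ge> M \<Longrightarrow> int l < s' (k + 1) \<Longrightarrow> approximable \<kappa> u \<delta>' (S.x k) ((l + 1) * S.x k + S.x (k - 1))"
    using ap' unfolding eventually_sequentially by blast
  show ?thesis
    unfolding eventually_sequentially
  proof (intro exI allI impI)
    fix k l assume k: "n0 + M + b + 1 \<le> k" and l: "int l < s (k + 1)"
    define n where "n = k - b"
    have n: "k = n + b" "n \<ge> n0 + M + 1" using k unfolding n_def by auto
    have "int l < s' (n + a + 1)" using l ss[of n] n by simp
    then have A: "approximable \<kappa> u \<delta> (S.x (n + a)) ((real l + 1) * S.x (n + a) + S.x (n + a - 1))"
      using M[of "n + a" l] n unfolding \<delta>' by (simp add: add.commute)
    have e: "\<bar>x k - S.x (n + a)\<bar> < \<epsilon>" using n0[of n] n by simp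
    have e1: "\<bar>x (k - 1) - S.x (n + a - 1)\<bar> < \<epsilon>"
    proof -
      have "k - 1 = (n - 1) + b" "n + a - 1 = (n - 1) + a" "n - 1 \<ge> n0" using n by auto
      then show ?thesis using n0[of "n - 1"] by simp
    qed
    have lB: "real l + 1 \<le> B" using l s_le[of "k + 1"] by linarith
    have "(real l + 1) * \<bar>x k - S.x (n + a)\<bar> \<le> B * \<epsilon>" using lB e B1 by (intro mult_mono) auto
    moreover have "(real l + 1) * x k - (real l + 1) * S.x (n + a) = (real l + 1) * (x k - S.x (n + a))"
      by (rule right_diff_distrib[symmetric])
    ultimately have "\<bar>(real l + 1) * x k - (real l + 1) * S.x (n + a)\<bar> \<le> B * \<epsilon>"
      by (simp add: abs_mult)
    moreover have B\<epsilon>: "B * \<epsilon> + \<epsilon> = 1 / 4" using \<epsilon>(2) by (simp add: algebra_simps)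
    ultimately have d2: "\<bar>((real l + 1) * x k + x (k - 1)) - ((real l + 1) * S.x (n + a) + S.x (n + a - 1))\<bar> \<le> 1 / 4"
      using e1 by linarith
    have "0 \<le> B * \<epsilon>" using B1 \<epsilon>(1) by simp
    then have d1: "\<bar>x k - S.x (n + a)\<bar> \<le> 1 / 4" using e B\<epsilon> by linarith
    show "approximable (3 * \<kappa>) u \<delta> (x k) ((real l + 1) * x k + x (k - 1))"
      using approximable_perturb[OF A d1 d2 \<delta>0 \<delta>1] \<kappa> by simp
  qed
qed

lemma sturmian_data_uniform:
  "\<exists>\<kappa>\<ge>1. \<forall>s w N \<delta> W. sturmian_data \<xi> s w N \<delta> W \<longrightarrow>
     (\<forall>\<^sub>F k in sequentially. \<forall>l. int l < s (k + 1) \<longrightarrow> approximable \<kappa> (vector [1, \<xi>, \<xi>^2]) \<delta> (ln (W k)) ((l + 1) * ln (W k) + ln (W (k - 1))))"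
proof (cases "\<exists>s w N \<delta> W. sturmian_data \<xi> s w N \<delta> W")
  case False
  \<comment> \<open>Without data for this \<open>\<xi>\<close> the claim is vacuous.\<close>
  then show ?thesis by (intro exI[of _ 1]) auto
next
  case True
  \<comment> \<open>One sequence is fixed for each \<open>\<xi>\<close>; three times its constant
    serves for all sequences, itself included.\<close>
  then obtain s0 w0 N0 \<delta>0 W0 where D0: "sturmian_data \<xi> s0 w0 N0 \<delta>0 W0" by blast
  then obtain B0 C0 K0 where M0: "sturmian_matrices s0 W0 \<delta>0 w0 N0 \<xi> B0 C0" "sturm_weights.regular_from W0 \<delta>0 K0"
    using sturmian_data_locale by blast
  interpret M0: sturmian_matrices s0 W0 \<delta>0 w0 N0 \<xi> B0 C0 by (rule M0)
  obtain \<kappa> where \<kappa>: "\<kappa> \<ge> 1" "\<forall>\<^sub>F k in sequentially. \<forall>l. int l < s0 (k + 1) \<longrightarrow>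
      approximable \<kappa> M0.u \<delta>0 (M0.x k) (M0.ell k (l + 1))" using M0.eventually_approximable by blast
  show ?thesis
  proof (intro exI[of _ "3 * \<kappa>"] conjI allI impI)
    show "1 \<le> 3 * \<kappa>" using \<kappa>(1) by simp
    fix s w N \<delta> W assume "sturmian_data \<xi> s w N \<delta> W"
    then obtain B C K where M: "sturmian_matrices s W \<delta> w N \<xi> B C" "sturm_weights.regular_from W \<delta> K"
      using sturmian_data_locale by blast
    interpret M: sturmian_matrices s W \<delta> w N \<xi> B C by (rule M)
    have "\<forall>\<^sub>F k in sequentially. \<forall>l. int l < s (k + 1) \<longrightarrow>
      approximable (3 * \<kappa>) M.u \<delta> (M.x k) ((l + 1) * M.x k + M.x (k - 1))"
      by (rule M.approximable_of_other_data[OF M0 \<kappa>(2,1) M(2)])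
    then show "\<forall>\<^sub>F k in sequentially. \<forall>l. int l < s (k + 1) \<longrightarrow>
      approximable (3 * \<kappa>) (vector [1, \<xi>, \<xi>\<^sup>2]) \<delta> (ln (W k)) ((l + 1) * ln (W k) + ln (W (k - 1)))"
      unfolding M.u_def M.x_def .
  qed
qed

theorem proposition7p16:
  fixes \<xi> :: real
  shows "\<exists>C>0. \<forall>(s :: nat \<Rightarrow> int) (w :: nat \<Rightarrow> int^2^2) (N :: int^2^2) (\<delta> :: real) (W :: nat \<Rightarrow> real).
    s 0 = -1 \<and> s 1 = 1 \<and> (\<forall>k\<ge>1. s k \<ge> 1) \<and> (\<exists>B. \<forall>k. \<bar>s k\<bar> \<le> B) \<and>
    sturmian s w \<and> admissible_with w N \<and> multiplicative_growth s w \<and>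
    filterlim (\<lambda>i. mnorm (w i)) at_top sequentially \<and> \<not> symmetric N \<and>
    \<delta> \<ge> 0 \<and> (\<lambda>i. \<bar>real_of_int (det (w i))\<bar>) \<in> \<Theta>(\<lambda>i. mnorm (w i) powr \<delta>) \<and>
    \<delta> < sturm_sigma s / (1 + sturm_sigma s) \<and>
    (\<exists>B. \<forall>i\<ge>-2. content (sturm_y s w N i) \<le> B) \<and>
    proj_tendsto (\<lambda>n. point (sturm_y s w N (int n))) (vector [1, \<xi>, \<xi>^2]) \<and>
    is_What s w W
    \<longrightarrow>
    (\<forall>\<^sub>F k0 in sequentially.
       valid_start W k0 \<and>
       three_system (qq s W \<delta> (tt s k0)) (Pmap s W \<delta> k0) \<and>
       (\<forall>i\<ge>tt s k0. Iset s W \<delta> k0 i = {aa s W \<delta> k0 i..bb s W \<delta> k0 i}) \<and>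
       combined_graph_type s k0 (Pmap s W \<delta> k0)
         (aa s W \<delta> k0) (qq s W \<delta>) (bb s W \<delta> k0) (cc s W \<delta>) (dd W \<delta>)) \<and>
    (\<forall>k0. valid_start W k0 \<longrightarrow>
       (let P = Pmap s W \<delta> k0; L = Lmap (vector [1, \<xi>, \<xi>^2]);
            a = aa s W \<delta> k0; b = bb s W \<delta> k0
        in (\<forall>\<^sub>F q in at_top. \<bar>L 1 q - P 1 q\<bar> \<le> C) \<and>
           (\<forall>\<^sub>F j in at_top. \<forall>q\<in>{a j..b j}. \<bar>L 2 q - P 2 q\<bar> \<le> C \<and> \<bar>L 3 q - P 3 q\<bar> \<le> C) \<and>
           (\<forall>\<^sub>F j in at_top. \<forall>q\<in>{b (j - 1)..a j}.
              P 2 q - C \<le> L 2 q \<and> L 2 q \<le> L 3 q \<and> L 3 q \<le> P 3 q + C)))"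
proof -
  define u :: "real^3" where "u = vector [1, \<xi>, \<xi>^2]"
  have u1: "u $ 1 = 1" by (simp add: u_def)
  obtain \<kappa> where \<kappa>: "\<kappa> \<ge> 1" and approx: "\<And>s w N \<delta> W. sturmian_data \<xi> s w N \<delta> W \<Longrightarrow>
     (\<forall>\<^sub>F k in sequentially. \<forall>l. int l < s (k + 1) \<longrightarrow> approximable \<kappa> u \<delta> (ln (W k)) ((l + 1) * ln (W k) + ln (W (k - 1))))"
    using sturmian_data_uniform[of \<xi>] unfolding u_def by blast
  \<comment> \<open>\<open>\<kappa>\<close> was obtained from \<open>\<xi>\<close> before any
    sequence was given, so \<open>C\<close> depends on \<open>\<xi>\<close> only. The summand
    \<open>ln 6\<close> is the loss in the determinant bound.\<close>
  define C where "C = 2 * ln (\<kappa>\<^sup>2 * norm u + 2 * \<kappa>) + ln 6"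
  have "C > 0"
  proof -
    have "0 \<le> \<kappa>\<^sup>2 * norm u" by simp
    then have "1 < \<kappa>\<^sup>2 * norm u + 2 * \<kappa>" using \<kappa> by linarith
    then show ?thesis unfolding C_def by (simp add: add_pos_pos)
  qed
  show ?thesis
  proof (intro exI[of _ C] conjI allI impI, goal_cases)
    case 1
    show ?case by (rule \<open>C > 0\<close>)
  next
    case (2 s w N \<delta> W)
    then have data: "sturmian_data \<xi> s w N \<delta> W" unfolding sturmian_data_def .
    obtain B C' K where M: "sturmian_matrices s W \<delta> w N \<xi> B C'" "sturm_weights.regular_from W \<delta> K"
      using sturmian_data_locale[OF data] by blast
    interpret M: sturmian_matrices s W \<delta> w N \<xi> B C' by (rule M)
    show ?case
    proof (rule eventually_sequentiallyI[of K])
      fix k0 assume "K \<le> k0"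
      then have reg: "M.regular_from k0" by (rule M.regular_from_mono[OF M(2)])
      have V: "valid_start W k0" by (rule M.regular_imp_valid[OF reg])
      show "valid_start W k0 \<and>
        three_system (qq s W \<delta> (tt s k0)) (Pmap s W \<delta> k0) \<and>
        (\<forall>i\<ge>tt s k0. Iset s W \<delta> k0 i = {aa s W \<delta> k0 i..bb s W \<delta> k0 i}) \<and>
        combined_graph_type s k0 (Pmap s W \<delta> k0)
          (aa s W \<delta> k0) (qq s W \<delta>) (bb s W \<delta> k0) (cc s W \<delta>) (dd W \<delta>)"
        using V M.graph_type[OF reg V order_refl M.W_lim refl] M.Iset_eq[OF reg V order_refl M.W_lim] by simp
    qed
  next
    case (3 s w N \<delta> W k0)
    then have data: "sturmian_data \<xi> s w N \<delta> W" unfolding sturmian_data_def by -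
    obtain B C' K where M: "sturmian_matrices s W \<delta> w N \<xi> B C'" "sturm_weights.regular_from W \<delta> K"
      using sturmian_data_locale[OF data] by blast
    interpret M: sturmian_matrices s W \<delta> w N \<xi> B C' by (rule M)
    have "\<forall>\<^sub>F k in sequentially. \<forall>l. int l < s (k + 1) \<longrightarrow>
        approximable \<kappa> u \<delta> (M.x k) ((l + 1) * M.x k + M.x (k - 1))"
      using approx[OF data] unfolding M.x_def .
    note close = M.close_if_approximable[OF u1 \<kappa> M.W_lim M(2) 3(2) this, folded C_def]
    show ?case unfolding Let_def using close unfolding u_def by blast
  qed
qed

end
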